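(* Let $D$ be a $2$-dimensional regular local ring and let $\mathcal{V}$ be a downset of $Q^*(D)$ that is a Noetherian space in the Zariski topology. Then for every Zariski open subset $\mathcal{U}$ of $\mathcal{V}$, the ring $\mathcal{O}_{\mathcal{U}}$ is a Noetherian normal domain.
   Context: $F$ is the quotient field of $D$. $L(D)$ is the set of local rings $R$ with $D\subseteq R\subseteq F$ and $\mathfrak{m}_R\cap D=\mathfrak{m}_D$; its Zariski topology has basis the sets $\{R\in L(D):x_1,\dots,x_n\in R\}$, $x_i\in F$, and subsets carry the subspace topology. $Q(D)$ is the set of $2$-dimensional regular local rings $\alpha$ with $D\subseteq\alpha\subseteq F$, and $Q^*(D)$ is the union of $Q(D)$ and all valuation rings in $L(D)$. A downset of $Q^*(D)$ is a subset $\mathcal{V}$ such that $\alpha\in Q^*(D)$, $\alpha\subseteq\beta\in\mathcal{V}$ imply $\alpha\in\mathcal{V}$. For $\mathcal{U}\subseteq Q^*(D)$, $\mathcal{O}_{\mathcal{U}}$ is the intersection of the rings in $\mathcal{U}$, with $\mathcal{O}_{\emptyset}=F$. *)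

theory Defs
  imports "HOL-Analysis.Analysis" "HOL-Library.Extended_Nat"
begin

text \<open>Throughout, the ambient field F is a type 'a :: field; subrings of F are sets of type 'a set.\<close>

definition subring :: "'a::field set \<Rightarrow> bool" where
  "subring R \<longleftrightarrow> 0 \<in> R \<and> 1 \<in> R \<and> (\<forall>x\<in>R. \<forall>y\<in>R. x + y \<in> R \<and> x * y \<in> R) \<and> (\<forall>x\<in>R. - x \<in> R)"

definition frac :: "'a::field set \<Rightarrow> 'a set" where
  "frac R = {a / b | a b. a \<in> R \<and> b \<in> R \<and> b \<noteq> 0}"

definition is_ideal :: "'a::field set \<Rightarrow> 'a set \<Rightarrow> bool" where
  "is_ideal I R \<longleftrightarrow> I \<subseteq> R \<and> 0 \<in> I \<and> (\<forall>x\<in>I. \<forall>y\<in>I. x + y \<in> I) \<and> (\<forall>r\<in>R. \<forall>x\<in>I. r * x \<in> I)"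

definition prime_ideal :: "'a::field set \<Rightarrow> 'a set \<Rightarrow> bool" where
  "prime_ideal P R \<longleftrightarrow> is_ideal P R \<and> P \<noteq> R \<and> (\<forall>a\<in>R. \<forall>b\<in>R. a * b \<in> P \<longrightarrow> a \<in> P \<or> b \<in> P)"

definition maximal_ideal :: "'a::field set \<Rightarrow> 'a set \<Rightarrow> bool" where
  "maximal_ideal M R \<longleftrightarrow> is_ideal M R \<and> M \<noteq> R \<and> (\<forall>J. is_ideal J R \<and> M \<subseteq> J \<longrightarrow> J = M \<or> J = R)"

definition local_ring :: "'a::field set \<Rightarrow> bool" where
  "local_ring R \<longleftrightarrow> subring R \<and> (\<exists>!M. maximal_ideal M R)"

definition max_ideal :: "'a::field set \<Rightarrow> 'a set" where
  "max_ideal R = (THE M. maximal_ideal M R)"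

definition noetherian_ring :: "'a::field set \<Rightarrow> bool" where
  "noetherian_ring R \<longleftrightarrow> subring R \<and>
     (\<forall>I :: nat \<Rightarrow> 'a set. (\<forall>n. is_ideal (I n) R) \<and> incseq I \<longrightarrow> (\<exists>N. \<forall>n\<ge>N. I n = I N))"

definition krull_dim :: "'a::field set \<Rightarrow> enat" where
  "krull_dim R = Sup {enat n | n. \<exists>P :: nat \<Rightarrow> 'a set.
      (\<forall>i\<le>n. prime_ideal (P i) R) \<and> (\<forall>i<n. P i \<subset> P (Suc i))}"

definition ideal_span :: "'a::field set \<Rightarrow> 'a set \<Rightarrow> 'a set" where
  "ideal_span R G = {(\<Sum>g\<in>G. c g * g) | c. \<forall>g\<in>G. c g \<in> R}"

definition regular_local_ring :: "'a::field set \<Rightarrow> bool" where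
  "regular_local_ring R \<longleftrightarrow> local_ring R \<and> noetherian_ring R \<and>
     (\<exists>d. krull_dim R = enat d \<and>
        (\<exists>G. finite G \<and> G \<subseteq> R \<and> card G \<le> d \<and> ideal_span R G = max_ideal R))"

definition valuation_ring :: "'a::field set \<Rightarrow> bool" where
  "valuation_ring R \<longleftrightarrow> subring R \<and> (\<forall>x. x \<noteq> 0 \<longrightarrow> x \<in> R \<or> inverse x \<in> R)"

definition integral_over :: "'a::field set \<Rightarrow> 'a \<Rightarrow> bool" where
  "integral_over R x \<longleftrightarrow> (\<exists>n c. n \<ge> 1 \<and> (\<forall>i<n. c i \<in> R) \<and> x ^ n + (\<Sum>i<n. c i * x ^ i) = 0)"

definition normal_domain :: "'a::field set \<Rightarrow> bool" where
  "normal_domain R \<longleftrightarrow> subring R \<and> (\<forall>x\<in>frac R. integral_over R x \<longrightarrow> x \<in> R)"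

definition LD :: "'a::field set \<Rightarrow> 'a set set" where
  "LD D = {R. local_ring R \<and> D \<subseteq> R \<and> max_ideal R \<inter> D = max_ideal D}"

definition QD :: "'a::field set \<Rightarrow> 'a set set" where
  "QD D = {\<alpha>. D \<subseteq> \<alpha> \<and> regular_local_ring \<alpha> \<and> krull_dim \<alpha> = 2}"

definition QstarD :: "'a::field set \<Rightarrow> 'a set set" where
  "QstarD D = QD D \<union> {R \<in> LD D. valuation_ring R}"

definition downset :: "'a::field set \<Rightarrow> 'a set set \<Rightarrow> bool" where
  "downset D V \<longleftrightarrow> V \<subseteq> QstarD D \<and>
     (\<forall>\<alpha>\<in>QstarD D. \<forall>\<beta>\<in>V. \<alpha> \<subseteq> \<beta> \<longrightarrow> \<alpha> \<in> V)"

definition zariski :: "'a::field set \<Rightarrow> 'a set topology" where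
  "zariski D = subtopology (topology_generated_by {{R. X \<subseteq> R} | X. finite X}) (LD D)"

definition noetherian_space :: "'b topology \<Rightarrow> bool" where
  "noetherian_space T \<longleftrightarrow>
     (\<forall>C :: nat \<Rightarrow> 'b set. (\<forall>n. closedin T (C n)) \<and> decseq C \<longrightarrow> (\<exists>N. \<forall>n\<ge>N. C n = C N))"

text \<open>O_U: intersection of the rings in U (with O_{} = F = UNIV).\<close>
definition OU :: "'a::field set set \<Rightarrow> 'a set" where
  "OU U = \<Inter> U"

end

theory Submission
  imports Defs "HOL-Computational_Algebra.Polynomial"
begin

text \<open>
  A Zariski open subset \<open>U\<close> of the Noetherian space \<open>V\<close> is quasi-compact, so membership in \<open>U\<close> is
  decided by finitely many elements \<open>f/g\<close> of the field. The points of the quadratic tree at which such an \<open>f/g\<close>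
  is undetermined (base points of the pencil \<open>(f, g)\<close>) are finite in number, because the colength of
  \<open>(f, g)\<close> drops strictly under a quadratic transform. If \<open>D \<in> U\<close>, then \<open>\<O>\<^sub>U = D\<close>.
  Otherwise, since \<open>V\<close> is a downset, every ring of \<open>U\<close> contains a ring of \<open>U\<close> that is an immediate successor, or the order valuation ring, of such a base point. Hence
  \<open>\<O>\<^sub>U\<close> is the intersection of localizations of \<open>D\<close> at height-one primes and of finitely many order
  valuation rings. Such a ring \<open>A\<close> is clearly normal. Unless \<open>A = D\<close>, some prime element \<open>g\<close> of
  \<open>D\<close> is inverted by all the localizations; every ideal of \<open>A\<close> is, up to \<open>g\<close>-torsion, generated by a
  single element, which reduces the claim to \<open>A/g\<^sup>NA\<close>. This module is filtered by ideals of the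
  rings \<open>A/P\<close> for the centers \<open>P\<close> of the order valuations, and these rings are Noetherian by a
  Krull--Akizuki argument.
\<close>

subsection \<open>Subrings of a field and lengths of chains of submodules\<close>

text \<open>All rings are subsets of one field, so no quotient is ever formed: divisibility is
  membership of a fraction, and a module M/N is seen only through the submodules between N and M.
  Length is measured over a smaller ring, ultimately D; this works because residue fields grow only
  by finite extensions along the tree. The obstacle is that the residue field of an order valuation
  is a field of rational functions in one variable over the residue field of its point, so A/P can
  have infinite length over D. Only the quotients of A/P by a nonzero element have finite length.
  Hence it is the Noetherian property, and not a length, that passes through the filtration of A/g^N
  A. Its factors are separated by making the finite family of valuation rings irredundant: some
  element then has a pole of exact order k at one of them and lies in all the other rings of the
  intersection. The colength drops because contraction along x^r turns a chain above the transformed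
  pencil into a chain above the pencil itself with at least one step to spare.\<close>

definition nonunits :: "'a::field set \<Rightarrow> 'a set" where
  "nonunits R = {a \<in> R. a = 0 \<or> inverse a \<notin> R}"

locale sring = fixes R :: "'a::field set" assumes sub: "subring R"
begin

lemma zero [simp]: "0 \<in> R" and one [simp]: "1 \<in> R"
  and add [simp]: "a \<in> R \<Longrightarrow> b \<in> R \<Longrightarrow> a + b \<in> R"
  and mult [simp]: "a \<in> R \<Longrightarrow> b \<in> R \<Longrightarrow> a * b \<in> R"
  and neg [simp]: "a \<in> R \<Longrightarrow> - a \<in> R"
  using sub unfolding subring_def by auto

lemma diff [simp]: "a \<in> R \<Longrightarrow> b \<in> R \<Longrightarrow> a - b \<in> R"
  using add[of a "-b"] neg[of b] by simp

lemma pow [simp]: "a \<in> R \<Longrightarrow> a ^ n \<in> R"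
  by (induction n) auto

lemma setsum [simp]: "(\<And>i. i \<in> I \<Longrightarrow> f i \<in> R) \<Longrightarrow> (\<Sum>i\<in>I. f i) \<in> R"
  by (induction I rule: infinite_finite_induct) auto

lemma div_trans: "b / a \<in> R \<Longrightarrow> c / b \<in> R \<Longrightarrow> b \<noteq> 0 \<Longrightarrow> c / a \<in> R"
  using mult[of "b/a" "c/b"] by simp

lemma div_mult: "b / a \<in> R \<Longrightarrow> c \<in> R \<Longrightarrow> b * c / a \<in> R" "b / a \<in> R \<Longrightarrow> c \<in> R \<Longrightarrow> c * b / a \<in> R"
  using mult[of "b/a" c] by (simp_all add: mult.commute)

lemma div_add: "b / a \<in> R \<Longrightarrow> c / a \<in> R \<Longrightarrow> (b + c) / a \<in> R"
  by (simp add: add_divide_distrib)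

lemma ideal_principal: assumes a: "a \<in> R" shows "is_ideal {a * r | r. r \<in> R} R"
  unfolding is_ideal_def
proof (intro conjI ballI)
  show "{a * r | r. r \<in> R} \<subseteq> R" using a by auto
  have "a * 0 \<in> {a * r | r. r \<in> R}" using zero by blast
  then show "0 \<in> {a * r | r. r \<in> R}" by simp
  fix u v assume "u \<in> {a * r | r. r \<in> R}" "v \<in> {a * r | r. r \<in> R}"
  then obtain r s where "u = a * r" "v = a * s" "r \<in> R" "s \<in> R" by auto
  then have "u + v = a * (r + s)" "r + s \<in> R" by (auto simp: algebra_simps)
  then show "u + v \<in> {a * r | r. r \<in> R}" by blast
next
  fix u v assume u: "u \<in> R" "v \<in> {a * r | r. r \<in> R}"
  then obtain r where "v = a * r" "r \<in> R" by auto
  then have "u * v = a * (u * r)" "u * r \<in> R" using u by (auto simp: algebra_simps)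
  then show "u * v \<in> {a * r | r. r \<in> R}" by blast
qed

lemma nonunitD: "a \<in> nonunits R \<Longrightarrow> a \<in> R" by (auto simp: nonunits_def)
lemma nonunit0 [simp]: "0 \<in> nonunits R" by (auto simp: nonunits_def)
lemma one_nonunit [simp]: "1 \<notin> nonunits R" by (auto simp: nonunits_def)
lemma unitD: "a \<in> R \<Longrightarrow> a \<notin> nonunits R \<Longrightarrow> a \<noteq> 0 \<and> inverse a \<in> R" by (auto simp: nonunits_def)
lemma nonunit_mult: assumes "a \<in> nonunits R" "b \<in> R" shows "a * b \<in> nonunits R"
proof -
  have "inverse a \<in> R" if "inverse (a * b) \<in> R" "a * b \<noteq> 0"
  proof -
    have "inverse (a * b) * b = inverse a" using that(2) by (simp add: field_simps)
    then show ?thesis using mult[OF that(1) assms(2)] by (simp only:)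
  qed
  then show ?thesis using assms by (auto simp: nonunits_def)
qed

lemma nonunit_mult2: "a \<in> nonunits R \<Longrightarrow> b \<in> R \<Longrightarrow> b * a \<in> nonunits R"
  using nonunit_mult by (simp add: mult.commute)

lemma nonunit_prime: assumes "a \<in> R" "b \<in> R" "a * b \<in> nonunits R" shows "a \<in> nonunits R \<or> b \<in> nonunits R"
proof (rule ccontr)
  assume "\<not> ?thesis"
  then have "a \<noteq> 0" "b \<noteq> 0" "inverse a \<in> R" "inverse b \<in> R" using assms unitD by auto
  then show False using assms mult[of "inverse a" "inverse b"] by (auto simp: nonunits_def)
qed

lemma nonunit_pow: "a \<in> R \<Longrightarrow> a ^ n \<in> nonunits R \<Longrightarrow> a \<in> nonunits R"
proof (induction n)
  case (Suc n) then show ?case using nonunit_prime[of a "a ^ n"] by auto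
qed auto

lemma ideal_neg: "is_ideal I R \<Longrightarrow> a \<in> I \<Longrightarrow> - a \<in> I"
proof -
  assume a: "is_ideal I R" "a \<in> I"
  have "-1 \<in> R" by simp
  then have "(-1) * a \<in> I" using a unfolding is_ideal_def by blast
  then show ?thesis by simp
qed

lemma ideal_diff: "is_ideal I R \<Longrightarrow> a \<in> I \<Longrightarrow> b \<in> I \<Longrightarrow> a - b \<in> I"
  using ideal_neg[of I b] unfolding is_ideal_def by (metis add_uminus_conv_diff)

lemma ideal_unit: assumes "is_ideal I R" "a \<in> I" "a \<notin> nonunits R" shows "I = R"
proof -
  have "a \<in> R" using assms by (auto simp: is_ideal_def)
  then have "a \<noteq> 0" "inverse a \<in> R" using assms unitD by auto
  then have "1 \<in> I" using assms by (auto simp: is_ideal_def) (metis left_inverse)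
  then have "r \<in> I" if "r \<in> R" for r using assms that by (auto simp: is_ideal_def) (metis mult.right_neutral)
  then show ?thesis using assms by (auto simp: is_ideal_def)
qed

text \<open>\<open>max_ideal\<close> is a definite description. Additive closure of
  \<open>nonunits\<close> identifies it, and this closure is the form in which locality is used from
  here on, for Noetherian rings and valuation rings alike.\<close>

lemma nonunit_max:
  assumes "\<And>a b. a \<in> nonunits R \<Longrightarrow> b \<in> nonunits R \<Longrightarrow> a + b \<in> nonunits R"
  shows "local_ring R" "max_ideal R = nonunits R" "is_ideal (nonunits R) R"
proof -
  show id: "is_ideal (nonunits R) R" unfolding is_ideal_def
  proof (intro conjI ballI)
    show "nonunits R \<subseteq> R" using nonunitD by blast
    show "0 \<in> nonunits R" by (rule nonunit0)
    show "a \<in> nonunits R \<Longrightarrow> b \<in> nonunits R \<Longrightarrow> a + b \<in> nonunits R" for a b by (rule assms)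
    show "r \<in> R \<Longrightarrow> a \<in> nonunits R \<Longrightarrow> r * a \<in> nonunits R" for r a by (rule nonunit_mult2)
  qed
  have m: "maximal_ideal (nonunits R) R" unfolding maximal_ideal_def
  proof (intro conjI allI impI id)
    show "nonunits R \<noteq> R" using one_nonunit one by metis
    fix J assume J: "is_ideal J R \<and> nonunits R \<subseteq> J"
    show "J = nonunits R \<or> J = R" using ideal_unit[of J] J by blast
  qed
  have u: "M = nonunits R" if "maximal_ideal M R" for M
  proof -
    have "M \<subseteq> nonunits R" using that ideal_unit unfolding maximal_ideal_def by blast
    then show ?thesis using that id unfolding maximal_ideal_def using one_nonunit one by metis
  qed
  show "local_ring R" unfolding local_ring_def using sub m u by blast
  show "max_ideal R = nonunits R" unfolding max_ideal_def by (rule the_equality, rule m, rule u)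
qed

end

lemma is_idealI:
  assumes "I \<subseteq> R" "0 \<in> I" "\<And>x y. x \<in> I \<Longrightarrow> y \<in> I \<Longrightarrow> x + y \<in> I" "\<And>r x. r \<in> R \<Longrightarrow> x \<in> I \<Longrightarrow> r * x \<in> I"
  shows "is_ideal I R"
  using assms by (auto simp: is_ideal_def)

lemma noeth_max:
  assumes "noetherian_ring R" "S \<noteq> {}" "\<And>I. I \<in> S \<Longrightarrow> is_ideal I R"
  shows "\<exists>M\<in>S. \<forall>J\<in>S. M \<subseteq> J \<longrightarrow> J = M"
proof (rule ccontr)
  assume "\<not> ?thesis"
  then have n: "\<forall>M\<in>S. \<exists>J\<in>S. M \<subset> J" by blast
  obtain M0 where M0: "M0 \<in> S" using assms by auto
  obtain g where g: "\<And>M. M \<in> S \<Longrightarrow> g M \<in> S \<and> M \<subset> g M" using n by metis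
  define f where "f n = (g ^^ n) M0" for n
  have f1: "f n \<in> S" for n by (induction n) (auto simp: f_def M0 g)
  have f: "f n \<in> S" "f n \<subset> f (Suc n)" for n using f1 g by (auto simp: f_def)
  have "incseq f" using f(2) by (intro incseq_SucI) auto
  then obtain N where "\<forall>n\<ge>N. f n = f N" using assms f unfolding noetherian_ring_def by meson
  then have "f (Suc N) = f N" by (meson le_Suc_eq order_refl)
  with f(2)[of N] show False by auto
qed

locale nring = sring + assumes noeth: "noetherian_ring R"
begin

text \<open>In a Noetherian ring the proper ideals containing a given nonunit have a maximal member,
  so every nonunit lies in the unique maximal ideal.\<close>

lemma regular_max:
  assumes "local_ring R"
  shows "max_ideal R = nonunits R" "a \<in> nonunits R \<Longrightarrow> b \<in> nonunits R \<Longrightarrow> a + b \<in> nonunits R"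
proof -
  obtain M where M: "maximal_ideal M R" "\<And>N. maximal_ideal N R \<Longrightarrow> N = M" using assms unfolding local_ring_def by blast
  have "M \<subseteq> nonunits R" using M(1) ideal_unit unfolding maximal_ideal_def by blast
  moreover have "a \<in> M" if a: "a \<in> nonunits R" for a
  proof -
    let ?S = "{I. is_ideal I R \<and> I \<noteq> R \<and> a \<in> I}"
    have aR: "a \<in> R" using a nonunitD by auto
    have "{a * r | r. r \<in> R} \<noteq> R" 
    proof
      assume "{a * r | r. r \<in> R} = R"
      then have "1 \<in> {a * r | r. r \<in> R}" using one by blast
      then obtain r where "1 = a * r" "r \<in> R" by blast
      then show False using nonunit_mult[OF a] one_nonunit by metis
    qed
    moreover have "a * 1 \<in> {a * r | r. r \<in> R}" using one by blast
    ultimately have "{a * r | r. r \<in> R} \<in> ?S" using ideal_principal[OF aR] by simp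
    then have "?S \<noteq> {}" by blast
    from noeth_max[OF noeth this] obtain I where I: "I \<in> ?S" "\<forall>J\<in>?S. I \<subseteq> J \<longrightarrow> J = I" by auto
    then have "maximal_ideal I R" unfolding maximal_ideal_def by blast
    then show ?thesis using M I by auto
  qed
  ultimately have e: "M = nonunits R" by auto
  show "max_ideal R = nonunits R" unfolding max_ideal_def e[symmetric] by (rule the_equality, rule M(1), rule M(2))
  have "is_ideal (nonunits R) R" using M(1) e unfolding maximal_ideal_def by simp
  then show "a \<in> nonunits R \<Longrightarrow> b \<in> nonunits R \<Longrightarrow> a + b \<in> nonunits R" unfolding is_ideal_def by simp
qed

text \<open>Each \<open>a n\<close> is a multiple of \<open>a (Suc n)\<close>, so the principal
  ideals ascend and two neighbours coincide. Applied with \<open>a n = c / x ^ n\<close> this rules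
  out infinite divisibility by x, because t becomes an inverse of x.\<close>

lemma principal_chain:
  assumes "\<And>n. a n \<in> R" "\<And>n. a n = x * a (Suc n)" "x \<in> R" 
  shows "\<exists>n. \<exists>t\<in>R. a (Suc n) = a n * t"
proof -
  define I where "I n = {a n * r | r. r \<in> R}" for n
  have "incseq I"
  proof (rule incseq_SucI, rule subsetI)
    fix n z assume "z \<in> I n"
    then obtain r where "z = a n * r" "r \<in> R" by (auto simp: I_def)
    then have "z = a (Suc n) * (x * r)" "x * r \<in> R" using assms(2)[of n] assms(3) by (auto simp: mult_ac)
    then show "z \<in> I (Suc n)" unfolding I_def by blast
  qed
  moreover have "\<forall>n. is_ideal (I n) R" unfolding I_def by (intro allI ideal_principal assms)
  ultimately obtain N where "\<forall>n\<ge>N. I n = I N" using noeth unfolding noetherian_ring_def by meson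
  then have "I (Suc N) = I N" by (meson le_Suc_eq order_refl)
  moreover have "a (Suc N) * 1 \<in> I (Suc N)" unfolding I_def using one by blast
  ultimately show ?thesis by (auto simp: I_def)
qed

end

section \<open>Submodules of the ambient field over a subring\<close>

definition submod :: "'a::field set \<Rightarrow> 'a set \<Rightarrow> bool" where
  "submod R M \<longleftrightarrow> 0 \<in> M \<and> (\<forall>a\<in>M. \<forall>b\<in>M. a + b \<in> M) \<and> (\<forall>r\<in>R. \<forall>a\<in>M. r * a \<in> M)"

lemma ideal_submod: "is_ideal I R \<longleftrightarrow> I \<subseteq> R \<and> submod R I"
  by (auto simp: is_ideal_def submod_def)

lemma submodI:
  assumes "0 \<in> M" "\<And>a b. a \<in> M \<Longrightarrow> b \<in> M \<Longrightarrow> a + b \<in> M" "\<And>r a. r \<in> R \<Longrightarrow> a \<in> M \<Longrightarrow> r * a \<in> M"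
  shows "submod R M" using assms by (auto simp: submod_def)

lemma submodD: assumes "submod R M" 
  shows "0 \<in> M" "a \<in> M \<Longrightarrow> b \<in> M \<Longrightarrow> a + b \<in> M" "r \<in> R \<Longrightarrow> a \<in> M \<Longrightarrow> r * a \<in> M"
  using assms by (auto simp: submod_def)

definition ssum :: "'a::field set \<Rightarrow> 'a set \<Rightarrow> 'a set" where
  "ssum M N = {a + b | a b. a \<in> M \<and> b \<in> N}"

lemma ssum_submod: assumes M: "submod R M" and N: "submod R N" shows "submod R (ssum M N)"
proof (rule submodI)
  have "0 + 0 \<in> ssum M N" using submodD(1)[OF M] submodD(1)[OF N] unfolding ssum_def by blast
  then show "0 \<in> ssum M N" by simp
next
  fix a b assume "a \<in> ssum M N" "b \<in> ssum M N"
  then obtain p q r s where "a = p + q" "b = r + s" "p \<in> M" "q \<in> N" "r \<in> M" "s \<in> N" by (auto simp: ssum_def)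
  then have "a + b = (p + r) + (q + s)" "p + r \<in> M" "q + s \<in> N" using submodD[OF M] submodD[OF N] by auto
  then show "a + b \<in> ssum M N" unfolding ssum_def by blast
next
  fix t a assume t: "t \<in> R" "a \<in> ssum M N"
  then obtain p q where "a = p + q" "p \<in> M" "q \<in> N" by (auto simp: ssum_def)
  then have "t * a = t * p + t * q" "t * p \<in> M" "t * q \<in> N" using t submodD[OF M] submodD[OF N] by (auto simp: distrib_left)
  then show "t * a \<in> ssum M N" unfolding ssum_def by blast
qed

lemma ssum_mono: "M \<subseteq> M' \<Longrightarrow> N \<subseteq> N' \<Longrightarrow> ssum M N \<subseteq> ssum M' N'" by (auto simp: ssum_def)
lemma ssum_iff: "z \<in> ssum M N \<longleftrightarrow> (\<exists>a\<in>M. \<exists>b\<in>N. z = a + b)" by (auto simp: ssum_def)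
lemma ssum_sup1: assumes "submod R N" shows "M \<subseteq> ssum M N"
proof
  fix a assume "a \<in> M"
  moreover have "a = a + 0" "0 \<in> N" using submodD(1)[OF assms] by auto
  ultimately show "a \<in> ssum M N" unfolding ssum_iff by blast
qed
lemma ssum_sup2: assumes "submod R M" shows "N \<subseteq> ssum M N"
proof
  fix a assume "a \<in> N"
  moreover have "a = 0 + a" "0 \<in> M" using submodD(1)[OF assms] by auto
  ultimately show "a \<in> ssum M N" unfolding ssum_iff by blast
qed
lemma ssum_least: "submod R L \<Longrightarrow> M \<subseteq> L \<Longrightarrow> N \<subseteq> L \<Longrightarrow> ssum M N \<subseteq> L"
  unfolding ssum_def using submodD(2) by blast

lemma submod_smult: assumes M: "submod R M" shows "submod R ((*) a ` M)"
proof (rule submodI)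
  have "a * 0 \<in> (*) a ` M" using submodD(1)[OF M] by blast
  then show "0 \<in> (*) a ` M" by simp
  fix u v assume "u \<in> (*) a ` M" "v \<in> (*) a ` M"
  then obtain p q where "u = a * p" "v = a * q" "p \<in> M" "q \<in> M" by auto
  then have "u + v = a * (p + q)" "p + q \<in> M" using submodD[OF M] by (auto simp: algebra_simps)
  then show "u + v \<in> (*) a ` M" by blast
next
  fix t u assume t: "t \<in> R" "u \<in> (*) a ` M"
  then obtain p where "u = a * p" "p \<in> M" by auto
  then have "t * u = a * (t * p)" "t * p \<in> M" using submodD(3)[OF M t(1)] by (simp_all add: mult_ac)
  then show "t * u \<in> (*) a ` M" by blast
qed

lemma submod_Int: "submod R M \<Longrightarrow> submod R N \<Longrightarrow> submod R (M \<inter> N)" by (auto simp: submod_def)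
lemma submod_mono: "submod R M \<Longrightarrow> R' \<subseteq> R \<Longrightarrow> submod R' M" by (auto simp: submod_def)
lemma (in sring) submod_self: "submod R R" by (auto simp: submod_def)
lemma submod_vimage: "submod R M \<Longrightarrow> submod R {r. r * a \<in> M}"
  by (auto simp: submod_def distrib_right mult.assoc)
lemma (in sring) submod_line: "submod R {r * a | r. r \<in> R}"
proof -
  have "{r * a | r. r \<in> R} = (*) a ` R" by (auto simp: mult.commute)
  then show ?thesis using submod_smult[OF submod_self, of a] by simp
qed
lemma (in sring) submod_diff: assumes M: "submod R M" and "a \<in> M" "b \<in> M" shows "a - b \<in> M"
proof -
  have "-1 \<in> R" by simp
  then have "(-1) * b \<in> M" using submodD(3)[OF M] assms by blast
  then have "a + (-1) * b \<in> M" using submodD(2)[OF M] assms by blast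
  then show ?thesis by simp
qed

text \<open>A form of Nakayama's lemma: only chains of ideals \<open>N + pR\<close> are needed, so no finiteness
  assumption on \<open>P\<close> appears.\<close>
lemma (in nring) nakayama:
  assumes localization: "\<And>a b. a \<in> nonunits R \<Longrightarrow> b \<in> nonunits R \<Longrightarrow> a + b \<in> nonunits R"
    and x: "x \<in> nonunits R" and P: "P \<subseteq> R" and N: "is_ideal N R"
    and step: "\<And>p. p \<in> P \<Longrightarrow> \<exists>p'\<in>P. p - x * p' \<in> N"
  shows "P \<subseteq> N"
proof
  fix p0 assume p0: "p0 \<in> P"
  have xR: "x \<in> R" using x nonunitD by auto
  obtain p where p: "p 0 = p0" "\<And>n. p n \<in> P" "\<And>n. p n - x * p (Suc n) \<in> N"
  proof -
    have "\<exists>p. p 0 = p0 \<and> (\<forall>n. p n \<in> P) \<and> (\<forall>n. p n - x * p (Suc n) \<in> N)"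
    proof -
      have "\<exists>f. \<forall>q. q \<in> P \<longrightarrow> f q \<in> P \<and> q - x * f q \<in> N" using step by (metis)
      then obtain f where f: "\<And>q. q \<in> P \<Longrightarrow> f q \<in> P \<and> q - x * f q \<in> N" by auto
      define p where "p n = (f ^^ n) p0" for n
      have "p n \<in> P" for n by (induction n) (auto simp: p_def p0 f)
      then show ?thesis using f by (intro exI[of _ p]) (auto simp: p_def)
    qed
    then show ?thesis using that by auto
  qed
  have pR: "p n \<in> R" for n using p P by auto
  \<comment> \<open>The congruence \<open>p n - x * p (Suc n) \<in> N\<close> makes these ideals
    ascend. Where they stall, \<open>p (Suc M)\<close> is congruent to t times \<open>p M\<close>,
    hence to \<open>x * t\<close> times itself, and \<open>1 - x * t\<close> is a unit.\<close>
  define I where "I n = ssum N {r * p n | r. r \<in> R}" for n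
  have Nsm: "submod R N" and NR: "N \<subseteq> R" using N by (auto simp: ideal_submod)
  note Nadd = submodD[OF Nsm]
  have "is_ideal (I n) R" for n
    unfolding ideal_submod I_def
  proof
    have "{r * p n |r. r \<in> R} \<subseteq> R" using pR by auto
    then show "ssum N {r * p n |r. r \<in> R} \<subseteq> R" by (rule ssum_least[OF submod_self NR])
    show "submod R (ssum N {r * p n |r. r \<in> R})" by (rule ssum_submod[OF Nsm submod_line])
  qed
  moreover have "incseq I"
  proof (rule incseq_SucI, rule subsetI)
    fix n z assume "z \<in> I n"
    then obtain u r where z: "z = u + r * p n" "u \<in> N" "r \<in> R" unfolding I_def ssum_iff by blast
    define v where "v = p n - x * p (Suc n)"
    have "v \<in> N" using p(3)[of n] by (simp only: v_def)
    then have "u + r * v \<in> N" using z(2,3) Nadd by blast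
    moreover have "z = (u + r * v) + (r * x) * p (Suc n)" using z(1) by (simp add: v_def algebra_simps)
    moreover have "r * x \<in> R" using z(3) xR by simp
    ultimately show "z \<in> I (Suc n)" unfolding I_def ssum_iff by blast
  qed
  ultimately obtain M where "\<forall>n\<ge>M. I n = I M" using noeth unfolding noetherian_ring_def by meson
  then have "I (Suc M) = I M" by (meson le_Suc_eq order_refl)
  moreover have "1 * p (Suc M) \<in> {r * p (Suc M) | r. r \<in> R}" using one by blast
  then have "1 * p (Suc M) \<in> I (Suc M)" unfolding I_def by (rule subsetD[OF ssum_sup2[OF Nsm]])
  then have "p (Suc M) \<in> I (Suc M)" by (simp only: mult_1_left)
  ultimately have "p (Suc M) \<in> I M" by (simp only:)
  then obtain u t where ut: "p (Suc M) = u + t * p M" "u \<in> N" "t \<in> R" unfolding I_def ssum_iff by blast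
  define v where "v = p M - x * p (Suc M)"
  have v: "v \<in> N" using p(3)[of M] by (simp only: v_def)
  have e: "p (Suc M) * (1 - x * t) = u + t * v" using ut(1) by (simp add: v_def algebra_simps)
  have "1 - x * t \<notin> nonunits R"
  proof
    assume "1 - x * t \<in> nonunits R"
    then have "(1 - x * t) + x * t \<in> nonunits R" using localization nonunit_mult[OF x ut(3)] by blast
    then show False by simp
  qed
  moreover have "1 - x * t \<in> R" using xR ut(3) by simp
  ultimately have w: "1 - x * t \<noteq> 0" "inverse (1 - x * t) \<in> R" using unitD by auto
  have "p (Suc M) = inverse (1 - x * t) * (u + t * v)" using e w(1) by (simp add: field_simps)
  also have "\<dots> \<in> N" using w(2) ut(2,3) v Nadd by blast
  finally have M: "p (Suc M) \<in> N" .
  have "p k \<in> N" if "k \<le> Suc M" for k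
    using that
  proof (induction k rule: inc_induct)
    case base show ?case by (rule M)
  next
    case (step k)
    have "p k = (p k - x * p (Suc k)) + x * p (Suc k)" by simp
    then show ?case using Nadd(2)[OF p(3)[of k] Nadd(3)[OF xR step(3)]] by simp
  qed
  then show "p0 \<in> N" using p(1) by auto
qed

text \<open>Chains may stall and only their proper steps are counted, so that intersecting a chain with a
  fixed submodule, or adding one to it, again yields a chain.\<close>
definition chain_in :: "'a::field set \<Rightarrow> 'a set \<Rightarrow> 'a set \<Rightarrow> (nat \<Rightarrow> 'a set) \<Rightarrow> nat \<Rightarrow> bool" where
  "chain_in R N M K k \<longleftrightarrow> (\<forall>i\<le>k. submod R (K i) \<and> N \<subseteq> K i \<and> K i \<subseteq> M) \<and> (\<forall>i<k. K i \<subseteq> K (Suc i))"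

definition steps :: "(nat \<Rightarrow> 'a set) \<Rightarrow> nat \<Rightarrow> nat set" where
  "steps K k = {i. i < k \<and> K i \<noteq> K (Suc i)}"

definition chain_ge :: "'a::field set \<Rightarrow> 'a set \<Rightarrow> 'a set \<Rightarrow> nat \<Rightarrow> bool" where
  "chain_ge R N M s \<longleftrightarrow> (\<exists>K k. chain_in R N M K k \<and> s \<le> card (steps K k))"

definition length_le :: "'a::field set \<Rightarrow> 'a set \<Rightarrow> 'a set \<Rightarrow> nat \<Rightarrow> bool" where
  "length_le R N M n \<longleftrightarrow> (\<forall>s. chain_ge R N M s \<longrightarrow> s \<le> n)"

lemma steps_fin: "finite (steps K k)" by (auto simp: steps_def)

lemma chain_inD:
  assumes "chain_in R N M K k"
  shows "i \<le> k \<Longrightarrow> submod R (K i)" "i \<le> k \<Longrightarrow> N \<subseteq> K i" "i \<le> k \<Longrightarrow> K i \<subseteq> M"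
    "i < k \<Longrightarrow> K i \<subseteq> K (Suc i)"
  using assms unfolding chain_in_def by simp_all

lemma chain_inI:
  assumes "\<And>i. i \<le> k \<Longrightarrow> submod R (K i)" "\<And>i. i \<le> k \<Longrightarrow> N \<subseteq> K i" "\<And>i. i \<le> k \<Longrightarrow> K i \<subseteq> M"
    "\<And>i. i < k \<Longrightarrow> K i \<subseteq> K (Suc i)"
  shows "chain_in R N M K k"
  using assms unfolding chain_in_def by simp

lemma hcI: "chain_in R N M K k \<Longrightarrow> s \<le> card (steps K k) \<Longrightarrow> chain_ge R N M s"
  unfolding chain_ge_def by blast

lemma chain_in_mono: "chain_in R N M K k \<Longrightarrow> N' \<subseteq> N \<Longrightarrow> M \<subseteq> M' \<Longrightarrow> chain_in R N' M' K k"
  unfolding chain_in_def by (meson order_trans)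

lemma chain_ge_mono: "chain_ge R N M s \<Longrightarrow> N' \<subseteq> N \<Longrightarrow> M \<subseteq> M' \<Longrightarrow> s' \<le> s \<Longrightarrow> chain_ge R N' M' s'"
  unfolding chain_ge_def using chain_in_mono order_trans by metis

lemma length_mono: "length_le R N M n \<Longrightarrow> N \<subseteq> N' \<Longrightarrow> M' \<subseteq> M \<Longrightarrow> n \<le> n' \<Longrightarrow> length_le R N' M' n'"
  unfolding length_le_def using chain_ge_mono[OF _ _ _ order_refl] order_trans by metis

lemma bdD: "length_le R N M n \<Longrightarrow> chain_in R N M K k \<Longrightarrow> card (steps K k) \<le> n"
  unfolding length_le_def chain_ge_def by blast

lemma bdI: "(\<And>K k. chain_in R N M K k \<Longrightarrow> card (steps K k) \<le> n) \<Longrightarrow> length_le R N M n"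
  unfolding length_le_def chain_ge_def using order_trans by blast

text \<open>The second chain is appended with index shift \<open>Suc k1\<close>. The joining step
  from \<open>K1 k1\<close> to \<open>K2 0\<close> may or may not be proper; only the steps inside
  the two pieces are counted.\<close>

lemma chain_ge_concat:
  assumes "chain_ge R N L a" "chain_ge R L M b" "N \<subseteq> L" "L \<subseteq> M"
  shows "chain_ge R N M (a + b)"
proof -
  obtain K1 k1 where 1: "chain_in R N L K1 k1" and a: "a \<le> card (steps K1 k1)" using assms(1) unfolding chain_ge_def by blast
  obtain K2 k2 where 2: "chain_in R L M K2 k2" and b: "b \<le> card (steps K2 k2)" using assms(2) unfolding chain_ge_def by blast
  note c1 = chain_inD[OF chain_in_mono[OF 1 order_refl assms(4)]]
  note c2 = chain_inD[OF chain_in_mono[OF 2 assms(3) order_refl]]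
  define K where "K i = (if i \<le> k1 then K1 i else K2 (i - Suc k1))" for i
  define m where "m = Suc (k1 + k2)"
  have Ka: "K i = K1 i" if "i \<le> k1" for i using that by (simp add: K_def)
  have Kb: "K (j + Suc k1) = K2 j" for j by (simp add: K_def)
  have sa: "i \<in> steps K m" if "i \<in> steps K1 k1" for i
    using that Ka[of i] Ka[of "Suc i"] by (auto simp: steps_def m_def)
  have sb: "j + Suc k1 \<in> steps K m" if "j \<in> steps K2 k2" for j
    using that Kb[of j] Kb[of "Suc j"] by (auto simp: steps_def m_def)
  let ?B = "(\<lambda>i. i + Suc k1) ` steps K2 k2"
  have cB: "card ?B = card (steps K2 k2)" by (rule card_image) (auto intro: inj_onI)
  have "card (steps K1 k1 \<union> ?B) = card (steps K1 k1) + card ?B"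
  proof (rule card_Un_disjoint)
    show "finite (steps K1 k1)" "finite ?B" by (simp_all add: steps_fin)
    show "steps K1 k1 \<inter> ?B = {}" by (auto simp: steps_def)
  qed
  moreover have "card (steps K1 k1 \<union> ?B) \<le> card (steps K m)"
  proof (rule card_mono[OF steps_fin], rule Un_least)
    show "steps K1 k1 \<subseteq> steps K m" by (rule subsetI, rule sa)
    show "?B \<subseteq> steps K m" by (rule image_subsetI, rule sb)
  qed
  ultimately have s: "a + b \<le> card (steps K m)" using a b cB by linarith
  have "chain_in R N M K m"
  proof (rule chain_inI)
    fix i assume i: "i \<le> m"
    have "submod R (K i) \<and> N \<subseteq> K i \<and> K i \<subseteq> M"
    proof (cases "i \<le> k1")
      case True then show ?thesis using c1[of i] Ka[of i] by simp
    next
      case False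
      then obtain j where j: "i = j + Suc k1" by (metis add.commute le_Suc_ex not_less_eq_eq)
      then have "j \<le> k2" using i by (simp add: m_def)
      then show ?thesis using c2[of j] Kb[of j] j by simp
    qed
    then show "submod R (K i)" "N \<subseteq> K i" "K i \<subseteq> M" by simp_all
  next
    fix i assume i: "i < m"
    consider "i < k1" | "i = k1" | "i > k1" by linarith
    then show "K i \<subseteq> K (Suc i)"
    proof cases
      case 1 then show ?thesis using c1(4)[of i] Ka by simp
    next
      case 2
      have "K1 k1 \<subseteq> K2 0" using chain_inD(3)[OF \<open>chain_in R N L K1 k1\<close>, of k1] chain_inD(2)[OF \<open>chain_in R L M K2 k2\<close>, of 0] by simp
      then show ?thesis using Ka[of i] Kb[of 0] 2 by simp
    next
      case 3
      then obtain j where j: "i = j + Suc k1" by (metis add.commute le_Suc_ex Suc_leI)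
      then have "j < k2" using i by (simp add: m_def)
      then show ?thesis using c2(4)[of j] Kb[of j] Kb[of "Suc j"] j by simp
    qed
  qed
  then show ?thesis using s by (rule hcI)
qed

text \<open>A chain K is split into its intersections with L and its sums with L. By the modular law
  a proper step of K stays proper in at least one of the two.\<close>

lemma (in sring) length_add:
  assumes "length_le R N L a" "length_le R L M b" "submod R L" "N \<subseteq> L" "L \<subseteq> M" "submod R M"
  shows "length_le R N M (a + b)"
proof (rule bdI)
  fix K k assume ch: "chain_in R N M K k"
  note K = chain_inD[OF ch]
  define A where "A i = K i \<inter> L" for i
  define B where "B i = ssum (K i) L" for i
  have "chain_in R N L A k"
  proof (rule chain_inI)
    fix i assume i: "i \<le> k"
    show "submod R (A i)" unfolding A_def by (rule submod_Int[OF K(1)[OF i] assms(3)])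
    show "N \<subseteq> A i" "A i \<subseteq> L" using K(2)[OF i] assms(4) by (auto simp: A_def)
  next
    fix i assume "i < k" then show "A i \<subseteq> A (Suc i)" unfolding A_def using K(4) by blast
  qed
  then have a: "card (steps A k) \<le> a" using bdD[OF assms(1)] by blast
  have "chain_in R L M B k"
  proof (rule chain_inI)
    fix i assume i: "i \<le> k"
    show "submod R (B i)" unfolding B_def by (rule ssum_submod[OF K(1)[OF i] assms(3)])
    show "L \<subseteq> B i" unfolding B_def by (rule ssum_sup2[OF K(1)[OF i]])
    show "B i \<subseteq> M" unfolding B_def by (rule ssum_least[OF assms(6) K(3)[OF i] assms(5)])
  next
    fix i assume "i < k" then show "B i \<subseteq> B (Suc i)" unfolding B_def using K(4) by (intro ssum_mono) auto
  qed
  then have b: "card (steps B k) \<le> b" using bdD[OF assms(2)] by blast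
  have "steps K k \<subseteq> steps A k \<union> steps B k"
  proof (rule subsetI)
    fix i assume i: "i \<in> steps K k"
    then have ik: "i < k" and ne: "K i \<noteq> K (Suc i)" by (simp_all add: steps_def)
    have sm: "submod R (K i)" "submod R (K (Suc i))" "K i \<subseteq> K (Suc i)" using K(1)[of i] K(1)[of "Suc i"] K(4)[of i] ik by auto
    show "i \<in> steps A k \<union> steps B k"
    proof (rule ccontr)
      assume "i \<notin> steps A k \<union> steps B k"
      then have e: "A i = A (Suc i)" "B i = B (Suc i)" using ik by (simp_all add: steps_def)
      have "z \<in> K i" if z: "z \<in> K (Suc i)" for z
      proof -
        have "z \<in> B (Suc i)" unfolding B_def by (rule subsetD[OF ssum_sup1[OF assms(3)] z])
        then obtain p q where pq: "z = p + q" "p \<in> K i" "q \<in> L" unfolding e(2)[symmetric] unfolding B_def ssum_iff by blast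
        have "q = z - p" using pq by simp
        moreover have "p \<in> K (Suc i)" using pq(2) sm(3) by blast
        ultimately have "q \<in> K (Suc i)" using submod_diff[OF sm(2) z] by simp
        then have "q \<in> A (Suc i)" using pq by (simp add: A_def)
        then have "q \<in> K i" unfolding e(1)[symmetric] by (simp add: A_def)
        then show ?thesis using pq submodD(2)[OF sm(1)] by simp
      qed
      then show False using ne sm by auto
    qed
  qed
  then have "card (steps K k) \<le> card (steps A k \<union> steps B k)" by (intro card_mono finite_UnI steps_fin)
  also have "\<dots> \<le> card (steps A k) + card (steps B k)" by (rule card_Un_le)
  finally show "card (steps K k) \<le> a + b" using a b by linarith
qed

lemma chain_in_mono_le:
  assumes "chain_in R N M K k" "i \<le> j" "j \<le> k" shows "K i \<subseteq> K j"
  using assms(2,3)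
proof (induction j rule: dec_induct)
  case (step n) then show ?case using chain_inD(4)[OF assms(1), of n] by simp
qed simp

lemma length_refl: "length_le R M M 0"
proof (rule bdI)
  fix K k assume ch: "chain_in R M M K k"
  have "K i = M" if "i \<le> k" for i using chain_inD(2,3)[OF ch that] by simp
  then have "steps K k = {}" by (auto simp: steps_def)
  then show "card (steps K k) \<le> 0" by simp
qed

text \<open>Infinitely many proper steps would yield more than n of them below some index, that is,
  a finite chain that is too long.\<close>

lemma length_stable:
  assumes length_le: "length_le R N M n" and K: "\<And>i. submod R (K i)" "\<And>i. N \<subseteq> K i" "\<And>i. K i \<subseteq> M" "\<And>i. K i \<subseteq> K (Suc i)"
  shows "\<exists>i0. \<forall>i\<ge>i0. K i = K i0"
proof -
  let ?S = "{i. K i \<noteq> K (Suc i)}"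
  have "finite ?S"
  proof (rule ccontr)
    assume "infinite ?S"
    then obtain T where T: "T \<subseteq> ?S" "finite T" "card T = Suc n" using infinite_arbitrarily_large by blast
    obtain k where k: "\<And>i. i \<in> T \<Longrightarrow> i < k" using T(2) by (meson finite_nat_set_iff_bounded)
    have "T \<subseteq> steps K k" using T(1) k by (auto simp: steps_def)
    then have "Suc n \<le> card (steps K k)" using card_mono[OF steps_fin] T(3) by metis
    moreover have "chain_in R N M K k" by (rule chain_inI) (rule K)+
    ultimately show False using bdD[OF length_le] by (meson Suc_n_not_le_n order_trans)
  qed
  then obtain m where m: "\<And>i. i \<in> ?S \<Longrightarrow> i < m" by (meson finite_nat_set_iff_bounded)
  have "K i = K m" if "i \<ge> m" for i
    using that
  proof (induction i rule: dec_induct)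
    case (step j) then show ?case using m[of j] by auto
  qed simp
  then show ?thesis by blast
qed

text \<open>Indexing from the top turns a descending chain into an ascending one.\<close>
lemma length_descending:
  assumes length_le: "length_le R N M n" and K: "\<And>i. submod R (K i)" "\<And>i. N \<subseteq> K i" "\<And>i. K i \<subseteq> M" "\<And>i. K (Suc i) \<subseteq> K i"
  shows "\<exists>i. K i = K (Suc i)"
proof (rule ccontr)
  assume ne: "\<not> ?thesis"
  define L where "L i = K (Suc n - i)" for i
  have d: "Suc n - i = Suc (Suc n - Suc i)" if "i < Suc n" for i using that by simp
  have "chain_in R N M L (Suc n)"
  proof (rule chain_inI)
    fix i assume "i < Suc n" then show "L i \<subseteq> L (Suc i)" unfolding L_def using d[OF \<open>i < Suc n\<close>] K(4) by metis
  qed (unfold L_def, (rule K)+)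
  moreover have "steps L (Suc n) = {..<Suc n}"
  proof -
    have "L i \<noteq> L (Suc i)" if "i < Suc n" for i
      unfolding L_def using d[OF that] ne by metis
    then show ?thesis by (auto simp: steps_def)
  qed
  ultimately show False using bdD[OF length_le] by (metis card_lessThan not_less_eq_eq order_refl)
qed

locale lring = nring + assumes nonunit_add: "a \<in> nonunits R \<Longrightarrow> b \<in> nonunits R \<Longrightarrow> a + b \<in> nonunits R"
begin

lemma nonunit_neg: assumes "a \<in> nonunits R" shows "- a \<in> nonunits R"
proof -
  have "a * (-1) \<in> nonunits R" by (rule nonunit_mult[OF assms]) simp
  then show ?thesis by simp
qed

lemma nonunit_diff: "a \<in> nonunits R \<Longrightarrow> b \<in> nonunits R \<Longrightarrow> a - b \<in> nonunits R"
  using nonunit_add[of a "-b"] nonunit_neg[of b] by simp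

lemma nonunit_sum: "(\<And>i. i \<in> I \<Longrightarrow> f i \<in> nonunits R) \<Longrightarrow> (\<Sum>i\<in>I. f i) \<in> nonunits R"
  by (induction I rule: infinite_finite_induct) (auto intro: nonunit_add)

lemma nonunit_ideal: "is_ideal (nonunits R) R" and nonunit_maxid: "max_ideal R = nonunits R" and local: "local_ring R"
  using nonunit_max[OF nonunit_add] by blast+

lemma nonunit_submod: "submod R (nonunits R)" using nonunit_ideal by (simp add: ideal_submod)

lemma one_minus: assumes "x \<in> nonunits R" shows "1 - x \<noteq> 0" "inverse (1 - x) \<in> R"
proof -
  have "1 - x \<notin> nonunits R" using nonunit_add[OF _ assms, of "1 - x"] by auto
  then show "1 - x \<noteq> 0" "inverse (1 - x) \<in> R" using unitD[of "1 - x"] nonunitD[OF assms] by auto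
qed

lemma nak:
  assumes "x \<in> nonunits R" "P \<subseteq> R" "is_ideal N R" "\<And>p. p \<in> P \<Longrightarrow> \<exists>p'\<in>P. p - x * p' \<in> N"
  shows "P \<subseteq> N"
  by (rule nakayama[OF _ assms]) (rule nonunit_add)

text \<open>The nonunits carry w into N, so the quotient is a vector space of dimension at most one
  over the residue field: a submodule larger than N contains a unit multiple of w modulo N, hence
  everything.\<close>

lemma length_simple:
  assumes N: "submod R N" and w: "\<And>c. c \<in> nonunits R \<Longrightarrow> c * w \<in> N"
  shows "length_le R N (ssum N {r * w | r. r \<in> R}) 1"
proof (rule bdI)
  fix K k assume ch: "chain_in R N (ssum N {r * w | r. r \<in> R}) K k"
  note K = chain_inD[OF ch]
  let ?M = "ssum N {r * w | r. r \<in> R}"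
  have full: "K i = ?M" if i: "i \<le> k" "K i \<noteq> N" for i
  proof -
    obtain z where z: "z \<in> K i" "z \<notin> N" using K(2)[OF i(1)] i(2) by blast
    then obtain n r where zr: "z = n + r * w" "n \<in> N" "r \<in> R" using K(3)[OF i(1)] unfolding ssum_def by blast
    have "r \<notin> nonunits R" using w[of r] zr z submodD(2)[OF N] by blast
    then have r: "r \<noteq> 0" "inverse r \<in> R" using unitD zr by auto
    have "z - n \<in> K i" using submod_diff[OF K(1)[OF i(1)] z(1)] K(2)[OF i(1)] zr(2) by blast
    then have "inverse r * (z - n) \<in> K i" using submodD(3)[OF K(1)[OF i(1)] r(2)] by blast
    moreover have "inverse r * (z - n) = w" using r zr by simp
    ultimately have "w \<in> K i" by simp
    then have "{r * w | r. r \<in> R} \<subseteq> K i" using submodD(3)[OF K(1)[OF i(1)]] by blast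
    then have "?M \<subseteq> K i" using ssum_least[OF K(1)[OF i(1)] K(2)[OF i(1)]] by blast
    then show ?thesis using K(3)[OF i(1)] by blast
  qed
  have "i = j" if "i \<in> steps K k" "j \<in> steps K k" "i \<le> j" for i j
  proof (rule ccontr)
    assume "i \<noteq> j"
    then have ij: "Suc i \<le> j" "j < k" "i < k" using that by (auto simp: steps_def)
    have "K (Suc i) \<noteq> N" using that(1) K(2)[of i] K(4)[of i] ij by (auto simp: steps_def)
    then have "K (Suc i) = ?M" using full[of "Suc i"] ij by simp
    moreover have "K (Suc i) \<subseteq> K j" "K j \<subseteq> K (Suc j)" "K (Suc j) \<subseteq> ?M" using chain_in_mono_le[OF ch ij(1)] K(4)[of j] K(3)[of "Suc j"] ij by auto
    ultimately have "K j = K (Suc j)" by blast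
    then show False using that(2) by (simp add: steps_def)
  qed
  then have "\<forall>i\<in>steps K k. \<forall>j\<in>steps K k. i = j" by (metis nle_le)
  then show "card (steps K k) \<le> 1" using card_le_Suc0_iff_eq[OF steps_fin, of K k] by simp
qed

end

definition mod_span :: "'a::field set \<Rightarrow> 'a set \<Rightarrow> ('i \<Rightarrow> 'a) \<Rightarrow> 'i set \<Rightarrow> 'a set" where
  "mod_span R N v J = {z + (\<Sum>j\<in>J. d j * v j) | d z. (\<forall>j\<in>J. d j \<in> R) \<and> z \<in> N}"

lemma spnI: "z \<in> N \<Longrightarrow> (\<And>j. j \<in> J \<Longrightarrow> d j \<in> R) \<Longrightarrow> z + (\<Sum>j\<in>J. d j * v j) \<in> mod_span R N v J"
  unfolding mod_span_def by blast

lemma mod_span_insert: assumes "finite J" "i \<notin> J"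
  shows "mod_span R N v (insert i J) = ssum (mod_span R N v J) {r * v i | r. r \<in> R}"
proof (rule set_eqI, rule iffI)
  fix y assume "y \<in> mod_span R N v (insert i J)"
  then obtain d z where d: "y = z + (\<Sum>j\<in>insert i J. d j * v j)" "\<forall>j\<in>insert i J. d j \<in> R" "z \<in> N" unfolding mod_span_def by blast
  have "y = (z + (\<Sum>j\<in>J. d j * v j)) + d i * v i" using d(1) assms by simp
  moreover have "z + (\<Sum>j\<in>J. d j * v j) \<in> mod_span R N v J" using d by (intro spnI) auto
  moreover have "d i \<in> R" using d by simp
  ultimately show "y \<in> ssum (mod_span R N v J) {r * v i | r. r \<in> R}" unfolding ssum_iff by blast
next
  fix y assume "y \<in> ssum (mod_span R N v J) {r * v i | r. r \<in> R}"
  then obtain u r where u: "y = u + r * v i" "u \<in> mod_span R N v J" "r \<in> R" unfolding ssum_iff by blast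
  then obtain d z where d: "u = z + (\<Sum>j\<in>J. d j * v j)" "\<forall>j\<in>J. d j \<in> R" "z \<in> N" unfolding mod_span_def by blast
  have "(\<Sum>j\<in>J. (d(i := r)) j * v j) = (\<Sum>j\<in>J. d j * v j)" using assms by (intro sum.cong) auto
  then have "y = z + (\<Sum>j\<in>insert i J. (d(i := r)) j * v j)" using u d assms by (simp add: algebra_simps)
  moreover have "z + (\<Sum>j\<in>insert i J. (d(i := r)) j * v j) \<in> mod_span R N v (insert i J)"
    using d u assms by (intro spnI) auto
  ultimately show "y \<in> mod_span R N v (insert i J)" by simp
qed

lemma (in sring) mod_span_submod: assumes N: "submod R N" and J: "finite J" shows "submod R (mod_span R N v J)"
  using J
proof (induction J)
  case empty
  have "mod_span R N v {} = N" by (auto simp: mod_span_def)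
  then show ?case using N by simp
next
  case (insert i J) then show ?case unfolding mod_span_insert[OF insert(1,2)] using ssum_submod submod_line by blast
qed

text \<open>Generators are added one at a time; each is killed by the nonunits modulo N and
  therefore costs at most one.\<close>

lemma (in lring) length_spn:
  assumes N: "submod R N" and J: "finite J" and v: "\<And>j c. j \<in> J \<Longrightarrow> c \<in> nonunits R \<Longrightarrow> c * v j \<in> N"
  shows "length_le R N (mod_span R N v J) (card J) \<and> N \<subseteq> mod_span R N v J"
  using J v
proof (induction J)
  case empty
  have "mod_span R N v {} = N" by (auto simp: mod_span_def)
  then show ?case using length_refl by simp
next
  case (insert i J)
  let ?L = "mod_span R N v J"
  have IH: "length_le R N ?L (card J)" "N \<subseteq> ?L" using insert.IH insert.prems by auto
  have L: "submod R ?L" by (rule mod_span_submod[OF N insert(1)])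
  have "length_le R ?L (ssum ?L {r * v i | r. r \<in> R}) 1"
    by (rule length_simple[OF L]) (use insert.prems IH in blast)
  then have "length_le R N (ssum ?L {r * v i | r. r \<in> R}) (card J + 1)"
    using IH L by (intro length_add[where L = ?L] ssum_sup1[OF submod_line] ssum_submod submod_line)
  moreover have "N \<subseteq> ssum ?L {r * v i | r. r \<in> R}" using IH(2) ssum_sup1[OF submod_line, of ?L] by blast
  ultimately show ?case unfolding mod_span_insert[OF insert(1,2)] using insert by simp
qed

subsection \<open>Polynomials over a local ring and the Hilbert basis theorem\<close>

definition polys :: "'a::field set \<Rightarrow> 'a poly set" where "polys R = {p. \<forall>i. coeff p i \<in> R}"

text \<open>Over a local ring this is the kernel of reduction to polynomials over the residue field.
  Working modulo it replaces the residue field, which is never constructed.\<close>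

definition mpolys :: "'a::field set \<Rightarrow> 'a poly set" where "mpolys R = {p. \<forall>i. coeff p i \<in> nonunits R}"

definition adjoin :: "'a::field set \<Rightarrow> 'a \<Rightarrow> 'a set" where "adjoin R z = {poly p z | p. p \<in> polys R}"

lemma adjI: "p \<in> polys R \<Longrightarrow> poly p z \<in> adjoin R z" by (auto simp: adjoin_def)

context sring begin

lemma polys_0 [simp]: "0 \<in> polys R" by (auto simp: polys_def)
lemma polys_pCons [simp]: "pCons a p \<in> polys R \<longleftrightarrow> a \<in> R \<and> p \<in> polys R"
proof
  assume "pCons a p \<in> polys R"
  then have c: "coeff (pCons a p) i \<in> R" for i by (auto simp: polys_def)
  show "a \<in> R \<and> p \<in> polys R" using c[of 0] c[of "Suc i" for i] by (simp add: polys_def)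
next
  assume "a \<in> R \<and> p \<in> polys R" then show "pCons a p \<in> polys R" by (auto simp: polys_def coeff_pCons split: nat.split)
qed
lemma polys_1 [simp]: "1 \<in> polys R" unfolding one_pCons by simp
lemma polys_add [simp]: "p \<in> polys R \<Longrightarrow> q \<in> polys R \<Longrightarrow> p + q \<in> polys R" by (auto simp: polys_def)
lemma polys_diff [simp]: "p \<in> polys R \<Longrightarrow> q \<in> polys R \<Longrightarrow> p - q \<in> polys R" by (auto simp: polys_def)
lemma polys_mult [simp]: "p \<in> polys R \<Longrightarrow> q \<in> polys R \<Longrightarrow> p * q \<in> polys R" by (auto simp: polys_def coeff_mult)
lemma polys_smult [simp]: "a \<in> R \<Longrightarrow> q \<in> polys R \<Longrightarrow> smult a q \<in> polys R" by (auto simp: polys_def)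
lemma polys_monom [simp]: "a \<in> R \<Longrightarrow> monom a n \<in> polys R" by (auto simp: polys_def)
lemma polys_power [simp]: "p \<in> polys R \<Longrightarrow> p ^ n \<in> polys R" by (induction n) auto
lemma polys_prod [simp]: "(\<And>i. i \<in> I \<Longrightarrow> f i \<in> polys R) \<Longrightarrow> (\<Prod>i\<in>I. f i) \<in> polys R"
  by (induction I rule: infinite_finite_induct) auto
lemma polys_poly: "p \<in> polys R \<Longrightarrow> z \<in> R \<Longrightarrow> poly p z \<in> R" unfolding poly_altdef by (rule setsum) (auto simp: polys_def)
lemma polys_coeff: "p \<in> polys R \<Longrightarrow> coeff p i \<in> R" by (auto simp: polys_def)

lemma mpolys_pol: "p \<in> mpolys R \<Longrightarrow> p \<in> polys R" by (auto simp: mpolys_def polys_def nonunitD)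

text \<open>Division by a monic polynomial keeps the coefficients in R. The induction is on a bound
  for the excess of the degree of p over that of g.\<close>

lemma polys_division:
  assumes g: "g \<in> polys R" "lead_coeff g = 1" "degree g \<ge> 1" and p: "p \<in> polys R"
  shows "\<exists>s\<in>polys R. \<exists>r\<in>polys R. p = g * s + r \<and> degree r < degree g"
proof -
  have "\<exists>s\<in>polys R. \<exists>r\<in>polys R. p = g * s + r \<and> degree r < degree g" if "degree p < n + degree g" "p \<in> polys R" for n p
    using that
  proof (induction n arbitrary: p)
    case 0
    have "p = g * 0 + p" by simp
    then show ?case using 0 polys_0 by (metis add_0)
  next
    case (Suc n)
    define m where "m = monom (coeff p (n + degree g)) n"
    have mR: "m \<in> polys R" using Suc(3) polys_coeff by (simp add: m_def)
    define p' where "p' = p - g * m"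
    have p'R: "p' \<in> polys R" using Suc(3) mR g by (simp add: p'_def)
    have "coeff p' (n + degree g) = 0" using g(2) by (simp add: p'_def m_def mult.commute[of g] coeff_monom_mult)
    moreover have "degree p' \<le> n + degree g" unfolding p'_def
    proof (rule degree_diff_le)
      show "degree p \<le> n + degree g" using Suc by simp
      have "degree (g * m) \<le> degree g + degree m" by (rule degree_mult_le)
      also have "degree m \<le> n" by (simp add: m_def degree_monom_le)
      finally show "degree (g * m) \<le> n + degree g" by simp
    qed
    ultimately have "degree p' < n + degree g" using g(3)
      by (metis add_is_0 degree_0 le_neq_implies_less leading_coeff_0_iff not_one_le_zero gr0I)
    then obtain s r where "s \<in> polys R" "r \<in> polys R" "p' = g * s + r" "degree r < degree g" using Suc.IH p'R by blast
    then have "p = g * (s + m) + r \<and> s + m \<in> polys R \<and> r \<in> polys R \<and> degree r < degree g" using mR by (simp add: p'_def algebra_simps)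
    then show ?case by blast
  qed
  then show ?thesis using p g(3) by (metis less_add_same_cancel1 zero_less_one_class.zero_less_one less_le_trans trans_less_add1 lessI)
qed

lemma adjoin_subring: "subring (adjoin R z)"
  unfolding subring_def
proof (intro conjI ballI)
  show "0 \<in> adjoin R z" using adjI[OF polys_0, of z] by simp
  show "1 \<in> adjoin R z" using adjI[OF polys_1, of z] by simp
  fix a b assume "a \<in> adjoin R z" "b \<in> adjoin R z"
  then obtain p q where "a = poly p z" "b = poly q z" "p \<in> polys R" "q \<in> polys R" by (auto simp: adjoin_def)
  then show "a + b \<in> adjoin R z" "a * b \<in> adjoin R z" using adjI[of "p+q"] adjI[of "p*q"] by auto
next
  fix a assume "a \<in> adjoin R z"
  then obtain p where "a = poly p z" "p \<in> polys R" by (auto simp: adjoin_def)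
  then show "- a \<in> adjoin R z" using adjI[of "0-p" R z] polys_diff[OF polys_0] by auto
qed

lemma adjoin_base: "a \<in> R \<Longrightarrow> a \<in> adjoin R z"
  using adjI[of "[:a:]" R z] by simp

lemma adjoin_gen: "z \<in> adjoin R z"
  using adjI[of "[:0,1:]" R z] by simp

end

context lring begin

lemma mpolys_0 [simp]: "0 \<in> mpolys R" by (auto simp: mpolys_def)
lemma mpolys_add: "p \<in> mpolys R \<Longrightarrow> q \<in> mpolys R \<Longrightarrow> p + q \<in> mpolys R" by (auto simp: mpolys_def nonunit_add)
lemma mpolys_diff: "p \<in> mpolys R \<Longrightarrow> q \<in> mpolys R \<Longrightarrow> p - q \<in> mpolys R" by (auto simp: mpolys_def nonunit_diff)
lemma mpolys_mult: "p \<in> mpolys R \<Longrightarrow> q \<in> polys R \<Longrightarrow> p * q \<in> mpolys R"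
  by (auto simp: mpolys_def coeff_mult polys_def intro!: nonunit_sum nonunit_mult)
lemma mpolys_smult: "a \<in> nonunits R \<Longrightarrow> q \<in> polys R \<Longrightarrow> smult a q \<in> mpolys R" by (auto simp: mpolys_def polys_def intro: nonunit_mult)
lemma mpolys_monom: "a \<in> nonunits R \<Longrightarrow> monom a n \<in> mpolys R" by (auto simp: mpolys_def)
lemma mpolys_1 [simp]: "1 \<notin> mpolys R" by (auto simp: mpolys_def intro!: exI[of _ 0])

text \<open>With i and j the least indices of unit coefficients, the coefficient of the product at
  \<open>i + j\<close> is a product of two units plus a nonunit. This reflects that polynomials over
  the residue field form a domain.\<close>

lemma gauss:
  assumes p: "p \<in> polys R" and q: "q \<in> polys R" and pq: "p * q \<in> mpolys R" shows "p \<in> mpolys R \<or> q \<in> mpolys R"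
proof (rule ccontr)
  assume n: "\<not> ?thesis"
  define i where "i = (LEAST i. coeff p i \<notin> nonunits R)"
  define j where "j = (LEAST i. coeff q i \<notin> nonunits R)"
  have "\<exists>i. coeff p i \<notin> nonunits R" "\<exists>i. coeff q i \<notin> nonunits R" using n by (auto simp: mpolys_def)
  then have i: "coeff p i \<notin> nonunits R" and j: "coeff q j \<notin> nonunits R" unfolding i_def j_def by (metis LeastI_ex)+
  have il: "coeff p k \<in> nonunits R" if "k < i" for k using that not_less_Least unfolding i_def by blast
  have jl: "coeff q k \<in> nonunits R" if "k < j" for k using that not_less_Least unfolding j_def by blast
  let ?f = "\<lambda>k. coeff p k * coeff q (i + j - k)"
  have s: "(\<Sum>k\<in>{..i+j}-{i}. ?f k) \<in> nonunits R"
  proof (rule nonunit_sum)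
    fix k assume k: "k \<in> {..i+j}-{i}"
    show "?f k \<in> nonunits R"
    proof (cases "k < i")
      case True then show ?thesis using il polys_coeff[OF q] nonunit_mult by blast
    next
      case False then have "i + j - k < j" using k by auto
      then show ?thesis using jl polys_coeff[OF p] nonunit_mult2 by blast
    qed
  qed
  have "coeff (p * q) (i + j) = ?f i + (\<Sum>k\<in>{..i+j}-{i}. ?f k)" unfolding coeff_mult by (rule sum.remove) auto
  then have "?f i = coeff (p * q) (i + j) - (\<Sum>k\<in>{..i+j}-{i}. ?f k)" by simp
  then have "?f i \<in> nonunits R" using s pq nonunit_diff by (simp add: mpolys_def)
  then show False using nonunit_prime[of "coeff p i" "coeff q j"] i j polys_coeff p q by auto
qed

lemma gauss_prod: "finite I \<Longrightarrow> (\<And>i. i \<in> I \<Longrightarrow> f i \<in> polys R \<and> f i \<notin> mpolys R) \<Longrightarrow> (\<Prod>i\<in>I. f i) \<notin> mpolys R"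
proof (induction I rule: finite_induct)
  case (insert i I)
  have "(\<Prod>i\<in>I. f i) \<in> polys R" using insert by (intro polys_prod) auto
  then show ?case using insert gauss[of "f i" "\<Prod>i\<in>I. f i"] by auto
qed simp

lemma gauss_power: "q \<in> polys R \<Longrightarrow> q \<notin> mpolys R \<Longrightarrow> q ^ n \<notin> mpolys R"
  using gauss_prod[of "{..<n}" "\<lambda>_. q"] by simp

end

text \<open>The element z need not be a free variable, so ideals are pulled back along evaluation:
  \<open>L k n\<close> collects the coefficients at n of polynomials of degree at most n whose value
  lies in \<open>I k\<close>. It is monotone in both indices.\<close>

theorem hilbert_basis:
  assumes noeth: "noetherian_ring R" shows "noetherian_ring (adjoin R z)"
proof -
  interpret nring R using noeth by unfold_locales (auto simp: noetherian_ring_def)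
  interpret A: sring "adjoin R z" by unfold_locales (rule adjoin_subring)
  show ?thesis unfolding noetherian_ring_def
  proof (intro conjI allI impI)
    show "subring (adjoin R z)" by (rule adjoin_subring)
    fix I :: "nat \<Rightarrow> 'a set" assume I: "(\<forall>n. is_ideal (I n) (adjoin R z)) \<and> incseq I"
    have Iadd: "a \<in> I k \<Longrightarrow> b \<in> I k \<Longrightarrow> a + b \<in> I k" and Imul: "r \<in> adjoin R z \<Longrightarrow> a \<in> I k \<Longrightarrow> r * a \<in> I k" 
      and I0: "0 \<in> I k" for a b r k
      using I unfolding is_ideal_def by blast+
    have Imono: "k \<le> l \<Longrightarrow> I k \<subseteq> I l" for k l using I by (auto dest: incseqD)
    define P where "P k n = {p \<in> polys R. poly p z \<in> I k \<and> degree p \<le> n}" for k n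
    define L where "L k n = (\<lambda>p. coeff p n) ` P k n" for k n
    have Pmono: "k \<le> l \<Longrightarrow> P k n \<subseteq> P l n" for k l n using Imono by (auto simp: P_def)
    have Lid: "is_ideal (L k n) R" for k n
    proof (rule is_idealI)
      show "L k n \<subseteq> R" by (auto simp: L_def P_def polys_coeff)
      have "0 \<in> P k n" by (simp add: P_def I0)
      then show "0 \<in> L k n" unfolding L_def by (metis coeff_0 image_eqI)
      fix a b assume "a \<in> L k n" "b \<in> L k n"
      then obtain p q where pq: "a = coeff p n" "b = coeff q n" "p \<in> P k n" "q \<in> P k n" by (auto simp: L_def)
      then have "p + q \<in> P k n" using Iadd by (auto simp: P_def degree_add_le)
      then show "a + b \<in> L k n" unfolding L_def using pq by (metis coeff_add image_eqI)
    next
      fix r a assume r: "r \<in> R" "a \<in> L k n"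
      then obtain p where p: "a = coeff p n" "p \<in> P k n" by (auto simp: L_def)
      then have "smult r p \<in> P k n" using Imul[OF adjoin_base[OF r(1)]] r by (auto simp: P_def intro: order_trans[OF degree_smult_le])
      then show "r * a \<in> L k n" unfolding L_def using p by (metis coeff_smult image_eqI)
    qed
    have Lk: "k \<le> l \<Longrightarrow> L k n \<subseteq> L l n" for k l n using Pmono unfolding L_def by (rule image_mono)
    have LS: "L k n \<subseteq> L k (Suc n)" for k n
    proof
      fix a assume "a \<in> L k n"
      then obtain p where p: "a = coeff p n" "p \<in> P k n" by (auto simp: L_def)
      then have "pCons 0 p \<in> P k (Suc n)" using Imul[OF adjoin_gen] degree_pCons_le[of 0 p] by (auto simp: P_def)
      then show "a \<in> L k (Suc n)" unfolding L_def using p by (metis coeff_pCons_Suc image_eqI)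
    qed
    have Ln: "n \<le> m \<Longrightarrow> L k n \<subseteq> L k m" for k n m using lift_Suc_mono_le[of "L k"] LS by blast
    have st: "\<exists>N. \<forall>n\<ge>N. J n = J N" if "\<And>n. is_ideal (J n) R" "\<And>m n. m \<le> n \<Longrightarrow> J m \<subseteq> J n" for J :: "nat \<Rightarrow> 'a set"
      using noeth that unfolding noetherian_ring_def by (metis incseq_def)
    \<comment> \<open>The diagonal stabilizes at N, which settles every column \<open>n > N\<close>
      from row N on. The finitely many columns \<open>n \<le> N\<close> stabilize separately, and
      \<open>M0\<close> is beyond all these bounds.\<close>
    obtain N where N: "\<And>n. n \<ge> N \<Longrightarrow> L n n = L N N"
      using st[of "\<lambda>n. L n n"] Lid Lk Ln by (metis order_trans)
    have "\<forall>n. \<exists>M. \<forall>k\<ge>M. L k n = L M n" using st[of "\<lambda>k. L k n" for n] Lid Lk by blast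
    then obtain M where M: "\<And>n k. k \<ge> M n \<Longrightarrow> L k n = L (M n) n" by metis
    define M0 where "M0 = Max (insert N (M ` {..N}))"
    have M0N: "N \<le> M0" and M0M: "n \<le> N \<Longrightarrow> M n \<le> M0" for n
      unfolding M0_def by (rule Max_ge, simp, simp)+
    have eq: "L k n = L M0 n" if k: "k \<ge> M0" for k n
    proof (cases "n \<le> N")
      case True then show ?thesis using M[of n k] M[of n M0] M0M[of n] k by simp
    next
      case False
      have "L l n = L N N" if "l \<ge> N" for l
      proof (rule antisym)
        have "L l n \<subseteq> L (max l n) (max l n)" using Lk[of l "max l n" n] Ln[of n "max l n" "max l n"] by auto
        then show "L l n \<subseteq> L N N" using N[of "max l n"] that by auto
        show "L N N \<subseteq> L l n" using Lk[of N l N] Ln[of N n l] that False by auto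
      qed
      then show ?thesis using k M0N by simp
    qed
    \<comment> \<open>Subtracting a polynomial with value in \<open>I M0\<close> and the same
      coefficient at n lowers the degree and keeps the value in \<open>I k\<close>.\<close>
    have sub: "poly p z \<in> I M0" if "k \<ge> M0" "p \<in> polys R" "poly p z \<in> I k" "degree p \<le> n" for k p n
      using that
    proof (induction n arbitrary: p rule: less_induct)
      case (less n)
      then have "coeff p n \<in> L k n" by (auto simp: L_def P_def)
      then obtain q where q: "coeff p n = coeff q n" "q \<in> P M0 n" unfolding eq[OF less(2)] by (auto simp: L_def)
      then have qq: "q \<in> polys R" "poly q z \<in> I M0" "degree q \<le> n" by (auto simp: P_def)
      define d where "d = p - q"
      have d: "d \<in> polys R" "degree d \<le> n" "coeff d n = 0" using less qq q by (auto simp: d_def degree_diff_le)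
      have "poly q z \<in> I k" using qq(2) Imono[OF less(2)] by blast
      moreover have "is_ideal (I k) (adjoin R z)" using I by blast
      ultimately have dI: "poly d z \<in> I k" using A.ideal_diff[of "I k"] less(4) by (simp add: d_def)
      have "poly d z \<in> I M0"
      proof (cases "d = 0")
        case True then show ?thesis using I0 by simp
      next
        case False
        then have "degree d < n" using d(2,3) by (metis le_neq_implies_less leading_coeff_0_iff)
        then show ?thesis using less.IH[of "degree d" d] less(2) d(1) dI by simp
      qed
      then have "poly d z + poly q z \<in> I M0" using qq Iadd by blast
      then show ?case by (simp add: d_def)
    qed
    have "I k = I M0" if "k \<ge> M0" for k
    proof
      show "I M0 \<subseteq> I k" using Imono that by blast
      show "I k \<subseteq> I M0"
      proof
        fix a assume a: "a \<in> I k"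
        then have "a \<in> adjoin R z" using I unfolding is_ideal_def by blast
        then obtain p where "a = poly p z" "p \<in> polys R" by (auto simp: adjoin_def)
        then show "a \<in> I M0" using sub[OF that, of p] a by blast
      qed
    qed
    then show "\<exists>N. \<forall>n\<ge>N. I n = I N" by blast
  qed
qed

text \<open>An ideal of S is determined by its contraction to C, because the denominator of each
  fraction is a unit of S.\<close>

lemma noeth_loc:
  assumes C: "noetherian_ring C" and S: "subring S" and CS: "C \<subseteq> S"
    and fr: "\<And>s. s \<in> S \<Longrightarrow> \<exists>c\<in>C. \<exists>d\<in>C. d \<noteq> 0 \<and> s = c / d \<and> inverse d \<in> S"
  shows "noetherian_ring S"
  unfolding noetherian_ring_def
proof (intro conjI allI impI)
  show "subring S" by (rule S)
  fix I :: "nat \<Rightarrow> 'a set" assume I: "(\<forall>n. is_ideal (I n) S) \<and> incseq I"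
  have "is_ideal (I n \<inter> C) C" for n
  proof -
    interpret sring C using C by unfold_locales (simp add: noetherian_ring_def)
    show ?thesis using I CS unfolding is_ideal_def by (auto simp: subset_iff)
  qed
  moreover have "incseq (\<lambda>n. I n \<inter> C)" using I unfolding incseq_def by blast
  ultimately obtain N where N: "\<And>n. n \<ge> N \<Longrightarrow> I n \<inter> C = I N \<inter> C" using C unfolding noetherian_ring_def by (metis (no_types, lifting))
  have "I n = I N" if "n \<ge> N" for n
  proof
    show "I N \<subseteq> I n" using I that by (auto dest: incseqD)
    show "I n \<subseteq> I N"
    proof
      fix s assume s: "s \<in> I n"
      then have "s \<in> S" using I unfolding is_ideal_def by blast
      then obtain c d where cd: "c \<in> C" "d \<in> C" "d \<noteq> 0" "s = c / d" "inverse d \<in> S" using fr by blast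
      have "d * s \<in> I n" using I s cd(2) CS unfolding is_ideal_def by blast
      then have "c \<in> I n \<inter> C" using cd by simp
      then have "c \<in> I N" using N[OF that] by blast
      then have "inverse d * c \<in> I N" using I cd(5) unfolding is_ideal_def by blast
      moreover have "inverse d * c = s" using cd(4) by (simp add: field_simps)
      ultimately show "s \<in> I N" by simp
    qed
  qed
  then show "\<exists>N. \<forall>n\<ge>N. I n = I N" by blast
qed

subsection \<open>Two-dimensional regular local rings\<close>

text \<open>Inside the ambient field, divisibility of \<open>b\<close> by \<open>a \<noteq> 0\<close> in \<open>R\<close> is expressed as \<open>b / a \<in> R\<close>.\<close>
definition prime_in :: "'a::field set \<Rightarrow> 'a \<Rightarrow> bool" where
  "prime_in R p \<longleftrightarrow> p \<in> nonunits R \<and> p \<noteq> 0 \<and> (\<forall>a\<in>R. \<forall>b\<in>R. a * b / p \<in> R \<longrightarrow> a / p \<in> R \<or> b / p \<in> R)"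

definition coprime_in :: "'a::field set \<Rightarrow> 'a \<Rightarrow> 'a \<Rightarrow> bool" where
  "coprime_in R a b \<longleftrightarrow> (\<forall>d\<in>nonunits R. d \<noteq> 0 \<longrightarrow> a / d \<in> R \<longrightarrow> b / d \<notin> R)"

locale two_gen = lring R for R :: "'a::field set" +
  fixes x y assumes gens: "nonunits R = {a * x + b * y | a b. a \<in> R \<and> b \<in> R}"
begin

lemma x_nonunit: "x \<in> nonunits R" and y_nonunit: "y \<in> nonunits R"
proof -
  have "1 * x + 0 * y \<in> nonunits R" "0 * x + 1 * y \<in> nonunits R" unfolding gens using zero one by blast+
  then show "x \<in> nonunits R" "y \<in> nonunits R" by simp_all
qed

lemma xR [simp]: "x \<in> R" and yR [simp]: "y \<in> R" using x_nonunit y_nonunit nonunitD by auto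

text \<open>Modulo x the nonunits are the multiples of y. An element without such a form is
  congruent modulo x to y times another one, so Nakayama's lemma puts all of them into xR.\<close>

lemma mod_x:
  assumes a: "a \<in> R" "a \<notin> {x * r | r. r \<in> R}"
  shows "\<exists>u n b. u \<in> R \<and> u \<notin> nonunits R \<and> b \<in> R \<and> a = u * y ^ n + x * b"
proof -
  define fm where "fm a \<longleftrightarrow> (\<exists>u n b. u \<in> R \<and> u \<notin> nonunits R \<and> b \<in> R \<and> a = u * y ^ n + x * b)" for a
  have "{a \<in> R. \<not> fm a} \<subseteq> {x * r | r. r \<in> R}"
  proof (rule nak[OF y_nonunit])
    show "is_ideal {x * r |r. r \<in> R} R" by (rule ideal_principal) simp
    fix p assume p: "p \<in> {a \<in> R. \<not> fm a}"
    have "p \<in> nonunits R"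
    proof (rule ccontr)
      assume "p \<notin> nonunits R"
      moreover have "p = p * y ^ 0 + x * 0" by simp
      ultimately have "fm p" unfolding fm_def using p zero by blast
      then show False using p by simp
    qed
    then obtain a b where ab: "p = a * x + b * y" "a \<in> R" "b \<in> R" unfolding gens by blast
    have "\<not> fm b"
    proof
      assume "fm b"
      then obtain u n c where u: "u \<in> R" "u \<notin> nonunits R" "c \<in> R" "b = u * y ^ n + x * c" unfolding fm_def by blast
      have "p = u * y ^ (Suc n) + x * (a + c * y)" unfolding ab(1) u(4) by (simp add: algebra_simps)
      moreover have "a + c * y \<in> R" using ab u by simp
      ultimately have "fm p" unfolding fm_def using u by blast
      then show False using p by simp
    qed
    moreover have "p - y * b = x * a" using ab by (simp add: algebra_simps)
    ultimately show "\<exists>p'\<in>{a \<in> R. \<not> fm a}. p - y * p' \<in> {x * r |r. r \<in> R}" using ab by blast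
  qed auto
  then have "fm a" using a by blast
  then show ?thesis by (simp add: fm_def)
qed

lemma zero_set: "{0 * r | r. r \<in> R} = {0}"
proof -
  have "0 * 0 \<in> {0 * r | r. r \<in> R}" using zero by blast
  then show ?thesis by auto
qed

lemma nak0:
  assumes "P \<subseteq> R" "z \<in> nonunits R" "\<And>p. p \<in> P \<Longrightarrow> \<exists>r\<in>P. p = z * r" shows "P \<subseteq> {0}"
proof (rule nak[OF assms(2,1)])
  show "is_ideal {0} R" by (auto simp: is_ideal_def)
  show "\<exists>p'\<in>P. p - z * p' \<in> {0}" if "p \<in> P" for p using assms(3)[OF that] by auto
qed

text \<open>This is the source of unique factorization. If J lies in xR, saturation gives J = xJ,
  hence J = 0. Otherwise choose a in J of least y-order modulo x: every j in J differs from a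
  multiple of a by an element of xR, whose quotient by x is again in J by saturation. So J lies in
  aR + xJ, and Nakayama's lemma applies.\<close>

lemma sat_principal:
  assumes J: "is_ideal J R" and sat: "\<And>r. r \<in> R \<Longrightarrow> x * r \<in> J \<Longrightarrow> r \<in> J"
  shows "\<exists>a\<in>J. J = {a * r | r. r \<in> R}"
proof -
  have JR: "J \<subseteq> R" and J0: "0 \<in> J" and Jm: "r \<in> R \<Longrightarrow> a \<in> J \<Longrightarrow> r * a \<in> J" for r a
    using J by (auto simp: is_ideal_def)
  show ?thesis
  proof (cases "J \<subseteq> {x * r | r. r \<in> R}")
    case True
    have "\<exists>r\<in>J. p = x * r" if p: "p \<in> J" for p
    proof -
      obtain r where r: "p = x * r" "r \<in> R" using True p by blast
      then have "r \<in> J" using sat p by simp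
      then show ?thesis using r by blast
    qed
    then have "J \<subseteq> {0}" by (rule nak0[OF JR x_nonunit])
    then have "J = {0}" using J0 by blast
    then have "J = {0 * r | r. r \<in> R}" using zero_set by simp
    then show ?thesis using J0 by blast
  next
    case False
    define Q where "Q n \<longleftrightarrow> (\<exists>a\<in>J. \<exists>u b. u \<in> R \<and> u \<notin> nonunits R \<and> b \<in> R \<and> a = u * y ^ n + x * b)" for n
    define n where "n = (LEAST n. Q n)"
    obtain a0 where a0: "a0 \<in> J" "a0 \<notin> {x * r | r. r \<in> R}" using False by blast
    then obtain n0 where "Q n0" using mod_x[of a0] JR unfolding Q_def by blast
    then have "Q n" unfolding n_def by (rule LeastI)
    then obtain a u b where a: "a \<in> J" "u \<in> R" "u \<notin> nonunits R" "b \<in> R" "a = u * y ^ n + x * b" unfolding Q_def by blast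
    have ui: "u \<noteq> 0" "inverse u \<in> R" using unitD a by auto
    have "J \<subseteq> {a * r | r. r \<in> R}"
    proof (rule nak[OF x_nonunit JR])
      show "is_ideal {a * r |r. r \<in> R} R" by (rule ideal_principal) (use a JR in auto)
      fix j assume j: "j \<in> J"
      show "\<exists>p'\<in>J. j - x * p' \<in> {a * r |r. r \<in> R}"
      proof (cases "j \<in> {x * r | r. r \<in> R}")
        case True
        then obtain r where r: "j = x * r" "r \<in> R" by blast
        then have "r \<in> J" using sat j by blast
        moreover have "j - x * r = a * 0" using r by simp
        ultimately show ?thesis using zero by blast
      next
        case False
        then obtain u' m b' where b': "u' \<in> R" "u' \<notin> nonunits R" "b' \<in> R" "j = u' * y ^ m + x * b'" using mod_x[of j] j JR by blast
        then have "Q m" unfolding Q_def using j by blast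
        then have nm: "n \<le> m" unfolding n_def by (rule Least_le)
        define r where "r = u' * inverse u * y ^ (m - n)"
        have rR: "r \<in> R" using b' ui by (simp add: r_def)
        have "y ^ m = y ^ n * y ^ (m - n)" using nm by (simp flip: power_add)
        then have "u' * y ^ m = (u * y ^ n) * r" using ui by (simp add: r_def)
        then have e: "j - a * r = x * (b' - b * r)" using a b' by (simp add: algebra_simps)
        have "j - a * r \<in> J" using ideal_diff[OF J j] Jm[OF rR a(1)] by (simp add: mult.commute)
        then have "b' - b * r \<in> J" using sat e b' a rR by simp
        moreover have "j - x * (b' - b * r) = a * r" using e by (simp add: algebra_simps)
        ultimately show ?thesis using rR by blast
      qed
    qed
    moreover have "{a * r | r. r \<in> R} \<subseteq> J" using Jm[OF _ a(1)] by (auto simp: mult.commute)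
    ultimately show ?thesis using a(1) by blast
  qed
qed

lemma dvd_set: "z \<noteq> 0 \<Longrightarrow> a \<in> {z * r | r. r \<in> R} \<longleftrightarrow> a / z \<in> R"
proof
  assume "z \<noteq> 0" "a / z \<in> R"
  then have "a = z * (a / z)" by simp
  then show "a \<in> {z * r | r. r \<in> R}" using \<open>a / z \<in> R\<close> by blast
qed auto

lemma prime_sub: assumes "prime_ideal P R" shows "P \<subseteq> nonunits R" "is_ideal P R" "a \<in> R \<Longrightarrow> b \<in> R \<Longrightarrow> a * b \<in> P \<Longrightarrow> a \<in> P \<or> b \<in> P"
  "a \<in> R \<Longrightarrow> a ^ n \<in> P \<Longrightarrow> a \<in> P"
proof -
  show id: "is_ideal P R" using assms by (simp add: prime_ideal_def)
  show s: "P \<subseteq> nonunits R" using assms ideal_unit[OF id] unfolding prime_ideal_def by blast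
  show p: "a \<in> R \<Longrightarrow> b \<in> R \<Longrightarrow> a * b \<in> P \<Longrightarrow> a \<in> P \<or> b \<in> P" for a b using assms unfolding prime_ideal_def by blast
  have "1 \<notin> P" using s one_nonunit by blast
  then show "a \<in> R \<Longrightarrow> a ^ n \<in> P \<Longrightarrow> a \<in> P"
  proof (induction n)
    case (Suc n) then show ?case using p[of a "a ^ n"] by auto
  qed auto
qed

text \<open>If z generates the maximal ideal, every nonzero element is a unit times a power of z, so
  a nonzero prime ideal contains z.\<close>

lemma not_principal:
  assumes P: "prime_ideal P R" "P \<noteq> {0}" and z: "nonunits R = {z * r | r. r \<in> R}"
  shows "P = nonunits R"
proof -
  note ps = prime_sub[OF P(1)]
  have "z * 1 \<in> nonunits R" unfolding z using one by blast
  then have zn: "z \<in> nonunits R" by simp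
  then have zR: "z \<in> R" by (rule nonunitD)
  have "0 \<in> P" using ps(2) by (simp add: is_ideal_def)
  then obtain p where p: "p \<in> P" "p \<noteq> 0" using P(2) by blast
  define fm where "fm a \<longleftrightarrow> (\<exists>u n. u \<in> R \<and> u \<notin> nonunits R \<and> a = u * z ^ n)" for a
  have "{a \<in> R. \<not> fm a} \<subseteq> {0}"
  proof (rule nak0[OF _ zn])
    fix a assume a: "a \<in> {a \<in> R. \<not> fm a}"
    have "a \<in> nonunits R"
    proof (rule ccontr)
      assume "a \<notin> nonunits R"
      moreover have "a = a * z ^ 0" by simp
      ultimately have "fm a" unfolding fm_def using a by blast
      then show False using a by simp
    qed
    then obtain r where r: "a = z * r" "r \<in> R" unfolding z by blast
    have "\<not> fm r"
    proof
      assume "fm r"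
      then obtain u n where "u \<in> R" "u \<notin> nonunits R" "r = u * z ^ n" unfolding fm_def by blast
      then have "u \<in> R \<and> u \<notin> nonunits R \<and> a = u * z ^ Suc n" using r by simp
      then have "fm a" unfolding fm_def by blast
      then show False using a by simp
    qed
    then show "\<exists>r\<in>{a \<in> R. \<not> fm a}. a = z * r" using r by blast
  qed auto
  then have "fm p" using p ps(1) nonunitD by blast
  then obtain u n where u: "u \<in> R" "u \<notin> nonunits R" "p = u * z ^ n" unfolding fm_def by blast
  have "u \<notin> P" using u ps(1) by blast
  moreover have "z ^ n \<in> R" using zR by simp
  ultimately have "z ^ n \<in> P" using u p(1) ps(3)[of u "z ^ n"] by blast
  then have "z \<in> P" by (rule ps(4)[OF zR])
  then have "nonunits R \<subseteq> P" unfolding z using ps(2) unfolding is_ideal_def by (auto simp: mult.commute)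
  then show ?thesis using ps(1) by blast
qed

text \<open>Noetherian induction on divisors: c generates a maximal principal ideal, so it is
  minimal for divisibility among the elements with Q. This supplies irreducible divisors,
  factorizations, lowest terms and greatest common divisors.\<close>

lemma principal_max:
  assumes "Q c0" "\<And>c. Q c \<Longrightarrow> c \<in> R \<and> c \<noteq> 0"
  obtains c where "Q c" "\<And>d. Q d \<Longrightarrow> c / d \<in> R \<Longrightarrow> d / c \<in> R"
proof -
  let ?I = "\<lambda>c. {c * r | r. r \<in> R}"
  let ?S = "?I ` {c. Q c}"
  have ne: "?S \<noteq> {}" using assms(1) by blast
  have id: "is_ideal I R" if "I \<in> ?S" for I using that assms(2) ideal_principal by blast
  obtain M where M: "M \<in> ?S" "\<forall>J\<in>?S. M \<subseteq> J \<longrightarrow> J = M" using noeth_max[OF noeth ne id] by blast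
  obtain c where c: "M = ?I c" "Q c" using M(1) by blast
  have "d / c \<in> R" if d: "Q d" "c / d \<in> R" for d
  proof -
    have d0: "d \<noteq> 0" "c \<noteq> 0" using assms(2) d c by blast+
    have "?I c \<subseteq> ?I d"
    proof
      fix z assume "z \<in> ?I c"
      then obtain r where "z = c * r" "r \<in> R" by blast
      moreover have "c / d * r \<in> R" using mult[OF d(2) \<open>r \<in> R\<close>] .
      ultimately have "z = d * (c / d * r)" "c / d * r \<in> R" using d0 by simp_all
      then show "z \<in> ?I d" by blast
    qed
    then have "?I d = ?I c" using M(2) c d(1) by blast
    moreover have "d * 1 \<in> ?I d" using one by blast
    ultimately have "d * 1 \<in> ?I c" by (simp only:)
    then have "d \<in> ?I c" by (simp only: mult_1_right)
    then show ?thesis using dvd_set[OF d0(2)] by blast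
  qed
  then show ?thesis using that c(2) by blast
qed

text \<open>The intermediate prime P plays the part of dimension two. The crux is that x divides no
  power of y; \<open>mod_x\<close> then reduces any product of two non-multiples of x to a unit
  times a power of y.\<close>

lemma prime_x:
  assumes P: "prime_ideal P R" "P \<noteq> {0}" "P \<noteq> nonunits R"
  shows "prime_in R x" "y / x \<notin> R"
proof -
  note ps = prime_sub[OF P(1)]
  have PI: "a \<in> P \<Longrightarrow> b \<in> P \<Longrightarrow> a + b \<in> P" "r \<in> R \<Longrightarrow> a \<in> P \<Longrightarrow> r * a \<in> P" for a b r using ps(2) by (auto simp: is_ideal_def)
  have np: "nonunits R \<noteq> {z * r | r. r \<in> R}" for z using not_principal[OF P(1,2)] P(3) by blast
  have x0: "x \<noteq> 0"
  proof
    assume "x = 0"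
    then have "nonunits R = {y * r | r. r \<in> R}" unfolding gens using zero by (auto simp: mult.commute)
    then show False using np by blast
  qed
  have nd: "b / a \<notin> R" if ab: "a \<in> R" "a \<noteq> 0" "nonunits R = {c * a + d * b | c d. c \<in> R \<and> d \<in> R}" for a b
  proof
    assume b: "b / a \<in> R"
    have "c * a + d * b \<in> {a * r | r. r \<in> R}" if "c \<in> R" "d \<in> R" for c d
    proof -
      have "c * a + d * b = a * (c + d * (b / a))" using ab by (simp add: field_simps)
      moreover have "c + d * (b / a) \<in> R" using add[OF that(1) mult[OF that(2) b]] .
      ultimately show ?thesis by blast
    qed
    then have "nonunits R \<subseteq> {a * r | r. r \<in> R}" unfolding ab(3) by blast
    moreover have "a * r \<in> nonunits R" if "r \<in> R" for r
    proof -
      have "a * r = r * a + 0 * b" by simp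
      then show ?thesis unfolding ab(3) using that zero by blast
    qed
    ultimately have "nonunits R = {a * r | r. r \<in> R}" by blast
    then show False using np by blast
  qed
  show yx: "y / x \<notin> R" by (rule nd[OF xR x0 gens])
  \<comment> \<open>If x divided \<open>y ^ n\<close>, it could not lie in P, so P = aR by
    saturation. Modulo x, the nonunit a is zero or of positive y-order, hence x divides
    \<open>a ^ Suc n\<close>. But a is prime and does not divide x, so \<open>a ^ Suc n\<close>
    divides the cofactor s, and x would be a unit.\<close>
  have yn: "y ^ n / x \<notin> R" for n
  proof
    assume yn: "y ^ n / x \<in> R"
    then have yx: "y ^ n = x * (y ^ n / x)" using x0 by simp
    have xP: "x \<notin> P"
    proof
      assume "x \<in> P"
      then have "y ^ n \<in> P" using yx PI(2)[OF yn] by (metis mult.commute)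
      then have "y \<in> P" using ps(4) by simp
      then have "nonunits R \<subseteq> P" unfolding gens using \<open>x \<in> P\<close> PI by blast
      then show False using P ps(1) by blast
    qed
    have "r \<in> P" if "r \<in> R" "x * r \<in> P" for r using ps(3)[OF xR that] xP by blast
    then obtain a where a: "a \<in> P" "P = {a * r | r. r \<in> R}" using sat_principal[OF ps(2)] by blast
    have an: "a \<in> nonunits R" and aR: "a \<in> R" using a(1) ps(1) nonunitD by auto
    have a0: "a \<noteq> 0" 
    proof
      assume "a = 0"
      then have "P = {0}" using a(2) zero_set by simp
      then show False using P by blast
    qed
    have pa: "r / a \<in> R" if "x * r / a \<in> R" "r \<in> R" for r
    proof -
      have "x * r \<in> P" using dvd_set[OF a0] that a(2) by metis
      then have "r \<in> P" using ps(3)[of x r] xP that by auto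
      then show ?thesis using dvd_set[OF a0] a(2) by metis
    qed
    obtain s where s: "s \<in> R" "a ^ Suc n = x * s"
    proof -
      have "a ^ n / x \<in> R \<or> a / x \<in> R"
      proof (cases "a / x \<in> R")
        case False
        then obtain u m b where b: "u \<in> R" "u \<notin> nonunits R" "b \<in> R" "a = u * y ^ m + x * b" using mod_x[OF aR] dvd_set[OF x0] by blast
        have "m \<noteq> 0"
        proof
          assume "m = 0"
          then have "u = a - x * b" using b by simp
          then show False using nonunit_diff[OF an] nonunit_mult[OF x_nonunit b(3)] b(2) by metis
        qed
        have "\<exists>c\<in>R. a ^ k = u ^ k * y ^ (m * k) + x * c" for k
        proof (induction k)
          case 0 show ?case by (auto intro!: bexI[of _ 0])
        next
          case (Suc k)
          then obtain c where c: "c \<in> R" "a ^ k = u ^ k * y ^ (m * k) + x * c" by blast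
          have "a ^ Suc k = (u * y ^ m + x * b) * (u ^ k * y ^ (m * k) + x * c)" using c b(4) by simp
          also have "\<dots> = u ^ Suc k * y ^ (m * Suc k) + x * (b * a ^ k + u * y ^ m * c)"
            unfolding c(2) by (simp add: algebra_simps power_add)
          finally show ?case using b c aR by (intro bexI[of _ "b * a ^ k + u * y ^ m * c"]) auto
        qed
        then obtain c where c: "c \<in> R" "a ^ n = u ^ n * y ^ (m * n) + x * c" by blast
        have "m * n = n + (m - 1) * n" using \<open>m \<noteq> 0\<close> by (metis Suc_pred' gr0I mult_Suc)
        then have "a ^ n / x = u ^ n * (y ^ n / x) * y ^ ((m-1) * n) + c" using c x0 by (simp add: field_simps power_add)
        moreover have "\<dots> \<in> R" using yn b c by (intro add mult pow) simp_all
        ultimately show ?thesis by simp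
      qed simp
      then have "a ^ Suc n / x \<in> R" using div_mult(1)[of "a ^ n" x a] div_mult(1)[of a x "a ^ n"] aR by (auto simp: mult.commute)
      moreover have "a ^ Suc n = x * (a ^ Suc n / x)" using x0 by simp
      ultimately show ?thesis using that by blast
    qed
    have "s / a ^ k \<in> R" if "k \<le> Suc n" for k
      using that
    proof (induction k)
      case 0 then show ?case using s by simp
    next
      case (Suc k)
      have "x * (s / a ^ k) / a = a ^ Suc n / a ^ Suc k" using s a0 by (simp add: field_simps)
      also have "\<dots> = a ^ (Suc n - Suc k)" using a0 Suc(2) by (rule power_diff[symmetric])
      finally have "x * (s / a ^ k) / a \<in> R" using aR by simp
      then have "s / a ^ k / a \<in> R" using pa[of "s / a ^ k"] Suc by auto
      then show ?case by (simp add: mult.commute)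
    qed
    from this[of "Suc n"] have "s / a ^ Suc n \<in> R" by blast
    moreover have "x * (s / a ^ Suc n) = a ^ Suc n / a ^ Suc n" using s(2) by (simp only: times_divide_eq_right)
    then have "x * (s / a ^ Suc n) = 1" using a0 by simp
    ultimately show False using nonunit_mult[OF x_nonunit, of "s / a ^ Suc n"] by auto
  qed
  show "prime_in R x" unfolding prime_in_def
  proof (intro conjI ballI impI x_nonunit x0)
    fix a b assume ab: "a \<in> R" "b \<in> R" "a * b / x \<in> R"
    show "a / x \<in> R \<or> b / x \<in> R"
    proof (rule ccontr)
      assume "\<not> ?thesis"
      then have n: "a \<notin> {x * r | r. r \<in> R}" "b \<notin> {x * r | r. r \<in> R}" using dvd_set[OF x0] by blast+
      obtain u n c where c1: "u \<in> R" "u \<notin> nonunits R" "c \<in> R" "a = u * y ^ n + x * c" using mod_x[OF ab(1) n(1)] by blast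
      obtain v m d where c2: "v \<in> R" "v \<notin> nonunits R" "d \<in> R" "b = v * y ^ m + x * d" using mod_x[OF ab(2) n(2)] by blast
      note c = c1 c2
      have i: "u \<noteq> 0" "inverse u \<in> R" "v \<noteq> 0" "inverse v \<in> R" using c unitD by auto
      have "a * b / x = u * v * y ^ (n + m) / x + (c * b + u * y ^ n * d)" using x0 c(4,8) by (simp add: field_simps power_add)
      then have "u * v * y ^ (n + m) / x \<in> R" using ab c diff[OF ab(3), of "c * b + u * y ^ n * d"] by simp
      then have "inverse u * (inverse v * (u * v * y ^ (n + m) / x)) \<in> R" by (intro mult i)
      moreover have "inverse u * (inverse v * (u * v * y ^ (n + m) / x)) = y ^ (n + m) / x" using i by (simp add: field_simps)
      ultimately show False using yn by metis
    qed
  qed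
qed

end

text \<open>Dimension two is replaced by divisibility data: x is prime and does not divide y. By
  \<open>reg2I\<close> and \<open>krull\<close> this amounts to Krull dimension two.\<close>

locale regular2 = two_gen R x y for R :: "'a::field set" and x y +
  assumes birat: "frac R = UNIV" and px: "prime_in R x" and yx: "y / x \<notin> R"
begin

lemma x0 [simp]: "x \<noteq> 0" using px by (simp add: prime_in_def)

lemma y0 [simp]: "y \<noteq> 0" using yx by auto

lemma prmD: assumes "prime_in R p" shows "p \<in> nonunits R" "p \<in> R" "p \<noteq> 0" "1 / p \<notin> R"
  "a \<in> R \<Longrightarrow> b \<in> R \<Longrightarrow> a * b / p \<in> R \<Longrightarrow> a / p \<in> R \<or> b / p \<in> R"
proof -
  show 1: "p \<in> nonunits R" "p \<noteq> 0" using assms unfolding prime_in_def by blast+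
  show "p \<in> R" by (rule nonunitD[OF 1(1)])
  show "1 / p \<notin> R" using 1 by (simp add: nonunits_def divide_inverse)
  show "a \<in> R \<Longrightarrow> b \<in> R \<Longrightarrow> a * b / p \<in> R \<Longrightarrow> a / p \<in> R \<or> b / p \<in> R" using assms unfolding prime_in_def by blast
qed

lemma prime_pow: assumes "prime_in R p" "a \<in> R" "a ^ n / p \<in> R" shows "a / p \<in> R"
  using assms(3)
proof (induction n)
  case 0 then show ?case using prmD[OF assms(1)] by simp
next
  case (Suc n) then show ?case using prmD(5)[OF assms(1,2), of "a ^ n"] assms(2) by auto
qed

text \<open>If x lies in P, then by \<open>mod_x\<close> an element of P outside xR would put y into
  P and make P maximal. Otherwise primality makes P saturated with respect to x, and
  \<open>sat_principal\<close> applies.\<close>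

lemma prime_principal:
  assumes P: "prime_ideal P R" "P \<noteq> {0}" "P \<noteq> nonunits R"
  shows "\<exists>a. prime_in R a \<and> P = {a * r | r. r \<in> R}"
proof -
  note ps = prime_sub[OF P(1)]
  have PI: "a \<in> P \<Longrightarrow> b \<in> P \<Longrightarrow> a + b \<in> P" "r \<in> R \<Longrightarrow> a \<in> P \<Longrightarrow> r * a \<in> P" for a b r using ps(2) by (auto simp: is_ideal_def)
  show ?thesis
  proof (cases "x \<in> P")
    case True
    have "P \<subseteq> {x * r | r. r \<in> R}"
    proof (rule ccontr)
      assume "\<not> ?thesis"
      then obtain p where p: "p \<in> P" "p \<notin> {x * r | r. r \<in> R}" by blast
      then obtain u n b where b: "u \<in> R" "u \<notin> nonunits R" "b \<in> R" "p = u * y ^ n + x * b" using mod_x[of p] ps(1) nonunitD by blast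
      have "x * b \<in> P" using PI(2)[OF b(3) True] by (simp add: mult.commute)
      then have "u * y ^ n \<in> P" using ideal_diff[OF ps(2) p(1)] b(4) by (metis add_diff_cancel_right')
      moreover have "u \<notin> P" using b ps(1) by blast
      ultimately have "y ^ n \<in> P" using ps(3)[of u "y ^ n"] b by auto
      then have "y \<in> P" using ps(4) by simp
      then have "nonunits R \<subseteq> P" unfolding gens using True PI by blast
      then show False using P ps(1) by blast
    qed
    moreover have "{x * r | r. r \<in> R} \<subseteq> P" using PI(2)[OF _ True] by (auto simp: mult.commute)
    ultimately show ?thesis using px by blast
  next
    case False
    have "r \<in> P" if "r \<in> R" "x * r \<in> P" for r using ps(3)[OF xR that] False by blast
    then obtain a where a: "a \<in> P" "P = {a * r | r. r \<in> R}" using sat_principal[OF ps(2)] by blast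
    have a0: "a \<noteq> 0" 
    proof
      assume "a = 0"
      then have "P = {0}" using a(2) zero_set by simp
      then show False using P by blast
    qed
    have "prime_in R a" unfolding prime_in_def
    proof (intro conjI ballI impI a0)
      show "a \<in> nonunits R" using a ps(1) by blast
      fix b c assume "b \<in> R" "c \<in> R" "b * c / a \<in> R"
      then show "b / a \<in> R \<or> c / a \<in> R" using ps(3)[of b c] dvd_set[OF a0] a(2) by metis
    qed
    then show ?thesis using a by blast
  qed
qed

text \<open>A nonunit divisor c of b that is minimal for divisibility is irreducible, and
  irreducible elements turn out to be prime. An irreducible c divisible by x is associated to
  x.\<close>

lemma ex_prime_div:
  assumes b: "b \<in> nonunits R" "b \<noteq> 0" shows "\<exists>p. prime_in R p \<and> b / p \<in> R"
proof -
  obtain c where cc: "c \<in> nonunits R \<and> c \<noteq> 0 \<and> b / c \<in> R"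
    and cm: "\<And>d. d \<in> nonunits R \<and> d \<noteq> 0 \<and> b / d \<in> R \<Longrightarrow> c / d \<in> R \<Longrightarrow> d / c \<in> R"
    by (rule principal_max[of "\<lambda>c. c \<in> nonunits R \<and> c \<noteq> 0 \<and> b / c \<in> R" b]) (use b nonunitD in simp_all)
  then have c: "c \<in> nonunits R" "c \<in> nonunits R" "c \<noteq> 0" "b / c \<in> R" by blast+
  have cR: "c \<in> R" using c nonunitD by blast
  have irr: "d / c \<in> R" if d: "d \<in> nonunits R" "d \<noteq> 0" "c / d \<in> R" for d
    using cm d div_trans[OF d(3) c(4) c(3)] by blast
  have "prime_in R c" unfolding prime_in_def
  proof (intro conjI ballI impI c(2,3))
    fix a b assume ab: "a \<in> R" "b \<in> R" "a * b / c \<in> R"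
    show "a / c \<in> R \<or> b / c \<in> R"
    proof (cases "c / x \<in> R")
      case True
      then have xc: "x / c \<in> R" using irr[of x] x_nonunit by simp
      have "a * b / x \<in> R" using div_trans[OF True ab(3) c(3)] .
      then have "a / x \<in> R \<or> b / x \<in> R" using prmD(5)[OF px] ab by blast
      then show ?thesis using div_trans[OF xc] by auto
    next
      case False
      \<comment> \<open>The colon ideal (c : a) is saturated with respect to x, since the prime x
        does not divide c; so it is generated by a divisor d of c. Either d is associated to c, and
        c divides b, or d is a unit, and c divides a.\<close>
      let ?J = "{r \<in> R. r * a / c \<in> R}"
      have J: "is_ideal ?J R"
      proof (rule is_idealI)
        show "0 \<in> ?J" by simp
        show "u + v \<in> ?J" if "u \<in> ?J" "v \<in> ?J" for u v
          using that add[of "u * a / c" "v * a / c"] by (simp add: add_divide_distrib distrib_right)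
        show "r * u \<in> ?J" if "r \<in> R" "u \<in> ?J" for r u
          using that mult[of r "u * a / c"] by (simp add: mult.assoc)
      qed auto
      have sat: "r \<in> ?J" if r: "r \<in> R" "x * r \<in> ?J" for r
      proof -
        define s where "s = x * r * a / c"
        have "s \<in> R" using r by (simp add: s_def)
        moreover have "c * s / x = r * a" using c(3) by (simp add: s_def)
        ultimately have "s / x \<in> R" using prmD(5)[OF px cR] False r ab by auto
        moreover have "s / x = r * a / c" by (simp add: s_def)
        ultimately show ?thesis using r by simp
      qed
      obtain d where d: "d \<in> ?J" "?J = {d * r | r. r \<in> R}" using sat_principal[OF J sat] by blast
      have "c \<in> ?J" using cR ab c(3) by simp
      then have cd: "c \<in> {d * r | r. r \<in> R}" using d(2) by simp
      then have d0: "d \<noteq> 0" using c(3) by auto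
      have cd: "c / d \<in> R" using cd dvd_set[OF d0] by blast
      have dR: "d \<in> R" using d by blast
      show ?thesis
      proof (cases "d \<in> nonunits R")
        case True
        have "b \<in> ?J" using ab by (simp add: mult.commute)
        then have "b / d \<in> R" using d(2) dvd_set[OF d0] by blast
        then show ?thesis using div_trans[OF irr[OF True d0 cd] _ d0] by blast
      next
        case False
        then have "inverse d \<in> R" using unitD[OF dR] by blast
        moreover have "d * a / c \<in> R" using d(1) by blast
        ultimately have "inverse d * (d * a / c) \<in> R" by (rule mult)
        moreover have "inverse d * (d * a / c) = a / c" using d0 by simp
        ultimately have "a / c \<in> R" by (simp only:)
        then show ?thesis ..
      qed
    qed
  qed
  then show ?thesis using c by blast
qed

lemma prime_induct [consumes 2, case_names unit prime]:
  assumes b: "b \<in> R" "b \<noteq> 0"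
    and unit: "\<And>b. b \<in> R \<Longrightarrow> b \<notin> nonunits R \<Longrightarrow> Q b"
    and step: "\<And>p b. prime_in R p \<Longrightarrow> b \<in> R \<Longrightarrow> b \<noteq> 0 \<Longrightarrow> Q b \<Longrightarrow> Q (p * b)"
  shows "Q b"
proof (rule ccontr)
  assume nQ: "\<not> Q b"
  obtain c where cc: "c \<in> R \<and> c \<noteq> 0 \<and> \<not> Q c"
    and cm: "\<And>d. d \<in> R \<and> d \<noteq> 0 \<and> \<not> Q d \<Longrightarrow> c / d \<in> R \<Longrightarrow> d / c \<in> R"
    by (rule principal_max[of "\<lambda>c. c \<in> R \<and> c \<noteq> 0 \<and> \<not> Q c" b]) (use b nQ in simp_all)
  then have c: "c \<in> R" "c \<noteq> 0" "\<not> Q c" by blast+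
  have "c \<in> nonunits R" using unit c by blast
  then obtain p where p: "prime_in R p" "c / p \<in> R" using ex_prime_div c by blast
  note pp = prmD[OF p(1)]
  have cp: "p * (c / p) = c" "c / p \<noteq> 0" using pp c by simp_all
  have nq: "\<not> Q (c / p)" using step[OF p cp(2)] c(3) cp(1) by metis
  have "c / (c / p) \<in> R" using pp c by simp
  then have "c / p / c \<in> R" using cm p(2) cp(2) nq by blast
  then have "1 / p \<in> R" using c by simp
  then show False using pp by blast
qed

lemma coprime_commute: "coprime_in R a b \<longleftrightarrow> coprime_in R b a" unfolding coprime_in_def by blast

lemma coprime_prm: assumes "coprime_in R a b" "prime_in R p" "a / p \<in> R" shows "b / p \<notin> R"
  using assms prmD[OF assms(2)] unfolding coprime_in_def by blast

lemma copI_prm: assumes a: "a \<in> R" "a \<noteq> 0" and p: "\<And>p. prime_in R p \<Longrightarrow> a / p \<in> R \<Longrightarrow> b / p \<notin> R" shows "coprime_in R a b"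
  unfolding coprime_in_def
proof (intro ballI impI notI)
  fix d assume d: "d \<in> nonunits R" "d \<noteq> 0" "a / d \<in> R" "b / d \<in> R"
  then obtain p where q: "prime_in R p" "d / p \<in> R" using ex_prime_div by blast
  then show False using p[OF q(1)] div_trans[OF q(2) d(3,2)] div_trans[OF q(2) d(4,2)] by blast
qed

text \<open>Euclid's lemma for coprime elements, obtained by removing the prime factors of b one at
  a time.\<close>

lemma coprime_cancel:
  assumes "b \<in> R" "b \<noteq> 0" "coprime_in R a b" "a \<in> R" "c \<in> R" "a * c / b \<in> R" shows "c / b \<in> R"
  using assms
proof (induction b arbitrary: c rule: prime_induct)
  case (unit b)
  then show ?case using unitD[of b] mult[of c "inverse b"] by (auto simp: divide_inverse)
next
  case (prime p b)
  note pp = prmD[OF prime(1)]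
  have "coprime_in R a b" unfolding coprime_in_def
  proof (intro ballI impI notI)
    fix d assume d: "d \<in> nonunits R" "d \<noteq> 0" "a / d \<in> R" "b / d \<in> R"
    then have "p * b / d \<in> R" using div_mult(2)[OF d(4) pp(2)] by simp
    then show False using prime.prems(1) d unfolding coprime_in_def by blast
  qed
  moreover have "a * c / b \<in> R" using mult[OF pp(2) prime.prems(4)] pp by simp
  ultimately have cb: "c / b \<in> R" using prime by blast
  have e: "a * (c / b) / p \<in> R" using prime.prems(4) by (simp add: field_simps)
  have "p * b / p \<in> R" using pp prime by simp
  then have "a / p \<notin> R" using coprime_prm[of "p * b" a p] prime.prems(1) prime(1) coprime_commute by blast
  then have "c / b / p \<in> R" using pp(5)[OF _ cb e] prime by blast
  then show ?case by (simp add: mult.commute)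
qed

lemma ex_frac: "\<exists>a\<in>R. \<exists>b\<in>R. b \<noteq> 0 \<and> z = a / b"
proof -
  have "z \<in> Defs.frac R" unfolding birat by simp
  then show ?thesis unfolding Defs.frac_def by blast
qed

text \<open>The denominator is chosen minimal for divisibility: a common factor d would give the
  smaller denominator \<open>b / d\<close>.\<close>

lemma ex_coprime: "\<exists>a\<in>R. \<exists>b\<in>R. b \<noteq> 0 \<and> z = a / b \<and> coprime_in R a b"
proof -
  obtain a0 b0 where 0: "a0 \<in> R" "b0 \<in> R" "b0 \<noteq> 0" "z = a0 / b0" using ex_frac by blast
  obtain b where bb: "b \<in> R \<and> b \<noteq> 0 \<and> b * z \<in> R"
    and bm: "\<And>d. d \<in> R \<and> d \<noteq> 0 \<and> d * z \<in> R \<Longrightarrow> b / d \<in> R \<Longrightarrow> d / b \<in> R"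
    by (rule principal_max[of "\<lambda>b. b \<in> R \<and> b \<noteq> 0 \<and> b * z \<in> R" b0]) (use 0 in simp_all)
  then have b: "b \<in> R" "b \<noteq> 0" "b * z \<in> R" by blast+
  have "coprime_in R (b * z) b" unfolding coprime_in_def
  proof (intro ballI impI notI)
    fix d assume d: "d \<in> nonunits R" "d \<noteq> 0" "b * z / d \<in> R" "b / d \<in> R"
    have "b / d * z \<in> R" "b / d \<noteq> 0" "b / (b / d) \<in> R" using d b nonunitD by simp_all
    then have "b / d / b \<in> R" using bm d(4) by blast
    moreover have "b / d / b = inverse d" using b(2) by (simp add: field_simps)
    ultimately have "inverse d \<in> R" by (simp only:)
    then show False using d by (simp add: nonunits_def)
  qed
  then show ?thesis using b by (intro bexI[of _ "b * z"] bexI[of _ b]) auto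
qed

lemma power_extract:
  assumes p: "prime_in R p" and a: "a \<in> R" "a \<noteq> 0" shows "\<exists>n. a / p ^ n \<in> R \<and> a / p ^ n / p \<notin> R"
proof (rule ccontr)
  assume n: "\<not> ?thesis"
  note pp = prmD[OF p]
  have i: "a / p ^ n \<in> R" for n 
  proof (induction n)
    case 0 then show ?case using a by simp
  next
    case (Suc k) then have "a / p ^ k / p \<in> R" using n by blast
    then show ?case by (simp add: mult.commute)
  qed
  have "\<exists>n. \<exists>t\<in>R. a / p ^ Suc n = a / p ^ n * t"
    by (rule principal_chain[OF i _ pp(2)]) (use pp in simp)
  then obtain n t where t: "t \<in> R" "a / p ^ Suc n = a / p ^ n * t" by blast
  then have "t = 1 / p" using a pp by (simp add: field_simps)
  then show False using t pp by simp
qed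

lemma coprime_xy: "coprime_in R x y"
proof (rule copI_prm)
  fix p assume p: "prime_in R p" "x / p \<in> R"
  have "p * (x / p) / x \<in> R" using prmD[OF p(1)] by simp
  then have "p / x \<in> R \<or> x / p / x \<in> R" using prmD(5)[OF px prmD(2)[OF p(1)] p(2)] by blast
  then have "p / x \<in> R" using prmD[OF p(1)] by (auto simp: field_simps)
  then show "y / p \<notin> R" using yx div_trans[of p x y] prmD[OF p(1)] by blast
qed auto

end

text \<open>A supremum exceeding 1 is witnessed by a chain of at least three primes. Its second
  member is neither zero nor maximal.\<close>

lemma (in sring) krull2_prime:
  assumes "krull_dim R = 2" shows "\<exists>P. prime_ideal P R \<and> P \<noteq> {0} \<and> P \<noteq> nonunits R"
proof -
  let ?S = "{enat n | n. \<exists>P :: nat \<Rightarrow> 'a set. (\<forall>i\<le>n. prime_ideal (P i) R) \<and> (\<forall>i<n. P i \<subset> P (Suc i))}"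
  have "\<exists>e\<in>?S. \<not> e \<le> 1"
  proof (rule ccontr)
    assume "\<not> ?thesis"
    then have "Sup ?S \<le> 1" by (intro Sup_least) blast
    then show False using assms unfolding krull_dim_def by simp
  qed
  then obtain n and P :: "nat \<Rightarrow> 'a set" where n: "\<not> enat n \<le> 1" and P: "\<And>i. i \<le> n \<Longrightarrow> prime_ideal (P i) R" "\<And>i. i < n \<Longrightarrow> P i \<subset> P (Suc i)"
    by auto
  have n2: "2 \<le> n" using n by (simp add: one_enat_def)
  have "0 \<in> P 0" using P(1)[of 0] by (simp add: prime_ideal_def is_ideal_def)
  then have "P 1 \<noteq> {0}" using P(2)[of 0] n2 by auto
  moreover have "P 2 \<subseteq> nonunits R" 
  proof -
    have "is_ideal (P 2) R" "P 2 \<noteq> R" using P(1)[of 2] n2 by (auto simp: prime_ideal_def)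
    then show ?thesis using ideal_unit[of "P 2"] by blast
  qed
  then have "P 1 \<noteq> nonunits R" using P(2)[of 1] n2 by (auto simp: numeral_2_eq_2)
  ultimately show ?thesis using P(1)[of 1] n2 by (intro exI[of _ "P 1"]) simp
qed

lemma (in two_gen) reg2I:
  assumes "krull_dim R = 2" "Defs.frac R = UNIV" shows "regular2 R x y"
proof -
  obtain P where P: "prime_ideal P R" "P \<noteq> {0}" "P \<noteq> nonunits R" using krull2_prime[OF assms(1)] by blast
  show ?thesis by unfold_locales (use assms prime_x[OF P] in blast)+
qed

lemma prime_idealI:
  assumes "is_ideal P R" "1 \<notin> P" "1 \<in> R" "\<And>a b. a \<in> R \<Longrightarrow> b \<in> R \<Longrightarrow> a * b \<in> P \<Longrightarrow> a \<in> P \<or> b \<in> P"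
  shows "prime_ideal P R"
  using assms unfolding prime_ideal_def by blast

context regular2 begin

lemma prime_ideal: assumes "prime_in R p" shows "prime_ideal {p * r | r. r \<in> R} R"
proof (rule prime_idealI)
  note pp = prmD[OF assms]
  show "is_ideal {p * r | r. r \<in> R} R" by (rule ideal_principal[OF pp(2)])
  show "1 \<notin> {p * r | r. r \<in> R}" using dvd_set[OF pp(3)] pp(4) by blast
  show "a \<in> {p * r | r. r \<in> R} \<or> b \<in> {p * r | r. r \<in> R}" if "a \<in> R" "b \<in> R" "a * b \<in> {p * r | r. r \<in> R}" for a b
  proof -
    have "a * b / p \<in> R" using that(3) dvd_set[OF pp(3)] by simp
    then have "a / p \<in> R \<or> b / p \<in> R" by (rule pp(5)[OF that(1,2)])
    then show ?thesis using dvd_set[OF pp(3)] by simp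
  qed
qed simp

lemma nonunit_prime_ideal: "prime_ideal (nonunits R) R"
  by (rule prime_idealI[OF nonunit_ideal one_nonunit one]) (rule nonunit_prime)

text \<open>In a chain of four primes the two middle ones are nonzero and not maximal, hence
  generated by prime elements; a prime element dividing another one is associated to it. The chain
  of zero, xR and the nonunits gives the lower bound.\<close>

lemma krull: "krull_dim R = 2"
proof -
  let ?S = "{enat n | n. \<exists>P :: nat \<Rightarrow> 'a set. (\<forall>i\<le>n. prime_ideal (P i) R) \<and> (\<forall>i<n. P i \<subset> P (Suc i))}"
  have "e \<le> 2" if "e \<in> ?S" for e
  proof -
    obtain n and P :: "nat \<Rightarrow> 'a set" where n: "e = enat n" and P: "\<And>i. i \<le> n \<Longrightarrow> prime_ideal (P i) R" "\<And>i. i < n \<Longrightarrow> P i \<subset> P (Suc i)"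
      using \<open>e \<in> ?S\<close> by auto
    have "n \<le> 2"
    proof (rule ccontr)
      assume "\<not> n \<le> 2"
      then have n3: "3 \<le> n" by simp
      have c: "P 0 \<subset> P 1" "P 1 \<subset> P 2" "P 2 \<subset> P 3" using P(2)[of 0] P(2)[of 1] P(2)[of 2] n3 by (simp_all add: numeral_eq_Suc)
      have pr: "prime_ideal (P 1) R" "prime_ideal (P 2) R" using P(1)[of 1] P(1)[of 2] n3 by simp_all
      have "0 \<in> P 0" using P(1)[of 0] by (simp add: prime_ideal_def is_ideal_def)
      then have "{0} \<subseteq> P 0" by simp
      then have z1: "{0} \<subset> P 1" using c(1) by (rule subset_psubset_trans)
      then have z2: "{0} \<subset> P 2" using c(2) by (rule psubset_trans)
      have nz: "P 1 \<noteq> {0}" "P 2 \<noteq> {0}" using z1 z2 by simp_all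
      have "P 3 \<subseteq> nonunits R" using prime_sub(1)[OF P(1)[of 3]] n3 by simp
      with c(3) have m2: "P 2 \<subset> nonunits R" by (rule psubset_subset_trans)
      with c(2) have m1: "P 1 \<subset> nonunits R" by (rule psubset_trans)
      have nm: "P 1 \<noteq> nonunits R" "P 2 \<noteq> nonunits R" using m1 m2 by simp_all
      obtain a where a: "prime_in R a" "P 1 = {a * r | r. r \<in> R}" using prime_principal[OF pr(1) nz(1) nm(1)] by blast
      obtain b where b: "prime_in R b" "P 2 = {b * r | r. r \<in> R}" using prime_principal[OF pr(2) nz(2) nm(2)] by blast
      note aa = prmD[OF a(1)] and bb = prmD[OF b(1)]
      have "a * 1 \<in> P 1" unfolding a(2) using one by blast
      then have "a \<in> P 2" using c(2) by auto
      then have ab: "a / b \<in> R" unfolding b(2) using dvd_set[OF bb(3)] by blast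
      have "b * (a / b) / a \<in> R" using aa bb by simp
      then have "b / a \<in> R \<or> a / b / a \<in> R" using aa(5)[OF bb(2) ab] by blast
      moreover have "a / b / a = 1 / b" using aa by simp
      ultimately have "b / a \<in> R" using bb(4) by metis
      then have "b \<in> P 1" unfolding a(2) using dvd_set[OF aa(3)] by blast
      then have "P 2 \<subseteq> P 1" unfolding b(2) using prime_sub(2)[OF pr(1)] unfolding is_ideal_def by (auto simp: mult.commute)
      then show False using c by blast
    qed
    then show ?thesis using n by (simp add: numeral_eq_enat)
  qed
  then have le: "Sup ?S \<le> 2" by (rule Sup_least)
  define P where "P i = (if i = 0 then {0} else if i = 1 then {x * r | r. r \<in> R} else nonunits R)" for i :: nat
  have p0: "prime_ideal {0} R" by (rule prime_idealI) (auto simp: is_ideal_def)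
  have "prime_ideal (P i) R" for i using p0 prime_ideal[OF px] nonunit_prime_ideal by (simp add: P_def)
  moreover have "P i \<subset> P (Suc i)" if "i < 2" for i
  proof -
    have x1: "x * 1 \<in> {x * r | r. r \<in> R}" "x * 0 \<in> {x * r | r. r \<in> R}" using one zero by blast+
    have "{x * r | r. r \<in> R} \<subseteq> nonunits R" using nonunit_mult[OF x_nonunit] by blast
    moreover have "y \<notin> {x * r | r. r \<in> R}" using dvd_set[OF x0] yx by blast
    ultimately have "{x * r | r. r \<in> R} \<subset> nonunits R" using y_nonunit by blast
    moreover have "{0} \<subset> {x * r | r. r \<in> R}"
    proof (rule psubsetI)
      show "{0} \<subseteq> {x * r | r. r \<in> R}" using x1(2) by (simp only: mult_zero_right) blast
      have "x \<in> {x * r | r. r \<in> R}" using x1(1) by (simp only: mult_1_right)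
      then show "{0} \<noteq> {x * r | r. r \<in> R}" using x0 by (metis singletonD)
    qed
    moreover have "i = 0 \<or> i = 1" using that by auto
    ultimately show ?thesis by (auto simp: P_def)
  qed
  ultimately have "enat 2 \<in> ?S" by blast
  then have "enat 2 \<le> Sup ?S" by (rule Sup_upper)
  then have "2 \<le> Sup ?S" by (simp add: numeral_eq_enat)
  then show ?thesis using le unfolding krull_dim_def by simp
qed

lemma swap: "regular2 R y x"
proof -
  interpret s: two_gen R y x
  proof unfold_locales
    have "{a * x + b * y |a b. a \<in> R \<and> b \<in> R} = {a * y + b * x |a b. a \<in> R \<and> b \<in> R}"
      by (auto simp: add.commute) (metis add.commute)+
    then show "nonunits R = {a * y + b * x |a b. a \<in> R \<and> b \<in> R}" using gens by simp
  qed
  show ?thesis by (rule s.reg2I[OF krull birat])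
qed

lemma regular: "regular_local_ring R"
  unfolding regular_local_ring_def
proof (intro conjI exI)
  show "local_ring R" by (rule local)
  show "noetherian_ring R" by (rule noeth)
  show "krull_dim R = enat 2" using krull by (simp add: numeral_eq_enat)
  show "finite {x, y}" "{x, y} \<subseteq> R" by simp_all
  show "card {x, y} \<le> 2" by (simp add: card_insert_if)
  have ne: "x \<noteq> y" using yx by auto
  have sum: "(\<Sum>g\<in>{x,y}. c g * g) = c x * x + c y * y" for c :: "'a \<Rightarrow> 'a" using ne by simp
  have "ideal_span R {x, y} = nonunits R"
  proof
    show "ideal_span R {x, y} \<subseteq> nonunits R" unfolding ideal_span_def gens sum by blast
    show "nonunits R \<subseteq> ideal_span R {x, y}"
    proof
      fix z assume "z \<in> nonunits R"
      then obtain a b where ab: "z = a * x + b * y" "a \<in> R" "b \<in> R" unfolding gens by blast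
      define c where "c = (\<lambda>g. if g = x then a else b)"
      have "z = (\<Sum>g\<in>{x,y}. c g * g)" unfolding sum using ab ne by (simp add: c_def)
      moreover have "\<forall>g\<in>{x,y}. c g \<in> R" using ab by (simp add: c_def)
      ultimately show "z \<in> ideal_span R {x, y}" unfolding ideal_span_def by blast
    qed
  qed
  then show "ideal_span R {x, y} = max_ideal R" using nonunit_maxid by simp
qed

end

lemma frac_mono: "Defs.frac D = UNIV \<Longrightarrow> D \<subseteq> R \<Longrightarrow> Defs.frac R = UNIV"
  unfolding Defs.frac_def by blast

text \<open>The generating set has at most two elements and is padded with zeros. The intermediate
  prime supplied by dimension two then excludes the degenerate cases.\<close>

lemma regular_reg2:
  assumes reg: "regular_local_ring R" and k: "krull_dim R = 2" and fr: "Defs.frac R = UNIV"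
  shows "\<exists>x y. regular2 R x y"
proof -
  interpret nring R using reg by unfold_locales (auto simp: regular_local_ring_def noetherian_ring_def)
  have l: "local_ring R" using reg by (simp add: regular_local_ring_def)
  interpret lring R by unfold_locales (rule regular_max(2)[OF l])
  obtain G where G: "finite G" "G \<subseteq> R" "card G \<le> 2" "ideal_span R G = nonunits R"
    using reg k regular_max(1)[OF l] unfolding regular_local_ring_def by (auto simp: numeral_eq_enat)
  have "\<exists>x y. nonunits R = {a * x + b * y | a b. a \<in> R \<and> b \<in> R}"
  proof -
    consider "card G = 0" | "card G = 1" | "card G = 2" using G(3) by linarith
    then show ?thesis
    proof cases
      case 1
      then have "G = {}" using G(1) by simp
      then have "nonunits R = {0}" using G(4) by (auto simp: ideal_span_def)
      moreover have "0 * 0 + 0 * 0 \<in> {a * 0 + b * 0 | a b. a \<in> R \<and> b \<in> R}" using zero by blast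
      then have "{a * 0 + b * 0 | a b. a \<in> R \<and> b \<in> R} = {0}" by auto
      ultimately show ?thesis by (intro exI[of _ 0]) simp
    next
      case 2
      then obtain g where g: "G = {g}" by (auto simp: card_1_singleton_iff)
      have "nonunits R = {a * g + b * 0 | a b. a \<in> R \<and> b \<in> R}"
      proof
        show "nonunits R \<subseteq> {a * g + b * 0 | a b. a \<in> R \<and> b \<in> R}"
        proof
          fix z assume "z \<in> nonunits R"
          then obtain c where "z = c g * g" "c g \<in> R" unfolding G(4)[symmetric] ideal_span_def g by auto
          then have "z = c g * g + 0 * 0" by simp
          then show "z \<in> {a * g + b * 0 | a b. a \<in> R \<and> b \<in> R}" using \<open>c g \<in> R\<close> zero by blast
        qed
        show "{a * g + b * 0 | a b. a \<in> R \<and> b \<in> R} \<subseteq> nonunits R"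
        proof
          fix z assume "z \<in> {a * g + b * 0 | a b. a \<in> R \<and> b \<in> R}"
          then obtain a where "z = a * g" "a \<in> R" by auto
          then show "z \<in> nonunits R" unfolding G(4)[symmetric] ideal_span_def g by (intro CollectI exI[of _ "\<lambda>_. a"]) simp
        qed
      qed
      then show ?thesis by blast
    next
      case 3
      then obtain g h where g: "G = {g, h}" "g \<noteq> h" by (auto simp: card_2_iff)
      have sum: "(\<Sum>i\<in>{g,h}. c i * i) = c g * g + c h * h" for c :: "'a \<Rightarrow> 'a" using g by simp
      have "nonunits R = {a * g + b * h | a b. a \<in> R \<and> b \<in> R}"
      proof
        show "nonunits R \<subseteq> {a * g + b * h | a b. a \<in> R \<and> b \<in> R}" unfolding G(4)[symmetric] ideal_span_def g sum by blast
        show "{a * g + b * h | a b. a \<in> R \<and> b \<in> R} \<subseteq> nonunits R"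
        proof
          fix z assume "z \<in> {a * g + b * h | a b. a \<in> R \<and> b \<in> R}"
          then obtain a b where "z = a * g + b * h" "a \<in> R" "b \<in> R" by blast
          then show "z \<in> nonunits R" unfolding G(4)[symmetric] ideal_span_def g(1) sum
            using g(2) by (intro CollectI exI[of _ "\<lambda>i. if i = g then a else b"]) simp
        qed
      qed
      then show ?thesis by blast
    qed
  qed
  then obtain x y where "nonunits R = {a * x + b * y | a b. a \<in> R \<and> b \<in> R}" by blast
  then interpret two_gen R x y by unfold_locales
  show ?thesis using reg2I[OF k fr] by blast
qed

lemma QD_iff:
  assumes "Defs.frac D = UNIV" shows "\<alpha> \<in> QD D \<longleftrightarrow> D \<subseteq> \<alpha> \<and> (\<exists>x y. regular2 \<alpha> x y)"
  using regular_reg2[OF _ _ frac_mono[OF assms]] regular2.regular regular2.krull unfolding QD_def by blast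

section \<open>Discrete valuation rings and localizations at height-one primes\<close>

locale dvr = sring R for R :: "'a::field set" + fixes t
  assumes tR: "t \<in> R" and t0: "t \<noteq> 0" and tn: "inverse t \<notin> R"
    and ex: "z \<noteq> 0 \<Longrightarrow> \<exists>n::int. z * t powi n \<in> R \<and> inverse (z * t powi n) \<in> R"
begin

text \<open>The exponent is unique for nonzero z because \<open>inverse t\<close> is not in R, see
  \<open>v_unique\<close>. The value at 0 is arbitrary, so zero is treated apart in the statements
  about \<open>v\<close>.\<close>

definition v :: "'a \<Rightarrow> int" where "v z = (SOME n. z * t powi (-n) \<in> R \<and> inverse (z * t powi (-n)) \<in> R)"

lemma v_un: assumes "z \<noteq> 0" shows "z * t powi (- v z) \<in> R" "inverse (z * t powi (- v z)) \<in> R"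
proof -
  obtain n where "z * t powi n \<in> R \<and> inverse (z * t powi n) \<in> R" using ex[OF assms] by blast
  then have "z * t powi (-(-n)) \<in> R \<and> inverse (z * t powi (-(-n))) \<in> R" by simp
  then have "z * t powi (- v z) \<in> R \<and> inverse (z * t powi (- v z)) \<in> R" unfolding v_def by (rule someI)
  then show "z * t powi (- v z) \<in> R" "inverse (z * t powi (- v z)) \<in> R" by blast+
qed

lemma powi_in: "n \<ge> 0 \<Longrightarrow> t powi n \<in> R"
  using tR by (simp add: power_int_def)

lemma powi_notin: assumes "n < 0" shows "t powi n \<notin> R"
proof
  assume "t powi n \<in> R"
  then have "t powi n * t powi (- n - 1) \<in> R" using powi_in[of "-n-1"] assms by simp
  moreover have "t powi n * t powi (- n - 1) = inverse t" using t0 by (simp flip: power_int_add add: power_int_minus)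
  ultimately show False using tn by simp
qed

lemma v_decomp: assumes "z \<noteq> 0" obtains u where "z = u * t powi (v z)" "u \<in> R" "inverse u \<in> R" "u \<noteq> 0"
proof -
  have e: "z = (z * t powi (- v z)) * t powi (v z)" using t0 by (simp add: power_int_minus)
  moreover have "z * t powi (- v z) \<noteq> 0" using assms t0 by simp
  ultimately show ?thesis using that[OF e v_un[OF assms]] by blast
qed

lemma v_unique: assumes "u \<in> R" "inverse u \<in> R" "u \<noteq> 0" "z = u * t powi n" shows "v z = n"
proof -
  have z0: "z \<noteq> 0" using assms t0 by simp
  obtain w where w: "z = w * t powi (v z)" "w \<in> R" "inverse w \<in> R" "w \<noteq> 0" using v_decomp[OF z0] .
  have a: "inverse u * w = t powi (n - v z)"
  proof -
    have "u * t powi n = w * t powi v z" using assms(4) w(1) by simp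
    then show ?thesis using assms(3) t0 by (simp add: power_int_diff field_simps)
  qed
  have b: "inverse w * u = t powi (v z - n)"
  proof -
    have "u * t powi n = w * t powi v z" using assms(4) w(1) by simp
    then show ?thesis using w(4) t0 by (simp add: power_int_diff field_simps)
  qed
  have "t powi (n - v z) \<in> R" "t powi (v z - n) \<in> R" using a b mult[OF assms(2) w(2)] mult[OF w(3) assms(1)] by simp_all
  then have "\<not> n - v z < 0" "\<not> v z - n < 0" using powi_notin by blast+
  then show ?thesis by linarith
qed

lemma v_mult: assumes "z \<noteq> 0" "w \<noteq> 0" shows "v (z * w) = v z + v w"
proof -
  obtain a where a: "z = a * t powi (v z)" "a \<in> R" "inverse a \<in> R" "a \<noteq> 0" using v_decomp[OF assms(1)] .
  obtain b where b: "w = b * t powi (v w)" "b \<in> R" "inverse b \<in> R" "b \<noteq> 0" using v_decomp[OF assms(2)] .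
  show ?thesis
  proof (rule v_unique[of "a * b"])
    have "z * w = (a * t powi (v z)) * (b * t powi (v w))" using a(1) b(1) by simp
    then show "z * w = a * b * t powi (v z + v w)" using t0 by (simp add: power_int_add mult_ac)
  qed (use a b in simp_all)
qed

lemma v_one: "v 1 = 0" by (rule v_unique[of 1]) simp_all
lemma v_t: "v t = 1" by (rule v_unique[of 1]) simp_all
lemma v_inverse: "z \<noteq> 0 \<Longrightarrow> v (inverse z) = - v z" using v_mult[of z "inverse z"] v_one by simp
lemma v_divide: "z \<noteq> 0 \<Longrightarrow> w \<noteq> 0 \<Longrightarrow> v (z / w) = v z - v w" using v_mult[of z "inverse w"] v_inverse by (simp add: divide_inverse)
lemma v_pow: "z \<noteq> 0 \<Longrightarrow> v (z ^ n) = int n * v z" 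
  by (induction n) (simp_all add: v_one v_mult algebra_simps)

lemma in_iff: assumes "z \<noteq> 0" shows "z \<in> R \<longleftrightarrow> v z \<ge> 0"
proof -
  obtain a where a: "z = a * t powi (v z)" "a \<in> R" "inverse a \<in> R" "a \<noteq> 0" using v_decomp[OF assms] .
  show ?thesis
  proof
    assume "v z \<ge> 0" then show "z \<in> R" using mult[OF a(2) powi_in] a(1) by metis
  next
    assume "z \<in> R"
    then have "inverse a * z \<in> R" using a(3) by simp
    moreover have "inverse a * z = t powi (v z)" by (subst a(1)) (use a(4) in simp)
    ultimately have "t powi (v z) \<in> R" by (simp only:)
    then show "v z \<ge> 0" using powi_notin[of "v z"] by linarith
  qed
qed

lemma nonunit_iff: "z \<in> nonunits R \<longleftrightarrow> z = 0 \<or> v z \<ge> 1"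
proof (cases "z = 0")
  case False
  then have "z \<in> R \<longleftrightarrow> v z \<ge> 0" "inverse z \<in> R \<longleftrightarrow> v z \<le> 0"
    using in_iff[of z] in_iff[of "inverse z"] v_inverse[of z] by simp_all
  then show ?thesis using False unfolding nonunits_def by auto
qed simp

lemma valuation: "z \<in> R \<or> inverse z \<in> R"
  using in_iff[of z] in_iff[of "inverse z"] v_inverse[of z] by (cases "z = 0") auto

lemma div_iff: assumes "w \<noteq> 0" shows "z / w \<in> R \<longleftrightarrow> z = 0 \<or> v z \<ge> v w"
  using assms in_iff[of "z/w"] v_divide[of z w] by (cases "z = 0") auto

text \<open>An element z outside R has negative value, so \<open>inverse t\<close> is a multiple of
  z with a factor in R. This is how valuation rings are later shown to be equal from one
  inclusion.\<close>

lemma maximal: assumes S: "subring S" "R \<subseteq> S" "inverse t \<notin> S" shows "S = R"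
proof -
  interpret S: sring S by unfold_locales (rule S)
  have "z \<in> R" if z: "z \<in> S" for z
  proof (rule ccontr)
    assume n: "z \<notin> R"
    then have z0: "z \<noteq> 0" by auto
    have "v z < 0" using in_iff[OF z0] n by linarith
    then have "v (inverse t / z) \<ge> 0" using v_divide[of "inverse t" z] z0 t0 v_inverse[OF t0] v_t by simp
    then have "inverse t / z \<in> R" using in_iff[of "inverse t / z"] z0 t0 by simp
    then have "inverse t / z * z \<in> S" using S.mult[OF _ z] S(2) by blast
    then show False using z0 S(3) by simp
  qed
  then show ?thesis using S by blast
qed

end

definition localization :: "'a::field set \<Rightarrow> 'a \<Rightarrow> 'a set" where
  "localization R p = {a / b | a b. a \<in> R \<and> b \<in> R \<and> b / p \<notin> R}"

lemma (in regular2) localization_dvr: assumes p: "prime_in R p" shows "dvr (localization R p) p" "R \<subseteq> localization R p"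
proof -
  note pp = prmD[OF p]
  have I: "a / b \<in> localization R p" if "a \<in> R" "b \<in> R" "b / p \<notin> R" for a b using that unfolding localization_def by blast
  have m: "b * d / p \<notin> R" if "b \<in> R" "b / p \<notin> R" "d \<in> R" "d / p \<notin> R" for b d using that pp(5) by blast
  show sub: "R \<subseteq> localization R p"
  proof
    fix a assume "a \<in> R" then have "a / 1 \<in> localization R p" using I[of a 1] pp by simp
    then show "a \<in> localization R p" by simp
  qed
  show "dvr (localization R p) p"
  proof unfold_locales
    show "subring (localization R p)" unfolding subring_def
    proof (intro conjI ballI)
      show "0 \<in> localization R p" "1 \<in> localization R p" using sub zero one by blast+
      fix u w assume "u \<in> localization R p" "w \<in> localization R p"
      then obtain a b c d where u: "u = a / b" "a \<in> R" "b \<in> R" "b / p \<notin> R" and w: "w = c / d" "c \<in> R" "d \<in> R" "d / p \<notin> R" unfolding localization_def by blast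
      have nz: "b \<noteq> 0" "d \<noteq> 0" using u w by auto
      have "(a * d + c * b) / (b * d) \<in> localization R p" "(a * c) / (b * d) \<in> localization R p" using u w m by (auto intro!: I)
      moreover have "u + w = (a * d + c * b) / (b * d)" "u * w = (a * c) / (b * d)" unfolding u(1) w(1) using nz by (simp_all add: field_simps)
      ultimately show "u + w \<in> localization R p" "u * w \<in> localization R p" by simp_all
    next
      fix u assume "u \<in> localization R p"
      then obtain a b where u: "u = a / b" "a \<in> R" "b \<in> R" "b / p \<notin> R" unfolding localization_def by blast
      then have "(-a) / b \<in> localization R p" by (intro I) simp_all
      then show "- u \<in> localization R p" using u by simp
    qed
    show "p \<in> localization R p" using sub pp by blast
    show "p \<noteq> 0" using pp by blast
    show "inverse p \<notin> localization R p"
    proof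
      assume "inverse p \<in> localization R p"
      then obtain a b where u: "inverse p = a / b" "a \<in> R" "b \<in> R" "b / p \<notin> R" unfolding localization_def by blast
      then have "b \<noteq> 0" by auto
      then have "b / p = a" using u(1) pp(3) by (simp add: field_simps)
      then show False using u by simp
    qed
    fix z :: 'a assume z: "z \<noteq> 0"
    obtain a b where ab: "a \<in> R" "b \<in> R" "b \<noteq> 0" "z = a / b" using ex_frac by blast
    have "a \<noteq> 0" using z ab by auto
    obtain n where n: "a / p ^ n \<in> R" "a / p ^ n / p \<notin> R" using power_extract[OF p ab(1) \<open>a \<noteq> 0\<close>] by blast
    obtain k where k: "b / p ^ k \<in> R" "b / p ^ k / p \<notin> R" using power_extract[OF p ab(2,3)] by blast
    have "p powi (int k - int n) = p ^ k / p ^ n" using pp by (simp add: power_int_diff)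
    then have "z * p powi (int k - int n) = (a / p ^ n) / (b / p ^ k)" using pp(3) ab(3,4) by (simp add: field_simps)
    moreover have "inverse ((a / p ^ n) / (b / p ^ k)) = (b / p ^ k) / (a / p ^ n)" by (rule inverse_divide)
    ultimately show "\<exists>n::int. z * p powi n \<in> localization R p \<and> inverse (z * p powi n) \<in> localization R p"
      using I[OF n(1) k] I[OF k(1) n] by metis
  qed
qed

text \<open>In lowest terms, a prime p dividing the denominator of z would, by membership in the
  localization at p, also divide the numerator.\<close>

lemma (in regular2) mem_loc:
  assumes "\<And>p. prime_in R p \<Longrightarrow> z \<in> localization R p" shows "z \<in> R"
proof -
  obtain a b where ab: "a \<in> R" "b \<in> R" "b \<noteq> 0" "z = a / b" "coprime_in R a b" using ex_coprime by blast
  show ?thesis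
  proof (cases "b \<in> nonunits R")
    case False then have "inverse b \<in> R" using unitD ab by blast
    then show ?thesis using ab mult[of a "inverse b"] by (simp add: divide_inverse)
  next
    case True
    then obtain p where p: "prime_in R p" "b / p \<in> R" using ex_prime_div ab by blast
    note pp = prmD[OF p(1)]
    obtain c d where cd: "z = c / d" "c \<in> R" "d \<in> R" "d / p \<notin> R" using assms[OF p(1)] unfolding localization_def by blast
    have "d \<noteq> 0" using cd by auto
    then have "a * d / p = b / p * c" using cd(1) ab(3,4) by (simp add: field_simps)
    then have "a * d / p \<in> R" using mult[OF p(2) cd(2)] by (simp only:)
    then have "a / p \<in> R" using pp(5)[OF ab(1) cd(3)] cd(4) by blast
    then show ?thesis using coprime_prm[OF ab(5) p(1)] p(2) by blast
  qed
qed

subsection \<open>The order valuation and quadratic transforms\<close>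

text \<open>For a regular local ring with maximal ideal \<open>(x, y)\<close> and \<open>z = y / x\<close> this is the order valuation ring.\<close>
definition order_ring :: "'a::field set \<Rightarrow> 'a \<Rightarrow> 'a set" where
  "order_ring R z = {poly p z / poly q z | p q. p \<in> polys R \<and> q \<in> polys R \<and> q \<notin> mpolys R}"

lemma degree_strip: assumes "degree p \<le> Suc n" shows "degree (p - monom (coeff p (Suc n)) (Suc n)) \<le> n"
proof (rule degree_le, intro allI impI)
  fix i assume "n < i"
  then show "coeff (p - monom (coeff p (Suc n)) (Suc n)) i = 0"
    using assms by (cases "i = Suc n") (auto simp: coeff_eq_0)
qed

context regular2 begin

text \<open>The factor \<open>a ^ n\<close> turns the value into a form of degree n in a and b. For
  this reason degree bounds are carried along with the representing polynomials.\<close>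

lemma homog: assumes a: "a \<in> R" "a \<noteq> 0" "b \<in> R" "p \<in> polys R" "degree p \<le> n"
  shows "a ^ n * poly p (b / a) \<in> R"
proof -
  have "a ^ n * poly p (b / a) = (\<Sum>i\<le>degree p. coeff p i * b ^ i * a ^ (n - i))"
    unfolding poly_altdef sum_distrib_left
  proof (rule sum.cong)
    fix i assume "i \<in> {..degree p}"
    then have "a ^ n = a ^ (n - i) * a ^ i" using assms(5) by (simp flip: power_add)
    then show "a ^ n * (coeff p i * (b / a) ^ i) = coeff p i * b ^ i * a ^ (n - i)" using a(2) by (simp add: power_divide)
  qed simp
  also have "\<dots> \<in> R" using a polys_coeff[OF a(4)] by (intro setsum mult pow) auto
  finally show ?thesis .
qed

lemma coprime_pow_cancel: assumes "a \<in> R" "a \<noteq> 0" "coprime_in R b a" "b \<in> R" "c \<in> R" "b ^ k * c / a \<in> R" shows "c / a \<in> R"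
  using assms(6)
proof (induction k)
  case (Suc k)
  have "b * (b ^ k * c) / a \<in> R" using Suc(2) by (simp add: mult.assoc)
  then have "b ^ k * c / a \<in> R" using coprime_cancel[OF assms(1,2,3,4), of "b ^ k * c"] assms by simp
  then show ?case by (rule Suc.IH)
qed simp

text \<open>Clearing denominators shows that a divides the leading coefficient c times a power of b,
  hence divides c. So c is a nonunit, and \<open>c * (b / a) ^ Suc n\<close> can be rewritten as
  \<open>(c / a * b) * (b / a) ^ n\<close>, which lowers the degree and changes coefficients only by
  nonunits.\<close>

lemma residually_transcendental:
  assumes a: "a \<in> nonunits R" "b \<in> nonunits R" "a \<noteq> 0" "coprime_in R b a"
    and p: "p \<in> polys R" "poly p (b / a) = 0"
  shows "p \<in> mpolys R"
proof -
  have aR: "a \<in> R" "b \<in> R" using a nonunitD by auto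
  have "p \<in> mpolys R" if "degree p \<le> n" "p \<in> polys R" "poly p (b / a) = 0" for n p
    using that
  proof (induction n arbitrary: p)
    case 0
    then obtain c where "p = [:c:]" by (meson degree_eq_zeroE le_zero_eq)
    then show ?case using 0 by simp
  next
    case (Suc n)
    define c where "c = coeff p (Suc n)"
    have cR: "c \<in> R" using polys_coeff[OF Suc(3)] by (simp add: c_def)
    define q where "q = p - monom c (Suc n)"
    have q: "q \<in> polys R" "degree q \<le> n" using Suc(2,3) cR degree_strip by (auto simp: q_def c_def)
    have qv: "poly q (b / a) = - (c * (b / a) ^ Suc n)" using Suc(4) by (simp add: q_def poly_monom)
    have "b ^ Suc n * c / a = - (a ^ n * poly q (b / a))" unfolding qv using a(3) by (simp add: power_divide field_simps)
    also have "\<dots> \<in> R" using homog[OF aR(1) a(3) aR(2) q] by (rule neg)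
    finally have d: "c / a \<in> R" by (rule coprime_pow_cancel[OF aR(1) a(3,4) aR(2) cR])
    define r where "r = q + monom (c / a * b) n"
    have r: "r \<in> polys R" "degree r \<le> n" unfolding r_def
      using q d aR mult[OF d aR(2)] by (auto intro!: degree_add_le degree_monom_le)
    have "poly r (b / a) = 0" unfolding r_def using qv a(3) by (simp add: poly_monom)
    then have rm: "r \<in> mpolys R" using Suc.IH r by blast
    have "c / a * b \<in> nonunits R" "c / a * a \<in> nonunits R" by (rule nonunit_mult2[OF _ d], rule a)+
    then have "monom (c / a * b) n \<in> mpolys R" "monom c (Suc n) \<in> mpolys R" using a(3) by (auto intro: mpolys_monom)
    then have "r - monom (c / a * b) n + monom c (Suc n) \<in> mpolys R" using rm by (intro mpolys_add mpolys_diff)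
    then show ?case by (simp add: r_def q_def)
  qed
  then show ?thesis using p by blast
qed

abbreviation "tau \<equiv> y / x"

abbreviation "Or \<equiv> order_ring R tau"

text \<open>Since y is x times \<open>tau\<close>, a nonunit of R is x times a linear expression in
  \<open>tau\<close>. The degree rises by one, in step with the power of x split off in
  \<open>ord_ex\<close>.\<close>

lemma mpolys_xE:
  assumes p: "p \<in> mpolys R" "degree p \<le> n" shows "\<exists>q\<in>polys R. degree q \<le> Suc n \<and> poly p tau = x * poly q tau"
proof -
  have "\<forall>i. \<exists>a b. a \<in> R \<and> b \<in> R \<and> coeff p i = a * x + b * y" using p(1) unfolding mpolys_def gens by blast
  then obtain a b where ab: "\<And>i. a i \<in> R" "\<And>i. b i \<in> R" "\<And>i. coeff p i = a i * x + b i * y" by metis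
  define q where "q = (\<Sum>i\<le>degree p. monom (a i) i + monom (b i) (Suc i))"
  have "q \<in> polys R" unfolding q_def polys_def using ab by (auto simp: coeff_sum intro!: setsum)
  moreover have "degree q \<le> Suc n" unfolding q_def
    by (intro degree_sum_le degree_add_le order_trans[OF degree_monom_le]) (use p in auto)
  moreover have "poly p tau = x * poly q tau"
  proof -
    have "poly p tau = (\<Sum>i\<le>degree p. coeff p i * tau ^ i)" by (rule poly_altdef)
    also have "\<dots> = (\<Sum>i\<le>degree p. x * (a i * tau ^ i + b i * tau ^ Suc i))"
      unfolding ab(3) by (rule sum.cong) (simp_all add: algebra_simps)
    also have "\<dots> = x * poly q tau" by (simp add: q_def poly_sum poly_monom sum_distrib_left)
    finally show ?thesis .
  qed
  ultimately show ?thesis by blast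
qed

lemma tau_transc: "p \<in> polys R \<Longrightarrow> poly p tau = 0 \<Longrightarrow> p \<in> mpolys R"
  using residually_transcendental[of x y] x_nonunit y_nonunit x0 coprime_xy coprime_commute by blast

text \<open>Together with \<open>mpolys_xE\<close> this says that x generates in
  \<open>adjoin R tau\<close> the same ideal as the nonunits of R, and that the quotient is a
  polynomial ring over the residue field.\<close>

lemma xE_mpol: assumes "p \<in> polys R" "q \<in> polys R" "poly p tau = x * poly q tau" shows "p \<in> mpolys R"
proof -
  have "p - smult x q \<in> mpolys R" by (rule tau_transc) (use assms in simp_all)
  then have "(p - smult x q) + smult x q \<in> mpolys R" using assms x_nonunit by (intro mpolys_add mpolys_smult)
  then show ?thesis by simp
qed

lemma nz: "p \<in> polys R \<Longrightarrow> p \<notin> mpolys R \<Longrightarrow> poly p tau \<noteq> 0" using tau_transc by blast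

lemma E_nring: "nring (adjoin R tau)"
  by unfold_locales (rule adjoin_subring, rule hilbert_basis[OF noeth])

lemma x_inv_E: "inverse x \<notin> adjoin R tau"
proof
  assume "inverse x \<in> adjoin R tau"
  then obtain p where p: "inverse x = poly p tau" "p \<in> polys R" by (auto simp: adjoin_def)
  have "poly 1 tau = x * poly p tau" unfolding p(1)[symmetric] by simp
  then show False using xE_mpol[OF polys_1 p(2)] mpolys_1 by blast
qed

text \<open>Here n is the order of a, and p modulo nonunits is its initial form. While p has only
  nonunit coefficients, another factor x can be split off; splitting forever is impossible because
  \<open>adjoin R tau\<close> is Noetherian and does not contain \<open>inverse x\<close>. The bound
  on the degree expresses homogeneity.\<close>

lemma ord_ex:
  assumes a: "a \<in> R" "a \<noteq> 0" shows "\<exists>n p. p \<in> polys R \<and> p \<notin> mpolys R \<and> degree p \<le> n \<and> a = x ^ n * poly p tau"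
proof (rule ccontr)
  assume n: "\<not> ?thesis"
  interpret E: nring "adjoin R tau" by (rule E_nring)
  have F: "\<exists>p\<in>polys R. degree p \<le> n \<and> a = x ^ n * poly p tau" for n
  proof (induction n)
    case 0 show ?case using a by (intro bexI[of _ "[:a:]"]) auto
  next
    case (Suc n)
    then obtain p where p: "p \<in> polys R" "degree p \<le> n" "a = x ^ n * poly p tau" by blast
    then have "p \<in> mpolys R" using n by blast
    then obtain q where "q \<in> polys R" "degree q \<le> Suc n" "poly p tau = x * poly q tau" using mpolys_xE p by blast
    then show ?case using p by (intro bexI[of _ q]) auto
  qed
  have i: "a / x ^ n \<in> adjoin R tau" for n
  proof -
    obtain p where p: "p \<in> polys R" "a = x ^ n * poly p tau" using F by blast
    then have "a / x ^ n = poly p tau" by simp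
    then show ?thesis using adjI[OF p(1)] by simp
  qed
  have "\<exists>n. \<exists>t\<in>adjoin R tau. a / x ^ Suc n = a / x ^ n * t"
    by (rule E.principal_chain[of "\<lambda>n. a / x ^ n" x, OF i _ adjoin_base[OF xR]]) simp
  then obtain n t where t: "t \<in> adjoin R tau" "a / x ^ Suc n = a / x ^ n * t" by blast
  then have "t = inverse x" using a by (simp add: field_simps)
  then show False using t x_inv_E by simp
qed

lemma OI: "p \<in> polys R \<Longrightarrow> q \<in> polys R \<Longrightarrow> q \<notin> mpolys R \<Longrightarrow> poly p tau / poly q tau \<in> Or"
  unfolding order_ring_def by blast

lemma E_O: "adjoin R tau \<subseteq> Or"
proof
  fix z assume "z \<in> adjoin R tau"
  then obtain p where "z = poly p tau" "p \<in> polys R" by (auto simp: adjoin_def)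
  then show "z \<in> Or" using OI[of p 1] by simp
qed

lemma R_O: "R \<subseteq> Or" using E_O adjoin_base by blast

lemma O_dvr: "dvr Or x"
proof unfold_locales
  show "subring Or" unfolding subring_def
  proof (intro conjI ballI)
    show "0 \<in> Or" "1 \<in> Or" using R_O zero one by blast+
    fix u w assume "u \<in> Or" "w \<in> Or"
    then obtain p q r s where u: "u = poly p tau / poly q tau" "p \<in> polys R" "q \<in> polys R" "q \<notin> mpolys R"
      and w: "w = poly r tau / poly s tau" "r \<in> polys R" "s \<in> polys R" "s \<notin> mpolys R" unfolding order_ring_def by blast
    have n0: "poly q tau \<noteq> 0" "poly s tau \<noteq> 0" using nz u w by auto
    have qs: "q * s \<in> polys R" "q * s \<notin> mpolys R" using u w gauss by auto
    have "poly (p * s + r * q) tau / poly (q * s) tau \<in> Or" "poly (p * r) tau / poly (q * s) tau \<in> Or"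
      by (rule OI[OF _ qs], use u w in simp)+
    moreover have "u + w = poly (p * s + r * q) tau / poly (q * s) tau" "u * w = poly (p * r) tau / poly (q * s) tau"
      unfolding u(1) w(1) using n0 by (simp_all add: field_simps)
    ultimately show "u + w \<in> Or" "u * w \<in> Or" by simp_all
  next
    fix u assume "u \<in> Or"
    then obtain p q where u: "u = poly p tau / poly q tau" "p \<in> polys R" "q \<in> polys R" "q \<notin> mpolys R" unfolding order_ring_def by blast
    have "poly (0 - p) tau / poly q tau \<in> Or" using u by (intro OI polys_diff) auto
    then show "- u \<in> Or" using u by simp
  qed
  show "x \<in> Or" using R_O xR by blast
  show "x \<noteq> 0" by simp
  show "inverse x \<notin> Or"
  proof
    assume "inverse x \<in> Or"
    then obtain p q where u: "inverse x = poly p tau / poly q tau" "p \<in> polys R" "q \<in> polys R" "q \<notin> mpolys R" unfolding order_ring_def by blast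
    then have "poly q tau = x * poly p tau" using nz[OF u(3,4)] x0 by (simp add: field_simps)
    then show False using xE_mpol[OF u(3,2)] u(4) by blast
  qed
  fix z :: 'a assume z: "z \<noteq> 0"
  obtain a b where ab: "a \<in> R" "b \<in> R" "b \<noteq> 0" "z = a / b" using ex_frac by blast
  have "a \<noteq> 0" using z ab by auto
  obtain n p where p: "p \<in> polys R" "p \<notin> mpolys R" "a = x ^ n * poly p tau" using ord_ex[OF ab(1) \<open>a \<noteq> 0\<close>] by blast
  obtain m q where q: "q \<in> polys R" "q \<notin> mpolys R" "b = x ^ m * poly q tau" using ord_ex[OF ab(2,3)] by blast
  have pw: "x powi (int m - int n) = x ^ m / x ^ n" by (simp add: power_int_diff)
  have e: "z * x powi (int m - int n) = poly p tau / poly q tau"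
    unfolding pw ab(4) p(3) q(3) using nz[OF q(1,2)] x0 by simp
  moreover have "inverse (poly p tau / poly q tau) = poly q tau / poly p tau" by (rule inverse_divide)
  ultimately have "z * x powi (int m - int n) \<in> Or \<and> inverse (z * x powi (int m - int n)) \<in> Or"
    using OI[OF p(1) q(1,2)] OI[OF q(1) p(1,2)] by simp
  then show "\<exists>n::int. z * x powi n \<in> Or \<and> inverse (z * x powi n) \<in> Or" by blast
qed

sublocale V: dvr Or x by (rule O_dvr)

lemma O_unit: assumes "p \<in> polys R" "p \<notin> mpolys R" shows "poly p tau \<in> Or" "inverse (poly p tau) \<in> Or" "poly p tau \<noteq> 0" "V.v (poly p tau) = 0"
proof -
  show 1: "poly p tau \<in> Or" "inverse (poly p tau) \<in> Or" "poly p tau \<noteq> 0"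
    using OI[OF assms(1) polys_1 mpolys_1] OI[OF polys_1 assms] nz[OF assms] by (simp_all add: divide_inverse)
  show "V.v (poly p tau) = 0" by (rule V.v_unique[OF 1]) simp
qed

lemma mpolys_O: assumes "p \<in> mpolys R" shows "poly p tau / x \<in> Or" "poly p tau \<in> nonunits Or"
proof -
  obtain q where q: "q \<in> polys R" "poly p tau = x * poly q tau" using mpolys_xE[OF assms order_refl] by blast
  then have "poly p tau / x = poly q tau" by simp
  then show 1: "poly p tau / x \<in> Or" using adjI[OF q(1)] E_O by auto
  show "poly p tau \<in> nonunits Or" using 1 V.div_iff[of x "poly p tau"] V.v_t V.nonunit_iff by simp
qed

lemma nonunit_O: assumes "a \<in> nonunits R" shows "a \<in> nonunits Or"
proof -
  have "[:a:] \<in> mpolys R" using assms by (auto simp: mpolys_def coeff_pCons split: nat.split)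
  then show ?thesis using mpolys_O(2)[of "[:a:]"] by simp
qed

lemma O_repr: assumes "z \<in> Or" obtains p q where "z = poly p tau / poly q tau" "p \<in> polys R" "q \<in> polys R" "q \<notin> mpolys R"
  using assms unfolding order_ring_def by blast

end

text \<open>By maximality R would equal T, but R is not a valuation ring: it contains neither
  \<open>y / x\<close> nor \<open>x / y\<close>.\<close>

lemma (in regular2) no_dvr: assumes "dvr T t" "T \<subseteq> R" "t \<in> nonunits R" shows False
proof -
  interpret T: dvr T t by (rule assms(1))
  have "inverse t \<notin> R" using assms(3) T.t0 by (simp add: nonunits_def)
  then have "R = T" using T.maximal[OF sub assms(2)] by blast
  then have "y / x \<in> R \<or> inverse (y / x) \<in> R" using T.valuation by blast
  then have "inverse (y / x) \<in> R" using yx by blast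
  then have "x / y \<in> R" by simp
  then show False using regular2.yx[OF swap] by blast
qed

text \<open>Multiplication by w sends A onto the added part and A0 into N, so the proper steps of a
  chain pull back to proper steps between A0 and A.\<close>

lemma (in sring) length_line:
  assumes N: "submod R N" and A: "submod R A" and A0: "submod R A0" "A0 \<subseteq> A" and length_le: "length_le R A0 A n" and w: "\<And>c. c \<in> A0 \<Longrightarrow> c * w \<in> N"
  shows "length_le R N (ssum N ((\<lambda>c. c * w) ` A)) n"
proof (rule bdI)
  fix K k assume ch: "chain_in R N (ssum N ((\<lambda>c. c * w) ` A)) K k"
  note K = chain_inD[OF ch]
  define C where "C i = {r. r * w \<in> K i} \<inter> A" for i
  have "chain_in R A0 A C k"
  proof (rule chain_inI)
    fix i assume i: "i \<le> k"
    show "submod R (C i)" unfolding C_def by (rule submod_Int[OF submod_vimage[OF K(1)[OF i]] A])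
    show "A0 \<subseteq> C i" "C i \<subseteq> A" unfolding C_def using K(2)[OF i] w A0(2) by auto
  next
    fix i assume "i < k" then show "C i \<subseteq> C (Suc i)" unfolding C_def using K(4) by blast
  qed
  moreover have "steps K k \<subseteq> steps C k"
  proof
    fix i assume "i \<in> steps K k"
    then have i: "i < k" "K i \<noteq> K (Suc i)" by (simp_all add: steps_def)
    then obtain z where z: "z \<in> K (Suc i)" "z \<notin> K i" using K(4)[OF i(1)] by blast
    have "z \<in> ssum N ((\<lambda>c. c * w) ` A)" using K(3)[of "Suc i"] i(1) z(1) by auto
    then obtain u r where u: "z = u + r * w" "u \<in> N" "r \<in> A" unfolding ssum_iff by blast
    have uK: "u \<in> K i" "u \<in> K (Suc i)" using u(2) K(2)[of i] K(2)[of "Suc i"] i by auto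
    have "r * w = z - u" using u(1) by simp
    then have "r * w \<in> K (Suc i)" using submod_diff[OF K(1)[of "Suc i"] z(1) uK(2)] i by simp
    moreover have "r * w \<notin> K i" using submodD(2)[OF K(1)[of i] uK(1), of "r * w"] z(2) u(1) i(1) by auto
    ultimately have "C i \<noteq> C (Suc i)" unfolding C_def using u(3) by blast
    then show "i \<in> steps C k" using i by (simp add: steps_def)
  qed
  ultimately show "card (steps K k) \<le> n" using bdD[OF length_le] card_mono[OF steps_fin] order_trans by blast
qed

lemma submod_image_right: assumes A: "submod R A" shows "submod R ((\<lambda>c. c * w) ` A)"
proof -
  have "(\<lambda>c. c * w) ` A = (*) w ` A" by (simp add: mult.commute)
  then show ?thesis using submod_smult[OF A, of w] by simp
qed

lemma (in lring) length_residue: "length_le R (nonunits R) R 1"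
proof -
  have "length_le R (nonunits R) (ssum (nonunits R) {r * 1 | r. r \<in> R}) 1"
    by (rule length_simple[OF nonunit_submod]) simp
  moreover have "R \<subseteq> ssum (nonunits R) {r * 1 | r. r \<in> R}"
  proof
    fix r assume "r \<in> R"
    then have "r = 0 + r * 1" "r * 1 \<in> {r * 1 | r. r \<in> R}" by auto
    then show "r \<in> ssum (nonunits R) {r * 1 | r. r \<in> R}" unfolding ssum_iff using nonunit0 by blast
  qed
  ultimately show ?thesis by (rule length_mono[OF _ order_refl _ order_refl])
qed

section \<open>Ideals of finite colength\<close>

definition gen_ideal :: "'a::field set \<Rightarrow> 'a \<Rightarrow> 'a \<Rightarrow> 'a set" where
  "gen_ideal R f g = ssum {r * f | r. r \<in> R} {r * g | r. r \<in> R}"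

lemma gen_ideal_iff: "z \<in> gen_ideal R f g \<longleftrightarrow> (\<exists>a\<in>R. \<exists>b\<in>R. z = a * f + b * g)"
  unfolding gen_ideal_def ssum_iff by blast

lemma gen_ideal_commute: "gen_ideal R f g = gen_ideal R g f"
  by (rule set_eqI) (unfold gen_ideal_iff, metis add.commute)

lemma (in sring) gen_ideal_ideal: assumes "f \<in> R" "g \<in> R" shows "is_ideal (gen_ideal R f g) R" "f \<in> gen_ideal R f g" "g \<in> gen_ideal R f g"
proof -
  have "submod R (gen_ideal R f g)" unfolding gen_ideal_def by (intro ssum_submod submod_line)
  moreover have "gen_ideal R f g \<subseteq> R" unfolding gen_ideal_iff subset_iff using assms by (metis add mult)
  ultimately show "is_ideal (gen_ideal R f g) R" by (simp add: ideal_submod)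
  have "f = 1 * f + 0 * g" "g = 0 * f + 1 * g" by simp_all
  then show "f \<in> gen_ideal R f g" "g \<in> gen_ideal R f g" unfolding gen_ideal_iff using zero one by blast+
qed

lemma (in sring) gen_ideal_least: "is_ideal J R \<Longrightarrow> f \<in> J \<Longrightarrow> g \<in> J \<Longrightarrow> gen_ideal R f g \<subseteq> J"
  unfolding gen_ideal_iff subset_iff is_ideal_def by metis

lemma (in sring) length_top: "length_le R R R 0" by (rule length_refl)

context regular2 begin

text \<open>Noetherian induction: take I maximal among the ideals above J without finite colength.
  If I is prime, it is neither zero nor maximal, hence generated by a prime element, against
  \<open>np\<close>. Otherwise I contains a product \<open>a * b\<close> but neither factor, and its
  colength is bounded by those of I + aR and (I : a).\<close>

lemma length_ex:
  assumes J: "is_ideal J R" and np: "\<And>p. prime_in R p \<Longrightarrow> \<exists>j\<in>J. j / p \<notin> R"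
  shows "\<exists>n. length_le R J R n"
proof (rule ccontr)
  assume neg: "\<not> ?thesis"
  let ?S = "{I. is_ideal I R \<and> J \<subseteq> I \<and> \<not> (\<exists>n. length_le R I R n)}"
  have "?S \<noteq> {}" using J neg by blast
  moreover have "is_ideal I R" if "I \<in> ?S" for I using that by blast
  ultimately obtain I where I: "I \<in> ?S" "\<forall>K\<in>?S. I \<subseteq> K \<longrightarrow> K = I" using noeth_max[OF noeth] by meson
  have Ii: "is_ideal I R" and JI: "J \<subseteq> I" and nI: "\<not> (\<exists>n. length_le R I R n)" using I(1) by blast+
  have Ism: "submod R I" and IR: "I \<subseteq> R" using Ii by (simp_all add: ideal_submod)
  have big: "\<exists>n. length_le R K R n" if "is_ideal K R" "I \<subseteq> K" "K \<noteq> I" for K using I(2) that JI by blast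
  have "1 \<notin> I" 
  proof
    assume "1 \<in> I" then have "I = R" using ideal_unit[OF Ii] by simp
    then show False using nI length_top by blast
  qed
  show False
  proof (cases "\<forall>a\<in>R. \<forall>b\<in>R. a * b \<in> I \<longrightarrow> a \<in> I \<or> b \<in> I")
    case True
    then have P: "prime_ideal I R" using prime_idealI[OF Ii \<open>1 \<notin> I\<close> one] by blast
    obtain j where "j \<in> J" "j / x \<notin> R" using np[OF px] by blast
    then have "I \<noteq> {0}" using JI by auto
    moreover have "I \<noteq> nonunits R"
    proof
      assume e: "I = nonunits R"
      have "length_le R (nonunits R) R 1" by (rule length_residue)
      then show False using nI e by blast
    qed
    ultimately obtain p where p: "prime_in R p" "I = {p * r | r. r \<in> R}" using prime_principal[OF P] by blast
    obtain j' where "j' \<in> J" "j' / p \<notin> R" using np[OF p(1)] by blast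
    then show False using JI p(2) dvd_set[OF prmD(3)[OF p(1)]] by blast
  next
    case False
    then obtain a b where ab: "a \<in> R" "b \<in> R" "a * b \<in> I" "a \<notin> I" "b \<notin> I" by blast
    let ?L = "{r * a | r. r \<in> R}"
    let ?I1 = "ssum I ?L"
    have Lsm: "submod R ?L" by (rule submod_line)
    have LR: "?L \<subseteq> R" using ab(1) by auto
    have I1: "is_ideal ?I1 R" unfolding ideal_submod using ssum_submod[OF Ism Lsm] ssum_least[OF submod_self IR LR] by blast
    have "1 * a \<in> ?L" using one by blast
    then have "a \<in> ?I1" using ssum_sup2[OF Ism, of ?L] by auto
    then have "?I1 \<noteq> I" using ab(4) by blast
    then obtain n1 where n1: "length_le R ?I1 R n1" using big[OF I1 ssum_sup1[OF Lsm]] by blast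
    let ?I2 = "{r. r * a \<in> I} \<inter> R"
    have I2: "is_ideal ?I2 R" unfolding ideal_submod using submod_Int[OF submod_vimage[OF Ism] submod_self] by blast
    have I2s: "I \<subseteq> ?I2"
    proof
      fix i assume i: "i \<in> I"
      then have "a * i \<in> I" using submodD(3)[OF Ism ab(1)] by blast
      then show "i \<in> ?I2" using i IR by (auto simp: mult.commute)
    qed
    have "b \<in> ?I2" using ab by (simp add: mult.commute)
    then have "?I2 \<noteq> I" using ab(5) by blast
    then obtain n2 where n2: "length_le R ?I2 R n2" using big[OF I2 I2s] by blast
    have "length_le R I (ssum I ((\<lambda>c. c * a) ` R)) n2"
    proof (rule length_line[OF Ism submod_self _ _ n2])
      show "submod R ?I2" using I2 by (simp add: ideal_submod)
    qed auto
    then have "length_le R I ?I1 n2" unfolding Setcompr_eq_image .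
    then have "length_le R I R (n2 + n1)"
      using n1 I1 ssum_sup1[OF Lsm] submod_self by (intro length_add[where L = ?I1]) (simp_all add: ideal_submod)
    then show False using nI by blast
  qed
qed

text \<open>The ideals J + z^i R descend, so two neighbours agree; then
  \<open>z ^ i * (1 - r * z)\<close> lies in J, and the second factor is a unit.\<close>

lemma length_power:
  assumes J: "is_ideal J R" and n: "length_le R J R n" and z: "z \<in> nonunits R" shows "\<exists>k. z ^ k \<in> J"
proof -
  have zR: "z \<in> R" using z nonunitD by blast
  have Jsm: "submod R J" and JR: "J \<subseteq> R" using J by (simp_all add: ideal_submod)
  define K where "K i = ssum J {r * z ^ i | r. r \<in> R}" for i
  have zi: "z ^ i \<in> R" for i using zR by simp
  have "\<exists>i. K i = K (Suc i)"
  proof (rule length_descending[OF n])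
    fix i
    show "submod R (K i)" unfolding K_def by (rule ssum_submod[OF Jsm submod_line])
    show "J \<subseteq> K i" unfolding K_def by (rule ssum_sup1[OF submod_line])
    have "{r * z ^ i | r. r \<in> R} \<subseteq> R" using zi by auto
    then show "K i \<subseteq> R" unfolding K_def by (rule ssum_least[OF submod_self JR])
    have "{r * z ^ Suc i | r. r \<in> R} \<subseteq> {r * z ^ i | r. r \<in> R}"
    proof
      fix w assume "w \<in> {r * z ^ Suc i | r. r \<in> R}"
      then obtain r where r: "w = r * z ^ Suc i" "r \<in> R" by blast
      then have "w = (r * z) * z ^ i" "r \<in> R" by (simp_all add: mult.assoc)
      then show "w \<in> {r * z ^ i | r. r \<in> R}" using mult[OF \<open>r \<in> R\<close> zR] by blast
    qed
    then show "K (Suc i) \<subseteq> K i" unfolding K_def by (rule ssum_mono[OF order_refl])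
  qed
  then obtain i where i: "K i = K (Suc i)" by blast
  have "1 * z ^ i \<in> {r * z ^ i | r. r \<in> R}" using one by blast
  then have "1 * z ^ i \<in> K i" unfolding K_def by (rule subsetD[OF ssum_sup2[OF Jsm]])
  then have "z ^ i \<in> K (Suc i)" unfolding i by simp
  then obtain j r where jr: "z ^ i = j + r * z ^ Suc i" "j \<in> J" "r \<in> R" unfolding K_def ssum_def by blast
  have u: "1 - r * z \<noteq> 0" "inverse (1 - r * z) \<in> R" using one_minus[OF nonunit_mult2[OF z jr(3)]] by blast+
  have "z ^ i * (1 - r * z) = j" using jr(1) by (simp add: algebra_simps)
  then have "z ^ i = inverse (1 - r * z) * j" using u(1) by (metis mult.assoc mult.commute mult_1 left_inverse)
  moreover have "inverse (1 - r * z) * j \<in> J" using submodD(3)[OF Jsm u(2) jr(2)] .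
  ultimately show ?thesis by metis
qed

lemma length_cop:
  assumes "f \<in> R" "g \<in> R" "coprime_in R f g" shows "\<exists>n. length_le R (gen_ideal R f g) R n"
proof (rule length_ex[OF gen_ideal_ideal(1)[OF assms(1,2)]])
  fix p assume p: "prime_in R p"
  show "\<exists>j\<in>gen_ideal R f g. j / p \<notin> R" using gen_ideal_ideal(2,3)[OF assms(1,2)] coprime_prm[OF assms(3) p] by blast
qed

end

section \<open>Domination and quadratic transforms\<close>

definition dominates :: "'a::field set \<Rightarrow> 'a set \<Rightarrow> bool" where
  "dominates \<alpha> R \<longleftrightarrow> \<alpha> \<subseteq> R \<and> nonunits \<alpha> \<subseteq> nonunits R"

lemma dominates_trans: "dominates a b \<Longrightarrow> dominates b c \<Longrightarrow> dominates a c" unfolding dominates_def by blast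

lemma polys_mono: "A \<subseteq> B \<Longrightarrow> polys A \<subseteq> polys B" unfolding polys_def by blast

lemma dominates_unit: assumes "dominates \<alpha> R" "a \<in> \<alpha>" "a \<notin> nonunits \<alpha>" "sring \<alpha>" shows "a \<notin> nonunits R"
proof -
  have "a \<noteq> 0" "inverse a \<in> R" using sring.unitD[OF assms(4,2,3)] assms(1) unfolding dominates_def by blast+
  then show ?thesis by (simp add: nonunits_def)
qed

lemma dominates_mpol: assumes "dominates \<alpha> R" "sring \<alpha>" "p \<in> polys \<alpha>" "p \<in> mpolys R" shows "p \<in> mpolys \<alpha>"
proof -
  have "coeff p i \<in> nonunits \<alpha>" for i
    using dominates_unit[OF assms(1) _ _ assms(2), of "coeff p i"] assms(3,4) unfolding polys_def mpolys_def by blast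
  then show ?thesis by (simp add: mpolys_def)
qed

text \<open>The key step of the Zariski--Abhyankar factorization: if neither quotient lies in \<open>R\<close>, then
  \<open>y/x\<close> is residually transcendental over \<open>R\<close>, which forces \<open>R\<close> into the order valuation ring of \<open>\<alpha>\<close>.\<close>
lemma factor_blowup:
  assumes "regular2 \<alpha> x y" "regular2 R u w" and dominates: "dominates \<alpha> R" and ny: "y / x \<notin> R" "x / y \<notin> R"
  shows "R = \<alpha>"
proof (rule ccontr)
  assume ne: "R \<noteq> \<alpha>"
  interpret a: regular2 \<alpha> x y by (rule assms(1))
  interpret r: regular2 R u w by (rule assms(2))
  have sub: "\<alpha> \<subseteq> R" and mm: "nonunits \<alpha> \<subseteq> nonunits R" using dominates by (auto simp: dominates_def)
  have pp: "polys \<alpha> \<subseteq> polys R" by (rule polys_mono[OF sub])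
  have xR: "x \<in> R" "y \<in> R" "x \<in> nonunits R" using sub mm a.x_nonunit by auto
  obtain b c where bc: "b \<in> R" "c \<in> R" "c \<noteq> 0" "y / x = b / c" "coprime_in R b c" using r.ex_coprime by blast
  have b0: "b \<noteq> 0" using bc(4) a.y0 a.x0 by auto
  have cn: "c \<in> nonunits R"
  proof (rule ccontr)
    assume "c \<notin> nonunits R" then have "inverse c \<in> R" using r.unitD bc by blast
    then have "b * inverse c \<in> R" using bc by simp
    then show False using ny bc(4) by (simp add: divide_inverse)
  qed
  have bn: "b \<in> nonunits R"
  proof (rule ccontr)
    assume "b \<notin> nonunits R" then have "inverse b \<in> R" using r.unitD bc by blast
    then have "c * inverse b \<in> R" using bc by simp
    moreover have "x / y = c * inverse b" using bc(4) b0 bc(3) a.x0 a.y0 by (simp add: field_simps)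
    ultimately show False using ny by simp
  qed
  have T: "p \<in> mpolys R" if "p \<in> polys R" "poly p (y / x) = 0" for p
    using r.residually_transcendental[OF cn bn bc(3,5)] that bc(4) by simp
  have key: "q \<in> mpolys \<alpha>" if "p \<in> polys \<alpha>" "q \<in> polys \<alpha>" "e \<in> nonunits R" "poly q (y / x) = e * poly p (y / x)" for p q e
  proof -
    have "q - smult e p \<in> mpolys R" 
      using subsetD[OF pp that(1)] subsetD[OF pp that(2)] r.nonunitD[OF that(3)] that(4) by (intro T) simp_all
    moreover have "smult e p \<in> mpolys R" using that pp by (intro r.mpolys_smult) auto
    ultimately have "(q - smult e p) + smult e p \<in> mpolys R" by (rule r.mpolys_add)
    then show ?thesis using dominates_mpol[OF dominates a.sring_axioms that(2)] by simp
  qed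
  have RO: "r \<in> a.Or" if r: "r \<in> R" for r
  proof (rule ccontr)
    assume n: "r \<notin> a.Or"
    then have r0: "r \<noteq> 0" by auto
    have "inverse r \<in> nonunits a.Or" using n a.V.valuation[of r] r0 unfolding nonunits_def by simp
    then have "inverse r / x \<in> a.Or" using a.V.div_iff[of x "inverse r"] a.V.v_t a.V.nonunit_iff by simp
    then obtain p q where pq: "inverse r / x = poly p (y/x) / poly q (y/x)" "p \<in> polys \<alpha>" "q \<in> polys \<alpha>" "q \<notin> mpolys \<alpha>" by (rule a.O_repr)
    have "poly q (y/x) = (x * r) * poly p (y/x)" using pq(1) a.nz[OF pq(3,4)] r0 a.x0 by (simp add: field_simps)
    moreover have "x * r \<in> nonunits R" by (rule r.nonunit_mult[OF xR(3) r])
    ultimately show False using key[OF pq(2,3)] pq(4) by blast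
  qed
  have MO: "r \<in> nonunits a.Or" if r: "r \<in> nonunits R" for r
  proof (rule ccontr)
    assume n: "r \<notin> nonunits a.Or"
    have "r \<in> a.Or" using RO r r.nonunitD by blast
    then have r0: "r \<noteq> 0" "inverse r \<in> a.Or" using a.V.unitD n by blast+
    from r0(2) obtain p q where pq: "inverse r = poly p (y/x) / poly q (y/x)" "p \<in> polys \<alpha>" "q \<in> polys \<alpha>" "q \<notin> mpolys \<alpha>" by (rule a.O_repr)
    have "poly q (y/x) = r * poly p (y/x)" using pq(1) a.nz[OF pq(3,4)] r0 by (simp add: field_simps)
    then show False using key[OF pq(2,3) r] pq(4) by blast
  qed
  \<comment> \<open>With \<open>y / x = b / c\<close> in lowest terms, x = dc and y = db for some d
    in R. Nonzero nonunits of R have value at least 1 in the order valuation and x has value exactly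
    1; as c is a nonunit, d is a unit. So x and y have no common prime divisor in R.\<close>
  define d where "d = x / c"
  have xb: "b * x / c = y" using bc(3,4) a.x0 by (simp add: field_simps)
  have dR: "d \<in> R" unfolding d_def using r.coprime_cancel[OF bc(2,3,5,1) xR(1)] xb xR by simp
  have xd: "x = d * c" "y = d * b" using bc(3) xb by (simp_all add: d_def field_simps)
  have d0: "d \<noteq> 0" using xd a.x0 by auto
  have du: "d \<notin> nonunits R"
  proof
    assume "d \<in> nonunits R"
    then have "a.V.v d \<ge> 1" "a.V.v c \<ge> 1" using MO[of d] MO[OF cn] a.V.nonunit_iff d0 bc(3) by auto
    moreover have "a.V.v x = a.V.v d + a.V.v c" 
      using a.V.v_mult[OF d0 bc(3)] unfolding xd(1)[symmetric] .
    ultimately show False using a.V.v_t by simp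
  qed
  then have di: "inverse d \<in> R" using r.unitD dR by blast
  have no_common: False if p: "prime_in R p" "x / p \<in> R" "y / p \<in> R" for p
  proof -
    have "inverse d * (x / p) \<in> R" "inverse d * (y / p) \<in> R" using r.mult[OF di p(2)] r.mult[OF di p(3)] by blast+
    moreover have "inverse d * (x / p) = c / p" "inverse d * (y / p) = b / p" unfolding xd using d0 by simp_all
    ultimately have "c / p \<in> R" "b / p \<in> R" by (simp_all only:)
    then show False using r.coprime_prm[OF bc(5) p(1)] by blast
  qed
  obtain r where r: "r \<in> R" "r \<notin> \<alpha>" using ne sub by blast
  obtain f g where fg: "f \<in> \<alpha>" "g \<in> \<alpha>" "g \<noteq> 0" "r = f / g" "coprime_in \<alpha> f g" using a.ex_coprime by blast
  have gn: "g \<in> nonunits \<alpha>"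
  proof (rule ccontr)
    assume "g \<notin> nonunits \<alpha>" then have "inverse g \<in> \<alpha>" using a.unitD fg by blast
    then have "f * inverse g \<in> \<alpha>" using fg by simp
    then show False using r fg(4) by (simp add: divide_inverse)
  qed
  then obtain p where p: "prime_in R p" "g / p \<in> R" using r.ex_prime_div[of g] fg(3) mm by blast
  obtain n where n: "length_le \<alpha> (gen_ideal \<alpha> f g) \<alpha> n" using a.length_cop[OF fg(1,2,5)] by blast
  \<comment> \<open>The coprime pair f, g generates an ideal of finite colength in \<alpha>, so it
    contains a power of z. Division by g stays in R because \<open>f / g = r\<close> does; hence the
    prime p, which divides g, divides every nonunit of \<alpha>, in particular x and y.\<close>
  have pw: "z / p \<in> R" if z: "z \<in> nonunits \<alpha>" for z
  proof -
    obtain k where "z ^ k \<in> gen_ideal \<alpha> f g" using a.length_power[OF a.gen_ideal_ideal(1)[OF fg(1,2)] n z] by blast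
    then obtain s t where st: "z ^ k = s * f + t * g" "s \<in> \<alpha>" "t \<in> \<alpha>" unfolding gen_ideal_iff by blast
    have "z ^ k / g = s * r + t" using st(1) fg(3,4) by (simp add: add_divide_distrib)
    moreover have "s * r + t \<in> R" using r.add[OF r.mult[OF subsetD[OF sub st(2)] r(1)] subsetD[OF sub st(3)]] .
    ultimately have "z ^ k / g \<in> R" by simp
    then have "z ^ k / p \<in> R" by (rule r.div_trans[OF p(2) _ fg(3)])
    moreover have "z \<in> R" using z sub a.nonunitD by blast
    ultimately show ?thesis using r.prime_pow[OF p(1)] by blast
  qed
  show False using no_common[OF p(1) pw[OF a.x_nonunit] pw[OF a.y_nonunit]] .
qed

text \<open>A member outside \<open>mpolys R\<close> of least degree has a unit as leading
  coefficient, since otherwise subtracting the leading term would lower the degree. The closure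
  conditions hold when membership is tested on values in an ideal that contains those of
  \<open>mpolys R\<close>.\<close>

lemma (in lring) min_monic:
  assumes J: "\<J> \<subseteq> polys R" and sm: "\<And>p c. p \<in> \<J> \<Longrightarrow> c \<in> R \<Longrightarrow> smult c p \<in> \<J>"
    and df: "\<And>p c n. p \<in> \<J> \<Longrightarrow> c \<in> nonunits R \<Longrightarrow> p - monom c n \<in> \<J>"
    and F: "F \<in> \<J>" "F \<notin> mpolys R"
  obtains g where "g \<in> \<J>" "lead_coeff g = 1" "degree g \<le> degree F" "\<And>p. p \<in> \<J> \<Longrightarrow> degree p < degree g \<Longrightarrow> p \<in> mpolys R"
proof -
  define Q where "Q n \<longleftrightarrow> (\<exists>p\<in>\<J>. p \<notin> mpolys R \<and> degree p = n)" for n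
  define n where "n = (LEAST n. Q n)"
  have QF: "Q (degree F)" using F unfolding Q_def by blast
  have "Q n" unfolding n_def by (rule LeastI[of Q, OF QF])
  then obtain p where p: "p \<in> \<J>" "p \<notin> mpolys R" "degree p = n" unfolding Q_def by blast
  have nF: "n \<le> degree F" unfolding n_def by (rule Least_le[of Q, OF QF])
  have min: "q \<in> mpolys R" if "q \<in> \<J>" "degree q < n" for q
  proof -
    have "\<not> Q (degree q)" using that(2) unfolding n_def by (rule not_less_Least)
    then show ?thesis using that(1) unfolding Q_def by blast
  qed
  have pR: "p \<in> polys R" using p J by blast
  define c where "c = lead_coeff p"
  have cR: "c \<in> R" using polys_coeff[OF pR] by (simp add: c_def)
  have cu: "c \<notin> nonunits R"
  proof
    assume cn: "c \<in> nonunits R"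
    have m: "monom c n \<in> mpolys R" using cn by (rule mpolys_monom)
    have "p - monom c n \<in> mpolys R"
    proof (cases n)
      case 0
      then have "p = monom c n" using p(3) unfolding c_def by (metis degree_0_id monom_0)
      then show ?thesis by simp
    next
      case (Suc k)
      have "degree (p - monom c n) \<le> k" unfolding Suc c_def using p(3) Suc degree_strip[of p k] by simp
      then show ?thesis using min df[OF p(1) cn] Suc by simp
    qed
    then have "(p - monom c n) + monom c n \<in> mpolys R" using m by (rule mpolys_add)
    then show False using p by simp
  qed
  then have ci: "c \<noteq> 0" "inverse c \<in> R" using unitD cR by auto
  show ?thesis
  proof (rule that[of "smult (inverse c) p"])
    show "smult (inverse c) p \<in> \<J>" by (rule sm[OF p(1) ci(2)])
    show "lead_coeff (smult (inverse c) p) = 1" using ci by (simp add: c_def)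
    show "degree (smult (inverse c) p) \<le> degree F" using nF p by simp
    show "q \<in> mpolys R" if "q \<in> \<J>" "degree q < degree (smult (inverse c) p)" for q
      using min that p ci by simp
  qed
qed

text \<open>The ring \<open>\<beta>\<close> is the localization of \<open>\<alpha>[y/x]\<close> at the maximal ideal generated by \<open>x\<close> and \<open>g(y/x)\<close>.\<close>
locale transform = a: regular2 \<alpha> x y + b: regular2 \<beta> x t for \<alpha> x y \<beta> t +
  fixes g :: "'a::field poly"
  assumes sub: "\<alpha> \<subseteq> \<beta>" and tau_in: "y / x \<in> \<beta>"
    and repr: "z \<in> \<beta> \<Longrightarrow> \<exists>p\<in>polys \<alpha>. \<exists>q\<in>polys \<alpha>. z = poly p (y/x) / poly q (y/x) \<and> poly q (y/x) \<notin> nonunits \<beta>"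
    and g: "g \<in> polys \<alpha>" "lead_coeff g = 1" "degree g \<ge> 1" "poly g (y/x) \<in> nonunits \<beta>"
    and gmin: "p \<in> polys \<alpha> \<Longrightarrow> poly p (y/x) \<in> nonunits \<beta> \<Longrightarrow> degree p < degree g \<Longrightarrow> p \<in> mpolys \<alpha>"

definition is_transform :: "'a::field set \<Rightarrow> 'a \<Rightarrow> 'a \<Rightarrow> 'a set \<Rightarrow> bool" where
  "is_transform \<alpha> x y \<beta> \<longleftrightarrow> (\<exists>t g. transform \<alpha> x y \<beta> t g)"

text \<open>\<beta> is the localization of \<open>adjoin R tau\<close> at the center of S. An
  element of \<open>Or\<close> outside S has a denominator that is a nonunit of S but does not come
  from \<open>mpolys R\<close>; so the center is larger than the ideal generated by x and contains
  the value of a monic polynomial g.\<close>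

lemma (in regular2) step:
  assumes S: "sring S" and Sadd: "\<And>a b. a \<in> nonunits S \<Longrightarrow> b \<in> nonunits S \<Longrightarrow> a + b \<in> nonunits S"
    and dm: "dominates R S" and tS: "tau \<in> S" and nO: "\<not> Or \<subseteq> S"
  shows "\<exists>\<beta>. is_transform R x y \<beta> \<and> dominates \<beta> S"
proof -
  interpret S: sring S by (rule S)
  have RS: "R \<subseteq> S" and mm: "nonunits R \<subseteq> nonunits S" using dm by (auto simp: dominates_def)
  have xS: "x \<in> nonunits S" using mm x_nonunit by blast
  have pS: "poly p tau \<in> S" if "p \<in> polys R" for p using S.polys_poly polys_mono[OF RS] that tS by blast
  have mS: "poly p tau \<in> nonunits S" if p: "p \<in> mpolys R" for p
  proof -
    obtain q where q: "q \<in> polys R" "poly p tau = x * poly q tau" using mpolys_xE[OF p order_refl] by blast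
    show ?thesis unfolding q(2) by (rule S.nonunit_mult[OF xS pS[OF q(1)]])
  qed
  have Sneg: "- a \<in> nonunits S" if "a \<in> nonunits S" for a
    using S.nonunit_mult[OF that, of "-1"] by simp
  have Sdiff: "a - b \<in> nonunits S" if "a \<in> nonunits S" "b \<in> nonunits S" for a b
    using Sadd[OF that(1) Sneg[OF that(2)]] by simp
  define \<J> where "\<J> = {p \<in> polys R. poly p tau \<in> nonunits S}"
  obtain z where z: "z \<in> Or" "z \<notin> S" using nO by blast
  from z(1) obtain p q where pq: "z = poly p tau / poly q tau" "p \<in> polys R" "q \<in> polys R" "q \<notin> mpolys R" by (rule O_repr)
  have "poly q tau \<in> nonunits S"
  proof (rule ccontr)
    assume "poly q tau \<notin> nonunits S"
    then have "inverse (poly q tau) \<in> S" using S.unitD pS[OF pq(3)] by blast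
    then have "poly p tau * inverse (poly q tau) \<in> S" using pS[OF pq(2)] by simp
    then show False using z pq(1) by (simp add: divide_inverse)
  qed
  then have qJ: "q \<in> \<J>" using pq by (simp add: \<J>_def)
  obtain g where g: "g \<in> \<J>" "lead_coeff g = 1" "\<And>p. p \<in> \<J> \<Longrightarrow> degree p < degree g \<Longrightarrow> p \<in> mpolys R"
  proof (rule min_monic[of \<J> q])
    show "\<J> \<subseteq> polys R" by (auto simp: \<J>_def)
    show "smult c p \<in> \<J>" if "p \<in> \<J>" "c \<in> R" for p c
      using that S.nonunit_mult2[of "poly p tau" c] RS by (auto simp: \<J>_def)
    show "p - monom c n \<in> \<J>" if "p \<in> \<J>" "c \<in> nonunits R" for p c n
      using that Sdiff[OF _ mS[OF mpolys_monom[OF that(2), of n]], of "poly p tau"] nonunitD by (auto simp: \<J>_def)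
  qed (use qJ pq in blast)+
  have gR: "g \<in> polys R" and gS: "poly g tau \<in> nonunits S" using g(1) by (simp_all add: \<J>_def)
  have gd: "degree g \<ge> 1"
  proof (rule ccontr)
    assume "\<not> degree g \<ge> 1"
    then have "g = 1" using g(2) by (metis degree_eq_zeroE less_one not_le one_pCons lead_coeff_pCons(2))
    then show False using gS by simp
  qed
  define \<beta> where "\<beta> = {poly p tau / poly q tau | p q. p \<in> polys R \<and> q \<in> polys R \<and> poly q tau \<notin> nonunits S}"
  have bI: "poly p tau / poly q tau \<in> \<beta>" if "p \<in> polys R" "q \<in> polys R" "poly q tau \<notin> nonunits S" for p q
    using that unfolding \<beta>_def by blast
  have bE: "\<exists>p q. z = poly p tau / poly q tau \<and> p \<in> polys R \<and> q \<in> polys R \<and> poly q tau \<notin> nonunits S \<and> poly q tau \<noteq> 0" if "z \<in> \<beta>" for z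
    using that S.nonunit0 unfolding \<beta>_def by (smt (verit) mem_Collect_eq)
  have qn: "q \<notin> mpolys R" if "poly q tau \<notin> nonunits S" for q using mS that by blast
  have Eb: "poly p tau \<in> \<beta>" if "p \<in> polys R" for p using bI[OF that polys_1] by simp
  have Rb: "R \<subseteq> \<beta>" using Eb[of "[:a:]" for a] by auto
  have bS: "\<beta> \<subseteq> S"
  proof
    fix z assume "z \<in> \<beta>"
    then obtain p q where z: "z = poly p tau / poly q tau" "p \<in> polys R" "q \<in> polys R" "poly q tau \<notin> nonunits S" using bE by blast
    then have "inverse (poly q tau) \<in> S" using S.unitD pS by blast
    then show "z \<in> S" using S.mult[OF pS[OF z(2)]] unfolding z(1) divide_inverse[of "poly p tau"] by blast
  qed
  have bsub: "subring \<beta>" unfolding subring_def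
  proof (intro conjI ballI)
    show "0 \<in> \<beta>" "1 \<in> \<beta>" using Rb zero one by blast+
    fix u w assume "u \<in> \<beta>" "w \<in> \<beta>"
    then obtain p q r s where u: "u = poly p tau / poly q tau" "p \<in> polys R" "q \<in> polys R" "poly q tau \<notin> nonunits S" "poly q tau \<noteq> 0"
      and w: "w = poly r tau / poly s tau" "r \<in> polys R" "s \<in> polys R" "poly s tau \<notin> nonunits S" "poly s tau \<noteq> 0" using bE by metis
    have qs: "q * s \<in> polys R" "poly (q * s) tau \<notin> nonunits S" using u w S.nonunit_prime[OF pS[OF u(3)] pS[OF w(3)]] by auto
    have "poly (p * s + r * q) tau / poly (q * s) tau \<in> \<beta>" "poly (p * r) tau / poly (q * s) tau \<in> \<beta>"
      by (rule bI[OF _ qs], use u w in simp)+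
    moreover have "u + w = poly (p * s + r * q) tau / poly (q * s) tau" "u * w = poly (p * r) tau / poly (q * s) tau"
      unfolding u(1) w(1) using u(5) w(5) by (simp_all add: field_simps)
    ultimately show "u + w \<in> \<beta>" "u * w \<in> \<beta>" by simp_all
  next
    fix u assume "u \<in> \<beta>"
    then obtain p q where u: "u = poly p tau / poly q tau" "p \<in> polys R" "q \<in> polys R" "poly q tau \<notin> nonunits S" using bE by blast
    have "poly (0 - p) tau / poly q tau \<in> \<beta>" using u by (intro bI polys_diff) auto
    then show "- u \<in> \<beta>" using u by simp
  qed
  interpret B: sring \<beta> by unfold_locales (rule bsub)
  have nb: "z \<in> nonunits \<beta> \<longleftrightarrow> z \<in> nonunits S" if "z \<in> \<beta>" for z
  proof
    assume zn: "z \<in> nonunits \<beta>"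
    show "z \<in> nonunits S"
    proof (rule ccontr)
      assume n: "z \<notin> nonunits S"
      obtain p q where u: "z = poly p tau / poly q tau" "p \<in> polys R" "q \<in> polys R" "poly q tau \<notin> nonunits S" "poly q tau \<noteq> 0" using bE \<open>z \<in> \<beta>\<close> by blast
      have zp: "z * poly q tau = poly p tau" using u by simp
      have "z \<in> S" using bS \<open>z \<in> \<beta>\<close> by blast
      then have "poly p tau \<notin> nonunits S" using S.nonunit_prime[of z "poly q tau"] zp n u(4) pS[OF u(3)] by metis
      then have "poly q tau / poly p tau \<in> \<beta>" by (rule bI[OF u(3,2)])
      then have "inverse z \<in> \<beta>" using u(1) by simp
      moreover have "z \<noteq> 0" using n S.nonunit0 by metis
      ultimately show False using zn by (simp add: nonunits_def)
    qed
  next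
    assume "z \<in> nonunits S"
    then show "z \<in> nonunits \<beta>" using bS that unfolding nonunits_def by blast
  qed
  have dmb: "dominates \<beta> S" unfolding dominates_def using bS nb B.nonunitD by blast
  \<comment> \<open>Modulo nonunits g generates the center: division by the monic g leaves a
    remainder of smaller degree, which minimality of the degree of g puts into
    \<open>mpolys R\<close>.\<close>
  have split: "\<exists>s\<in>polys R. \<exists>r\<in>mpolys R. p = g * s + r" if p: "p \<in> polys R" "poly p tau \<in> nonunits S" for p
  proof -
    obtain s r where sr: "s \<in> polys R" "r \<in> polys R" "p = g * s + r" "degree r < degree g" using polys_division[OF gR g(2) gd p(1)] by blast
    have "poly r tau = poly p tau - poly g tau * poly s tau" using sr(3) by simp
    moreover have "poly g tau * poly s tau \<in> nonunits S" by (rule S.nonunit_mult[OF gS pS[OF sr(1)]])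
    ultimately have "poly r tau \<in> nonunits S" using Sdiff[OF p(2)] by simp
    then have "r \<in> mpolys R" using g(3) sr by (simp add: \<J>_def)
    then show ?thesis using sr by blast
  qed
  define t where "t = poly g tau"
  have tb: "t \<in> \<beta>" unfolding t_def by (rule Eb[OF gR])
  have xb: "x \<in> \<beta>" using Rb xR by blast
  have "regular2 \<beta> x t"
  proof unfold_locales
    show "noetherian_ring \<beta>"
    proof (rule noeth_loc[OF hilbert_basis[OF noeth, of tau] bsub])
      show "adjoin R tau \<subseteq> \<beta>" using Eb by (auto simp: adjoin_def)
      fix s assume "s \<in> \<beta>"
      then obtain p q where u: "s = poly p tau / poly q tau" "p \<in> polys R" "q \<in> polys R" "poly q tau \<notin> nonunits S" "poly q tau \<noteq> 0" using bE by blast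
      have "1 / poly q tau \<in> \<beta>" using bI[OF polys_1 u(3,4)] by simp
      then have "inverse (poly q tau) \<in> \<beta>" by (simp add: divide_inverse)
      then show "\<exists>c\<in>adjoin R tau. \<exists>d\<in>adjoin R tau. d \<noteq> 0 \<and> s = c / d \<and> inverse d \<in> \<beta>"
        using u adjI[OF u(2)] adjI[OF u(3)] by blast
    qed
    show "a + b \<in> nonunits \<beta>" if "a \<in> nonunits \<beta>" "b \<in> nonunits \<beta>" for a b
    proof -
      have ab: "a \<in> \<beta>" "b \<in> \<beta>" using that B.nonunitD by blast+
      then have "a + b \<in> nonunits S" using that nb Sadd by blast
      then show ?thesis using nb[OF B.add[OF ab]] by blast
    qed
    show "nonunits \<beta> = {a * x + b * t |a b. a \<in> \<beta> \<and> b \<in> \<beta>}"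
    proof
      show "nonunits \<beta> \<subseteq> {a * x + b * t |a b. a \<in> \<beta> \<and> b \<in> \<beta>}"
      proof
        fix z assume zn: "z \<in> nonunits \<beta>"
        then have "z \<in> \<beta>" by (rule B.nonunitD)
        then obtain p q where u: "z = poly p tau / poly q tau" "p \<in> polys R" "q \<in> polys R" "poly q tau \<notin> nonunits S" "poly q tau \<noteq> 0" using bE by blast
        have "z * poly q tau \<in> nonunits S" using zn nb[OF \<open>z \<in> \<beta>\<close>] S.nonunit_mult pS[OF u(3)] by blast
        then have "poly p tau \<in> nonunits S" using u by simp
        then obtain s r where sr: "s \<in> polys R" "r \<in> mpolys R" "p = g * s + r" using split[OF u(2)] by blast
        obtain e where e: "e \<in> polys R" "poly r tau = x * poly e tau" using mpolys_xE[OF sr(2) order_refl] by blast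
        have "z = (poly e tau / poly q tau) * x + (poly s tau / poly q tau) * t"
          unfolding u(1) sr(3) using e(2) u(5) by (simp add: t_def field_simps)
        then show "z \<in> {a * x + b * t |a b. a \<in> \<beta> \<and> b \<in> \<beta>}" using bI[OF e(1) u(3,4)] bI[OF sr(1) u(3,4)] by blast
      qed
      show "{a * x + b * t |a b. a \<in> \<beta> \<and> b \<in> \<beta>} \<subseteq> nonunits \<beta>"
      proof
        fix z assume "z \<in> {a * x + b * t |a b. a \<in> \<beta> \<and> b \<in> \<beta>}"
        then obtain a b where ab: "z = a * x + b * t" "a \<in> \<beta>" "b \<in> \<beta>" by blast
        have "a * x \<in> nonunits S" "b * t \<in> nonunits S" using ab bS xS gS unfolding t_def by (auto intro!: S.nonunit_mult2)
        then have "z \<in> nonunits S" unfolding ab(1) by (rule Sadd)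
        moreover have "z \<in> \<beta>" unfolding ab(1) using ab tb xb by simp
        ultimately show "z \<in> nonunits \<beta>" using nb by blast
      qed
    qed
    show "Defs.frac \<beta> = UNIV" by (rule frac_mono[OF birat Rb])
    show "prime_in \<beta> x" unfolding prime_in_def
    proof (intro conjI ballI impI x0)
      show "x \<in> nonunits \<beta>" using nb[OF xb] xS by blast
      fix a b assume "a \<in> \<beta>" "b \<in> \<beta>" "a * b / x \<in> \<beta>"
      obtain p q where u: "a = poly p tau / poly q tau" "p \<in> polys R" "q \<in> polys R" "poly q tau \<notin> nonunits S" "poly q tau \<noteq> 0" using bE \<open>a \<in> \<beta>\<close> by blast
      obtain r s where w: "b = poly r tau / poly s tau" "r \<in> polys R" "s \<in> polys R" "poly s tau \<notin> nonunits S" "poly s tau \<noteq> 0" using bE \<open>b \<in> \<beta>\<close> by blast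
      obtain k l where c: "a * b / x = poly k tau / poly l tau" "k \<in> polys R" "l \<in> polys R" "poly l tau \<notin> nonunits S" "poly l tau \<noteq> 0" using bE \<open>a * b / x \<in> \<beta>\<close> by blast
      have e: "poly (p * r * l) tau = x * poly (k * q * s) tau"
        using c(1) u(5) w(5) c(5) x0 unfolding u(1) w(1) by (simp add: field_simps)
      have "p * r * l \<in> mpolys R" by (rule xE_mpol[OF _ _ e]) (intro polys_mult u(2,3) w(2,3) c(2,3))+
      then have "p \<in> mpolys R \<or> r \<in> mpolys R" using gauss[of "p * r" l] gauss[of p r] qn[OF c(4)] u w c by auto
      moreover have dv: "poly p tau / poly q tau / x \<in> \<beta>" if p: "p \<in> mpolys R" and q: "q \<in> polys R" "poly q tau \<notin> nonunits S" for p q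
      proof -
        obtain e where e: "e \<in> polys R" "poly p tau = x * poly e tau" using mpolys_xE[OF p order_refl] by blast
        have "poly p tau / poly q tau / x = poly e tau / poly q tau" unfolding e(2) by simp
        then show ?thesis using bI[OF e(1) q] by simp
      qed
      ultimately show "a / x \<in> \<beta> \<or> b / x \<in> \<beta>" unfolding u(1) w(1) using u w by blast
    qed
    show "t / x \<notin> \<beta>"
    proof
      assume "t / x \<in> \<beta>"
      then obtain p q where u: "t / x = poly p tau / poly q tau" "p \<in> polys R" "q \<in> polys R" "poly q tau \<notin> nonunits S" "poly q tau \<noteq> 0" using bE by blast
      have "poly (g * q) tau = x * poly p tau" using u(1,5) x0 by (simp add: t_def field_simps)
      then have "g * q \<in> mpolys R" using u gR by (intro xE_mpol) auto
      then have "g \<in> mpolys R" using gauss[OF gR u(3)] qn[OF u(4)] by blast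
      then have "lead_coeff g \<in> nonunits R" unfolding mpolys_def by blast
      then show False using g(2) by simp
    qed
  qed
  then interpret b: regular2 \<beta> x t .
  have "transform R x y \<beta> t g"
  proof unfold_locales
    show "R \<subseteq> \<beta>" by (rule Rb)
    show "tau \<in> \<beta>" using Eb[of "[:0,1:]"] by simp
    show "\<exists>p\<in>polys R. \<exists>q\<in>polys R. z = poly p tau / poly q tau \<and> poly q tau \<notin> nonunits \<beta>" if "z \<in> \<beta>" for z
      using bE[OF that] nb Eb by blast
    show "g \<in> polys R" "lead_coeff g = 1" "degree g \<ge> 1" by (rule gR g(2) gd)+
    show "poly g tau \<in> nonunits \<beta>" using nb Eb gR gS by blast
    show "p \<in> mpolys R" if "p \<in> polys R" "poly p tau \<in> nonunits \<beta>" "degree p < degree g" for p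
      using that nb Eb g(3) by (simp add: \<J>_def)
  qed
  then show ?thesis using dmb unfolding is_transform_def by blast
qed

context transform begin

lemma nonunit_sub: "nonunits \<alpha> \<subseteq> nonunits \<beta>"
proof
  fix z assume "z \<in> nonunits \<alpha>"
  then obtain c d where z: "z = c * x + d * y" "c \<in> \<alpha>" "d \<in> \<alpha>" unfolding a.gens by blast
  have "y = y / x * x" by simp
  then have "y \<in> nonunits \<beta>" using b.nonunit_mult2[OF b.x_nonunit tau_in] by simp
  then have "c * x \<in> nonunits \<beta>" "d * y \<in> nonunits \<beta>" using b.nonunit_mult2[OF b.x_nonunit, of c] b.nonunit_mult2[of y d] z sub by blast+
  then show "z \<in> nonunits \<beta>" unfolding z(1) by (rule b.nonunit_add)
qed

lemma dominates_ab: "dominates \<alpha> \<beta>" using sub nonunit_sub by (simp add: dominates_def)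

lemma polys_in: "p \<in> polys \<alpha> \<Longrightarrow> poly p (y/x) \<in> \<beta>"
  using b.polys_poly polys_mono[OF sub] tau_in by blast

lemma mpolys_in: assumes p: "p \<in> mpolys \<alpha>" shows "poly p (y/x) / x \<in> \<beta>"
proof -
  obtain q where "q \<in> polys \<alpha>" "poly p (y/x) = x * poly q (y/x)" using a.mpolys_xE[OF p order_refl] by blast
  then show ?thesis using polys_in by simp
qed

lemma mpolys_nonu: assumes p: "p \<in> mpolys \<alpha>" shows "poly p (y/x) \<in> nonunits \<beta>"
proof -
  have "poly p (y/x) = x * (poly p (y/x) / x)" by simp
  then show ?thesis using b.nonunit_mult[OF b.x_nonunit mpolys_in[OF p]] by simp
qed

lemma neq: "\<alpha> \<noteq> \<beta>" using tau_in a.yx by blast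

lemma reprE: assumes "z \<in> \<beta>" obtains p q where "z = poly p (y/x) / poly q (y/x)" "p \<in> polys \<alpha>" "q \<in> polys \<alpha>" 
  "poly q (y/x) \<notin> nonunits \<beta>" "poly q (y/x) \<noteq> 0" "inverse (poly q (y/x)) \<in> \<beta>" "q \<notin> mpolys \<alpha>"
proof -
  obtain p q where z: "z = poly p (y/x) / poly q (y/x)" "p \<in> polys \<alpha>" "q \<in> polys \<alpha>" "poly q (y/x) \<notin> nonunits \<beta>" using repr[OF assms] by blast
  show ?thesis by (rule that[OF z]) (use b.unitD[OF polys_in[OF z(3)] z(4)] mpolys_nonu z(4) in blast)+
qed

text \<open>Clearing the denominator l gives \<open>poly (p * l) (y/x) = x * poly k (y/x)\<close>;
  as l is not in \<open>mpolys \<alpha>\<close>, Gauss's lemma puts p there.\<close>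

lemma x_div: assumes p: "p \<in> polys \<alpha>" "poly p (y/x) / x \<in> \<beta>" shows "p \<in> mpolys \<alpha>"
proof -
  obtain k l where c: "poly p (y/x) / x = poly k (y/x) / poly l (y/x)" "k \<in> polys \<alpha>" "l \<in> polys \<alpha>" 
    "poly l (y/x) \<noteq> 0" "l \<notin> mpolys \<alpha>" using reprE[OF p(2)] by metis
  have e: "poly (p * l) (y/x) = x * poly k (y/x)" using c(1,4) a.x0 by (simp add: field_simps)
  have "p * l \<in> mpolys \<alpha>" by (rule a.xE_mpol[OF a.polys_mult[OF p(1) c(3)] c(2) e])
  then show ?thesis using a.gauss[OF p(1) c(3)] c(5) by blast
qed

text \<open>For elements of \<open>adjoin \<alpha> (y/x)\<close> this is division by a monic
  polynomial of degree at most r. A denominator w is inverted modulo J by another polynomial value: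
  that ring modulo J has finite length over \<alpha>, so the descending chain given by the powers of
  w stalls.\<close>

lemma reduce:
  assumes J: "is_ideal J \<beta>" and xJ: "x \<in> J" and F: "F \<in> polys \<alpha>" "F \<notin> mpolys \<alpha>" "poly F (y/x) \<in> J" "degree F \<le> r" "1 \<le> r"
    and z: "z \<in> \<beta>"
  shows "\<exists>e\<in>polys \<alpha>. degree e < r \<and> z - poly e (y/x) \<in> J"
proof -
  have Jsm: "submod \<beta> J" and Jb: "J \<subseteq> \<beta>" using J by (simp_all add: ideal_submod)
  note Jd = submodD[OF Jsm]
  have mJ: "poly p (y/x) \<in> J" if p: "p \<in> mpolys \<alpha>" for p
  proof -
    have "poly p (y/x) / x * x \<in> J" by (rule Jd(3)[OF mpolys_in[OF p] xJ])
    then show ?thesis by simp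
  qed
  define \<J> where "\<J> = {p \<in> polys \<alpha>. poly p (y/x) \<in> J}"
  obtain G where G: "G \<in> \<J>" "lead_coeff G = 1" "degree G \<le> degree F"
  proof (rule a.min_monic[of \<J> F])
    show "\<J> \<subseteq> polys \<alpha>" by (auto simp: \<J>_def)
    show "smult c p \<in> \<J>" if "p \<in> \<J>" "c \<in> \<alpha>" for p c
      using that Jd(3)[of c "poly p (y/x)"] sub by (auto simp: \<J>_def)
    show "p - monom c n \<in> \<J>" if "p \<in> \<J>" "c \<in> nonunits \<alpha>" for p c n
      using that b.submod_diff[OF Jsm _ mJ[OF a.mpolys_monom[OF that(2), of n]], of "poly p (y/x)"] a.nonunitD by (auto simp: \<J>_def)
  qed (use F in \<open>auto simp: \<J>_def\<close>)
  have GR: "G \<in> polys \<alpha>" and GJ: "poly G (y/x) \<in> J" using G(1) by (simp_all add: \<J>_def)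
  show ?thesis
  proof (cases "degree G \<ge> 1")
    case False
    then have "G = 1" using G(2) by (metis degree_eq_zeroE less_one not_le one_pCons lead_coeff_pCons(2))
    then have "1 \<in> J" using GJ by simp
    then have "z * 1 \<in> J" by (rule Jd(3)[OF z])
    then show ?thesis using F(5) by (intro bexI[of _ 0]) auto
  next
    case True
    have dv: "\<exists>e\<in>polys \<alpha>. degree e < degree G \<and> poly p (y/x) - poly e (y/x) \<in> J" if p: "p \<in> polys \<alpha>" for p
    proof -
      obtain s e where se: "s \<in> polys \<alpha>" "e \<in> polys \<alpha>" "p = G * s + e" "degree e < degree G" using a.polys_division[OF GR G(2) True p] by blast
      have "poly p (y/x) - poly e (y/x) = poly s (y/x) * poly G (y/x)" using se(3) by simp
      then have "poly p (y/x) - poly e (y/x) \<in> J" using Jd(3)[OF polys_in[OF se(1)] GJ] by simp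
      then show ?thesis using se by blast
    qed
    let ?E = "adjoin \<alpha> (y/x)"
    have Eb: "?E \<subseteq> \<beta>" using polys_in by (auto simp: adjoin_def)
    interpret E: sring ?E by unfold_locales (rule a.adjoin_subring)
    have Esm: "submod \<alpha> ?E" by (rule submod_mono[OF E.submod_self]) (use a.adjoin_base in blast)
    define N where "N = ?E \<inter> J"
    have Nsm: "submod \<alpha> N" unfolding N_def by (rule submod_Int[OF Esm submod_mono[OF Jsm sub]])
    have bdN: "length_le \<alpha> N (mod_span \<alpha> N (\<lambda>i. (y/x) ^ i) {..<degree G}) (card {..<degree G})"
    proof (rule conjunct1[OF a.length_spn[OF Nsm]])
      fix j c assume c: "c \<in> nonunits \<alpha>"
      have m: "monom c j \<in> mpolys \<alpha>" using c by (rule a.mpolys_monom)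
      then have "poly (monom c j) (y/x) \<in> J" "poly (monom c j) (y/x) \<in> ?E" using mJ adjI a.mpolys_pol by blast+
      then show "c * (y/x) ^ j \<in> N" by (simp add: N_def poly_monom)
    qed simp
    have "?E \<subseteq> mod_span \<alpha> N (\<lambda>i. (y/x) ^ i) {..<degree G}"
    proof
      fix u assume uE: "u \<in> ?E"
      then obtain p where u: "u = poly p (y/x)" "p \<in> polys \<alpha>" by (auto simp: adjoin_def)
      obtain e where e: "e \<in> polys \<alpha>" "degree e < degree G" "poly p (y/x) - poly e (y/x) \<in> J" using dv[OF u(2)] by blast
      have "poly e (y/x) = (\<Sum>i<degree G. coeff e i * (y/x) ^ i)"
        unfolding poly_altdef by (rule sum.mono_neutral_left) (use e(2) in \<open>auto intro: le_degree\<close>)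
      then have "u = (u - poly e (y/x)) + (\<Sum>i<degree G. coeff e i * (y/x) ^ i)" by simp
      moreover have "u - poly e (y/x) \<in> N" unfolding N_def using E.diff[OF uE adjI[OF e(1)]] e(3) u(1) by simp
      ultimately show "u \<in> mod_span \<alpha> N (\<lambda>i. (y/x) ^ i) {..<degree G}"
        using spnI[of "u - poly e (y/x)" N "{..<degree G}" "coeff e"] a.polys_coeff[OF e(1)] by metis
    qed
    then have bdE: "length_le \<alpha> N ?E (degree G)" using length_mono[OF bdN order_refl] by simp
    from z obtain p q where pq: "z = poly p (y/x) / poly q (y/x)" "p \<in> polys \<alpha>" "q \<in> polys \<alpha>" 
      "poly q (y/x) \<noteq> 0" "inverse (poly q (y/x)) \<in> \<beta>" by (rule reprE)
    define w where "w = poly q (y/x)"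
    have w: "w \<in> ?E" "w \<noteq> 0" "inverse w \<in> \<beta>" using pq adjI by (auto simp: w_def)
    have wi: "w ^ i \<in> ?E" for i using w(1) by simp
    \<comment> \<open>Stalling gives \<open>w ^ i = n + w ^ Suc i * u\<close> with n in J. Since w
      is a unit of \<beta>, \<open>1 - w * u\<close> lies in J, and u inverts w modulo J.\<close>
    define K where "K i = ssum N ((*) (w ^ i) ` ?E)" for i
    have "\<exists>i. K i = K (Suc i)"
    proof (rule length_descending[OF bdE])
      fix i
      have sm: "submod \<alpha> ((*) (w ^ i) ` ?E)" by (rule submod_smult[OF Esm])
      show "submod \<alpha> (K i)" unfolding K_def by (rule ssum_submod[OF Nsm sm])
      show "N \<subseteq> K i" unfolding K_def by (rule ssum_sup1[OF sm])
      show "K i \<subseteq> ?E" unfolding K_def using wi[of i] by (intro ssum_least[OF Esm]) (auto simp: N_def)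
      have "(*) (w ^ Suc i) ` ?E \<subseteq> (*) (w ^ i) ` ?E"
      proof (rule image_subsetI)
        fix u assume "u \<in> ?E"
        then have "w * u \<in> ?E" using w by simp
        moreover have "w ^ Suc i * u = w ^ i * (w * u)" by simp
        ultimately show "w ^ Suc i * u \<in> (*) (w ^ i) ` ?E" by blast
      qed
      then show "K (Suc i) \<subseteq> K i" unfolding K_def by (rule ssum_mono[OF order_refl])
    qed
    then obtain i where i: "K i = K (Suc i)" by blast
    have "w ^ i * 1 \<in> (*) (w ^ i) ` ?E" using E.one by blast
    then have "w ^ i * 1 \<in> K i" unfolding K_def by (rule subsetD[OF ssum_sup2[OF Nsm]])
    then have "w ^ i \<in> K (Suc i)" unfolding i by simp
    then obtain n u where nu: "w ^ i = n + w ^ Suc i * u" "n \<in> J" "u \<in> ?E" unfolding K_def ssum_def N_def by blast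
    obtain s where s: "u = poly s (y/x)" "s \<in> polys \<alpha>" using nu(3) by (auto simp: adjoin_def)
    have "1 - w * u = inverse w ^ i * n"
    proof -
      have "n = w ^ i * (1 - w * u)" using nu(1) by (simp add: algebra_simps)
      then show ?thesis using w(2) by (simp add: field_simps)
    qed
    then have one: "1 - w * u \<in> J" using Jd(3)[OF b.pow[OF w(3)] nu(2)] by simp
    have zw: "z = poly p (y/x) * inverse w" using pq(1) by (simp add: w_def field_simps)
    have "z - poly (p * s) (y/x) = (poly p (y/x) * inverse w) * (1 - w * u)"
      using w(2) s(1) unfolding zw by (simp add: field_simps)
    moreover have "\<dots> \<in> J" by (rule Jd(3)[OF b.mult[OF polys_in[OF pq(2)] w(3)] one])
    ultimately have 1: "z - poly (p * s) (y/x) \<in> J" by simp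
    obtain e where e: "e \<in> polys \<alpha>" "degree e < degree G" "poly (p * s) (y/x) - poly e (y/x) \<in> J" using dv[of "p * s"] pq(2) s(2) by auto
    have "(z - poly (p * s) (y/x)) + (poly (p * s) (y/x) - poly e (y/x)) \<in> J" by (rule Jd(2)[OF 1 e(3)])
    then have "z - poly e (y/x) \<in> J" by simp
    then show ?thesis using e G(3) F(4) by (intro bexI[of _ e]) auto
  qed
qed

lemma g_mpol: "g \<notin> mpolys \<alpha>"
proof
  assume "g \<in> mpolys \<alpha>" then have "lead_coeff g \<in> nonunits \<alpha>" unfolding mpolys_def by blast
  then show False using g(2) by simp
qed

lemma residue_repr: assumes "z \<in> \<beta>" shows "\<exists>e\<in>polys \<alpha>. degree e < degree g \<and> z - poly e (y/x) \<in> nonunits \<beta>"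
  by (rule reduce[OF b.nonunit_ideal b.x_nonunit g(1) g_mpol g(4) order_refl g(3) assms])

lemma split: assumes p: "p \<in> polys \<alpha>" "poly p (y/x) \<in> nonunits \<beta>"
  shows "\<exists>s\<in>polys \<alpha>. \<exists>r\<in>mpolys \<alpha>. p = g * s + r \<and> degree r < degree g"
proof -
  obtain s r where sr: "s \<in> polys \<alpha>" "r \<in> polys \<alpha>" "p = g * s + r" "degree r < degree g" using a.polys_division[OF g(1,2,3) p(1)] by blast
  have "poly r (y/x) = poly p (y/x) - poly g (y/x) * poly s (y/x)" using sr(3) by simp
  moreover have "poly g (y/x) * poly s (y/x) \<in> nonunits \<beta>" by (rule b.nonunit_mult[OF g(4) polys_in[OF sr(1)]])
  ultimately have "poly r (y/x) \<in> nonunits \<beta>" using b.nonunit_diff[OF p(2)] by simp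
  then have "r \<in> mpolys \<alpha>" using gmin sr by blast
  then show ?thesis using sr by blast
qed

text \<open>The center of \<beta> consists of the values of gs + r with r in
  \<open>mpolys \<alpha>\<close>, so it is contained in the center of \<beta>'. Equality follows
  from maximality: a value that is a unit of \<beta> has an inverse that is polynomial in
  \<open>y / x\<close> up to a nonunit.\<close>

lemma determined:
  assumes B: "transform \<alpha> x y \<beta>' t' g'" and gb: "poly g (y/x) \<in> nonunits \<beta>'"
  shows "\<beta>' = \<beta>"
proof -
  interpret B: transform \<alpha> x y \<beta>' t' g' by (rule B)
  have 1: "poly p (y/x) \<in> nonunits \<beta>'" if p: "p \<in> polys \<alpha>" "poly p (y/x) \<in> nonunits \<beta>" for p
  proof -
    obtain s r where sr: "s \<in> polys \<alpha>" "r \<in> mpolys \<alpha>" "p = g * s + r" using split[OF p] by blast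
    have "poly g (y/x) * poly s (y/x) \<in> nonunits \<beta>'" by (rule B.b.nonunit_mult[OF gb B.polys_in[OF sr(1)]])
    then show ?thesis using B.b.nonunit_add[OF _ B.mpolys_nonu[OF sr(2)]] sr(3) by simp
  qed
  have 2: "poly p (y/x) \<in> nonunits \<beta>" if p: "p \<in> polys \<alpha>" "poly p (y/x) \<in> nonunits \<beta>'" for p
  proof (rule ccontr)
    assume n: "poly p (y/x) \<notin> nonunits \<beta>"
    then have i: "poly p (y/x) \<noteq> 0" "inverse (poly p (y/x)) \<in> \<beta>" using b.unitD polys_in[OF p(1)] by blast+
    obtain e where e: "e \<in> polys \<alpha>" "inverse (poly p (y/x)) - poly e (y/x) \<in> nonunits \<beta>" using residue_repr[OF i(2)] by blast
    have "poly p (y/x) * (inverse (poly p (y/x)) - poly e (y/x)) \<in> nonunits \<beta>" by (rule b.nonunit_mult2[OF e(2) polys_in[OF p(1)]])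
    moreover have "poly p (y/x) * (inverse (poly p (y/x)) - poly e (y/x)) = poly (1 - p * e) (y/x)" using i(1) by (simp add: field_simps)
    ultimately have "poly (1 - p * e) (y/x) \<in> nonunits \<beta>" by simp
    then have 3: "poly (1 - p * e) (y/x) \<in> nonunits \<beta>'" using 1[of "1 - p * e"] p e by simp
    have "poly p (y/x) * poly e (y/x) \<in> nonunits \<beta>'" by (rule B.b.nonunit_mult[OF p(2) B.polys_in[OF e(1)]])
    then have "poly (1 - p * e) (y/x) + poly p (y/x) * poly e (y/x) \<in> nonunits \<beta>'" by (rule B.b.nonunit_add[OF 3])
    then show False by simp
  qed
  show ?thesis
  proof
    show "\<beta>' \<subseteq> \<beta>"
    proof
      fix z assume "z \<in> \<beta>'"
      then obtain p q where z: "z = poly p (y/x) / poly q (y/x)" "p \<in> polys \<alpha>" "q \<in> polys \<alpha>" "poly q (y/x) \<notin> nonunits \<beta>'" by (rule B.reprE)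
      then have "poly q (y/x) \<notin> nonunits \<beta>" using 1 by blast
      then have "inverse (poly q (y/x)) \<in> \<beta>" using b.unitD polys_in[OF z(3)] by blast
      then show "z \<in> \<beta>" using b.mult[OF polys_in[OF z(2)]] unfolding z(1) divide_inverse[of "poly p (y/x)"] by blast
    qed
    show "\<beta> \<subseteq> \<beta>'"
    proof
      fix z assume "z \<in> \<beta>"
      then obtain p q where z: "z = poly p (y/x) / poly q (y/x)" "p \<in> polys \<alpha>" "q \<in> polys \<alpha>" "poly q (y/x) \<notin> nonunits \<beta>" by (rule reprE)
      then have "poly q (y/x) \<notin> nonunits \<beta>'" using 2 by blast
      then have "inverse (poly q (y/x)) \<in> \<beta>'" using B.b.unitD B.polys_in[OF z(3)] by blast
      then show "z \<in> \<beta>'" using B.b.mult[OF B.polys_in[OF z(2)]] unfolding z(1) divide_inverse[of "poly p (y/x)"] by blast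
    qed
  qed
qed

end

text \<open>These transforms correspond to irreducible factors of F modulo nonunits. Splitting off
  the factor g of one of them leaves s of smaller degree, and any other transform in the set belongs
  to s.\<close>

lemma (in regular2) finite_points:
  assumes "F \<in> polys R" "F \<notin> mpolys R" shows "finite {\<beta>. is_transform R x y \<beta> \<and> poly F tau \<in> nonunits \<beta>}"
  using assms
proof (induction "degree F" arbitrary: F rule: less_induct)
  case less
  show ?case
  proof (cases "{\<beta>. is_transform R x y \<beta> \<and> poly F tau \<in> nonunits \<beta>} = {}")
    case False
    then obtain \<beta> t g where q: "transform R x y \<beta> t g" and Fb: "poly F tau \<in> nonunits \<beta>" unfolding is_transform_def by blast
    interpret q: transform R x y \<beta> t g by (rule q)
    obtain s r where sr: "s \<in> polys R" "r \<in> mpolys R" "F = g * s + r" "degree r < degree g" using q.split[OF less(2) Fb] by blast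
    have sn: "s \<notin> mpolys R"
    proof
      assume "s \<in> mpolys R"
      then have "s * g \<in> mpolys R" by (rule mpolys_mult[OF _ q.g(1)])
      then have "s * g + r \<in> mpolys R" using sr(2) by (rule mpolys_add)
      then show False using sr(3) less(3) by (simp add: mult.commute)
    qed
    then have "s \<noteq> 0" "g \<noteq> 0" using q.g(2) by auto
    then have dg: "degree (g * s) = degree g + degree s" by (rule degree_mult_eq[rotated])
    then have "degree F = degree g + degree s" using sr(3,4) degree_add_eq_left[of r "g * s"] by simp
    then have ds: "degree s < degree F" using q.g(3) by simp
    have "{\<beta>. is_transform R x y \<beta> \<and> poly F tau \<in> nonunits \<beta>} \<subseteq> insert \<beta> {\<beta>. is_transform R x y \<beta> \<and> poly s tau \<in> nonunits \<beta>}"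
    proof
      fix \<beta>' assume b': "\<beta>' \<in> {\<beta>. is_transform R x y \<beta> \<and> poly F tau \<in> nonunits \<beta>}"
      then obtain t' g' where q': "transform R x y \<beta>' t' g'" unfolding is_transform_def by blast
      interpret q': transform R x y \<beta>' t' g' by (rule q')
      have "poly F tau - poly r tau \<in> nonunits \<beta>'" using b' q'.b.nonunit_diff q'.mpolys_nonu[OF sr(2)] by blast
      then have "poly g tau * poly s tau \<in> nonunits \<beta>'" using sr(3) by simp
      then have "poly g tau \<in> nonunits \<beta>' \<or> poly s tau \<in> nonunits \<beta>'" by (rule q'.b.nonunit_prime[OF q'.polys_in[OF q.g(1)] q'.polys_in[OF sr(1)]])
      then show "\<beta>' \<in> insert \<beta> {\<beta>. is_transform R x y \<beta> \<and> poly s tau \<in> nonunits \<beta>}" using q.determined[OF q'] b' by blast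
    qed
    then show ?thesis using less(1)[OF ds sr(1) sn] by (meson finite_insert finite_subset)
  next
    case True then show ?thesis by (simp only: finite.emptyI)
  qed
qed

lemma (in regular2) prime_assoc: assumes p: "prime_in R p" "prime_in R q" "p / q \<in> R" shows "q / p \<in> R"
proof -
  note pp = prmD[OF p(1)] and qq = prmD[OF p(2)]
  have "q * (p / q) / p \<in> R" using pp qq by simp
  then have "q / p \<in> R \<or> p / q / p \<in> R" by (rule pp(5)[OF qq(2) p(3)])
  moreover have "p / q / p = 1 / q" using pp by simp
  ultimately show ?thesis using qq(4) by metis
qed

context transform begin

text \<open>The contraction is a nonzero prime ideal that misses x, so it is not maximal and hence
  principal.\<close>

lemma contract_prime:
  assumes p: "prime_in \<beta> p" and nx: "x / p \<notin> \<beta>" and f: "f \<in> \<alpha>" "f \<noteq> 0" "f / p \<in> \<beta>"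
  shows "\<exists>a. prime_in \<alpha> a \<and> {c \<in> \<alpha>. c / p \<in> \<beta>} = {a * r | r. r \<in> \<alpha>}"
proof -
  note pp = b.prmD[OF p]
  let ?P = "{c \<in> \<alpha>. c / p \<in> \<beta>}"
  have "prime_ideal ?P \<alpha>"
  proof (rule prime_idealI)
    show "is_ideal ?P \<alpha>"
    proof (rule is_idealI)
      show "u + v \<in> ?P" if "u \<in> ?P" "v \<in> ?P" for u v using that b.div_add by auto
      show "r * u \<in> ?P" if "r \<in> \<alpha>" "u \<in> ?P" for r u using that b.div_mult(2)[of u p r] sub by auto
    qed auto
    show "1 \<notin> ?P" using pp by simp
    show "c \<in> ?P \<or> d \<in> ?P" if "c \<in> \<alpha>" "d \<in> \<alpha>" "c * d \<in> ?P" for c d using that pp(5)[of c d] sub by auto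
  qed simp
  moreover have "?P \<noteq> {0}" using f by auto
  moreover have "?P \<noteq> nonunits \<alpha>" using a.x_nonunit nx by blast
  ultimately show ?thesis using a.prime_principal by simp
qed

text \<open>Noether's inequality in the weak form needed for induction: the colength of the transform of
  a pencil drops strictly. Ideals above the transform contract injectively along
  \<open>K \<mapsto> x\<^sup>rK \<inter> \<alpha>\<close>.\<close>
lemma noether_drop:
  assumes f: "f \<in> \<alpha>" "f = x ^ r * poly F (y/x)" "F \<in> polys \<alpha>" "F \<notin> mpolys \<alpha>" "degree F \<le> r"
    and h: "h \<in> \<alpha>" "h = x ^ s * poly G (y/x)" "G \<in> polys \<alpha>" "h \<noteq> 0"
    and rs: "r \<le> s" and coprime_in: "coprime_in \<alpha> f h" and nf: "f / h \<notin> \<beta>" "h / f \<notin> \<beta>" and length_le: "length_le \<alpha> (gen_ideal \<alpha> f h) \<alpha> n"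
  shows "\<exists>f'\<in>\<beta>. \<exists>h'\<in>\<beta>. f' / h' = f / h \<and> f' \<noteq> 0 \<and> h' \<noteq> 0 \<and> coprime_in \<beta> f' h' \<and> n \<ge> 1 \<and> length_le \<beta> (gen_ideal \<beta> f' h') \<beta> (n - 1)"
proof -
  \<comment> \<open>Both members of the pencil are divided by \<open>x ^ r\<close>, where r is the
    order of f; the surplus power \<open>x ^ (s - r)\<close> stays with h.\<close>
  define f' where "f' = poly F (y/x)"
  define h' where "h' = x ^ (s - r) * poly G (y/x)"
  have xs: "x ^ s = x ^ r * x ^ (s - r)" using rs by (simp flip: power_add)
  have ff: "f = x ^ r * f'" and hh: "h = x ^ r * h'" using f(2) h(2) xs by (simp_all add: f'_def h'_def)
  have fb: "f' \<in> \<beta>" unfolding f'_def by (rule polys_in[OF f(3)])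
  have hb: "h' \<in> \<beta>" unfolding h'_def using polys_in[OF h(3)] by simp
  have f0: "f' \<noteq> 0" unfolding f'_def by (rule a.nz[OF f(3,4)])
  have h0: "h' \<noteq> 0" using hh h(4) by auto
  have fne: "f \<noteq> 0" using ff f0 a.x0 by simp
  have e: "f' / h' = f / h" "h' / f' = h / f" unfolding ff hh by simp_all
  have fn: "f' \<in> nonunits \<beta>"
  proof (rule ccontr)
    assume "f' \<notin> nonunits \<beta>" then have "inverse f' \<in> \<beta>" using b.unitD fb by blast
    then have "h' * inverse f' \<in> \<beta>" using hb by simp
    then show False using e nf by (simp add: divide_inverse)
  qed
  \<comment> \<open>Order 0 would make f a unit, so that \<open>h / f\<close> would belong to
    \<beta>.\<close>
  have r1: "1 \<le> r"
  proof (rule ccontr)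
    assume "\<not> 1 \<le> r"
    then have "degree F = 0" using f(5) by simp
    then obtain c where c: "F = [:c:]" by (meson degree_eq_zeroE)
    have "c \<in> \<alpha>" using f(3) c by simp
    moreover have "c \<notin> nonunits \<alpha>" using f(4) c a.mpolys_monom[of c 0] by (auto simp: monom_0)
    ultimately have "c \<notin> nonunits \<beta>" using dominates_unit[OF dominates_ab _ _ a.sring_axioms] by blast
    then show False using fn c by (simp add: f'_def)
  qed
  have cp: "coprime_in \<beta> f' h'"
  proof (rule b.copI_prm[OF fb f0])
    fix p assume p: "prime_in \<beta> p" "f' / p \<in> \<beta>"
    show "h' / p \<notin> \<beta>"
    proof
      assume hp: "h' / p \<in> \<beta>"
      note pp = b.prmD[OF p(1)]
      have nx: "x / p \<notin> \<beta>"
      proof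
        assume "x / p \<in> \<beta>"
        then have "p / x \<in> \<beta>" using b.prime_assoc[OF b.px p(1)] by blast
        then have "f' / x \<in> \<beta>" using b.div_trans[of p x f'] p pp by blast
        then show False using x_div[OF f(3)] f(4) by (simp add: f'_def)
      qed
      have "f / p \<in> \<beta>" "h / p \<in> \<beta>" unfolding ff hh using b.div_mult(2)[OF p(2), of "x ^ r"] b.div_mult(2)[OF hp, of "x ^ r"] by simp_all
      then obtain a where a: "prime_in \<alpha> a" "{c \<in> \<alpha>. c / p \<in> \<beta>} = {a * r | r. r \<in> \<alpha>}"
        using contract_prime[OF p(1) nx f(1) fne] by blast
      have "f / a \<in> \<alpha>" "h / a \<in> \<alpha>" using a.dvd_set[OF a.prmD(3)[OF a(1)]] a(2) f(1) h(1) \<open>f / p \<in> \<beta>\<close> \<open>h / p \<in> \<beta>\<close> by blast+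
      then show False using a.coprime_prm[OF coprime_in a(1)] by blast
    qed
  qed
  let ?J = "gen_ideal \<beta> f' h'"
  have Ji: "is_ideal ?J \<beta>" and fJ: "f' \<in> ?J" using b.gen_ideal_ideal[OF fb hb] by blast+
  have Jsm: "submod \<beta> ?J" and Jb: "?J \<subseteq> \<beta>" using Ji by (simp_all add: ideal_submod)
  obtain m where m: "length_le \<beta> ?J \<beta> m" using b.length_cop[OF fb hb cp] by blast
  obtain k where k: "x ^ k \<in> ?J" using b.length_power[OF Ji m b.x_nonunit] by blast
  define L where "L = ssum ?J {r * x | r. r \<in> \<beta>}"
  have lsm: "submod \<beta> {r * x | r. r \<in> \<beta>}" by (rule b.submod_line)
  have Li: "is_ideal L \<beta>" unfolding L_def ideal_submod
  proof
    have "{r * x | r. r \<in> \<beta>} \<subseteq> \<beta>" using b.xR by auto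
    then show "ssum ?J {r * x | r. r \<in> \<beta>} \<subseteq> \<beta>" by (rule ssum_least[OF b.submod_self Jb])
    show "submod \<beta> (ssum ?J {r * x | r. r \<in> \<beta>})" by (rule ssum_submod[OF Jsm lsm])
  qed
  have "1 * x \<in> {r * x | r. r \<in> \<beta>}" using b.one by blast
  then have xL: "x \<in> L" unfolding L_def using ssum_sup2[OF Jsm, of "{r * x | r. r \<in> \<beta>}"] by auto
  have fL: "poly F (y/x) \<in> L" unfolding L_def using ssum_sup1[OF lsm, of ?J] fJ by (auto simp: f'_def)
  have red1: "\<exists>e\<in>polys \<alpha>. degree e < r \<and> z - poly e (y/x) \<in> L" if "z \<in> \<beta>" for z
    by (rule reduce[OF Li xL f(3,4) fL f(5) r1 that])
  \<comment> \<open>The reduction modulo L, the sum of the pencil ideal and x\<beta>, is iterated,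
    each remainder being passed to the next power of x. At \<open>i = k\<close> the remainder lies
    in the pencil ideal, since \<open>x ^ k\<close> does.\<close>
  have redi: "\<exists>e\<in>polys \<alpha>. degree e < r \<and> (\<exists>j\<in>?J. \<exists>w\<in>\<beta>. z = poly e (y/x) + j + x ^ i * w)" if z: "z \<in> \<beta>" for z i
  proof (induction i)
    case 0
    have "z = poly 0 (y/x) + 0 + x ^ 0 * z" by simp
    moreover have "0 \<in> ?J" by (rule submodD(1)[OF Jsm])
    moreover have "degree 0 < r" using r1 by simp
    ultimately show ?case using z a.polys_0 by blast
  next
    case (Suc i)
    then obtain e j w where e: "e \<in> polys \<alpha>" "degree e < r" "j \<in> ?J" "w \<in> \<beta>" "z = poly e (y/x) + j + x ^ i * w" by blast
    obtain e1 where e1: "e1 \<in> polys \<alpha>" "degree e1 < r" "w - poly e1 (y/x) \<in> L" using red1[OF e(4)] by blast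
    then obtain j1 w1 where j1: "w - poly e1 (y/x) = j1 + w1 * x" "j1 \<in> ?J" "w1 \<in> \<beta>" unfolding L_def ssum_def by blast
    then have w: "w = poly e1 (y/x) + j1 + w1 * x" by (simp add: algebra_simps)
    have "z = poly (e + smult (x ^ i) e1) (y/x) + (j + x ^ i * j1) + x ^ Suc i * w1"
      unfolding e(5) w by (simp add: algebra_simps)
    moreover have "e + smult (x ^ i) e1 \<in> polys \<alpha>" using e e1 by simp
    moreover have "degree (e + smult (x ^ i) e1) < r" using e e1 by (intro degree_add_less) (auto intro: le_less_trans[OF degree_smult_le])
    moreover have "j + x ^ i * j1 \<in> ?J" using submodD(2)[OF Jsm e(3) submodD(3)[OF Jsm _ j1(2)]] by simp
    ultimately show ?case using j1(3) by blast
  qed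
  have red: "\<exists>e\<in>polys \<alpha>. degree e < r \<and> z - poly e (y/x) \<in> ?J" if z: "z \<in> \<beta>" for z
  proof -
    obtain e j w where e: "e \<in> polys \<alpha>" "degree e < r" "j \<in> ?J" "w \<in> \<beta>" "z = poly e (y/x) + j + x ^ k * w" using redi[OF z] by blast
    have "x ^ k * w \<in> ?J" using submodD(3)[OF Jsm e(4) k] by (simp add: mult.commute)
    then have "j + x ^ k * w \<in> ?J" by (rule submodD(2)[OF Jsm e(3)])
    then show ?thesis using e by (intro bexI[of _ e]) (simp_all add: algebra_simps)
  qed
  \<comment> \<open>Proper steps survive this contraction because, modulo the pencil ideal, every
    element of \<beta> is a polynomial of degree below r in \<open>y / x\<close>, and
    \<open>x ^ r\<close> times such a value lies in \<alpha>.\<close>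
  define C where "C K = {c. c * inverse (x ^ r) \<in> K} \<inter> \<alpha>" for K
  have Csm: "submod \<alpha> (C K)" if "submod \<beta> K" for K
    unfolding C_def by (rule submod_Int[OF submod_vimage[OF submod_mono[OF that sub]] a.submod_self])
  have JC: "gen_ideal \<alpha> f h \<subseteq> C ?J"
  proof (rule a.gen_ideal_least)
    show "is_ideal (C ?J) \<alpha>" using Csm[OF Jsm] by (auto simp: ideal_submod C_def)
    have "f * inverse (x ^ r) = f'" "h * inverse (x ^ r) = h'" unfolding ff hh using a.x0 by simp_all
    then show "f \<in> C ?J" "h \<in> C ?J" using b.gen_ideal_ideal(2,3)[OF fb hb] f(1) h(1) unfolding C_def by simp_all
  qed
  have Cmono: "C K \<subseteq> C K'" if "K \<subseteq> K'" for K K' using that unfolding C_def by blast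
  have main: "s + 1 \<le> n" if s: "chain_ge \<beta> ?J \<beta> s" for s
  proof -
    obtain K l where ch: "chain_in \<beta> ?J \<beta> K l" and sl: "s \<le> card (steps K l)" using s unfolding chain_ge_def by blast
    note K = chain_inD[OF ch]
    have "chain_in \<alpha> (gen_ideal \<alpha> f h) (C \<beta>) (\<lambda>i. C (K i)) l"
    proof (rule chain_inI)
      fix i assume i: "i \<le> l"
      show "submod \<alpha> (C (K i))" by (rule Csm[OF K(1)[OF i]])
      show "gen_ideal \<alpha> f h \<subseteq> C (K i)" using JC Cmono[OF K(2)[OF i]] by blast
      show "C (K i) \<subseteq> C \<beta>" by (rule Cmono[OF K(3)[OF i]])
    next
      fix i assume "i < l" then show "C (K i) \<subseteq> C (K (Suc i))" by (rule Cmono[OF K(4)])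
    qed
    moreover have "steps K l \<subseteq> steps (\<lambda>i. C (K i)) l"
    proof
      fix i assume "i \<in> steps K l"
      then have i: "i < l" "K i \<noteq> K (Suc i)" by (simp_all add: steps_def)
      have sm: "submod \<beta> (K i)" "submod \<beta> (K (Suc i))" "?J \<subseteq> K i" "?J \<subseteq> K (Suc i)" "K (Suc i) \<subseteq> \<beta>"
        using K(1)[of i] K(1)[of "Suc i"] K(2)[of i] K(2)[of "Suc i"] K(3)[of "Suc i"] i(1) by simp_all
      obtain z where z: "z \<in> K (Suc i)" "z \<notin> K i" using K(4)[OF i(1)] i(2) by blast
      obtain e where e: "e \<in> polys \<alpha>" "degree e < r" "z - poly e (y/x) \<in> ?J" using red sm(5) z(1) by blast
      have "z - (z - poly e (y/x)) \<in> K (Suc i)" using b.submod_diff[OF sm(2) z(1)] e(3) sm(4) by blast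
      then have e1: "poly e (y/x) \<in> K (Suc i)" by simp
      have "poly e (y/x) \<notin> K i"
      proof
        assume "poly e (y/x) \<in> K i"
        then have "(z - poly e (y/x)) + poly e (y/x) \<in> K i" using submodD(2)[OF sm(1)] e(3) sm(3) by blast
        then show False using z(2) by simp
      qed
      moreover have "x ^ r * poly e (y/x) \<in> \<alpha>" using e(2) by (intro a.homog e(1)) auto
      moreover have eq: "x ^ r * poly e (y/x) * inverse (x ^ r) = poly e (y/x)" using a.x0 by simp
      ultimately have "x ^ r * poly e (y/x) \<in> C (K (Suc i))" "x ^ r * poly e (y/x) \<notin> C (K i)"
        unfolding C_def Int_iff mem_Collect_eq eq using e1 by blast+
      then show "i \<in> steps (\<lambda>i. C (K i)) l" using i(1) by (auto simp: steps_def)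
    qed
    then have "card (steps K l) \<le> card (steps (\<lambda>i. C (K i)) l)" by (rule card_mono[OF steps_fin])
    then have "s \<le> card (steps (\<lambda>i. C (K i)) l)" using sl by simp
    ultimately have 1: "chain_ge \<alpha> (gen_ideal \<alpha> f h) (C \<beta>) s" by (rule hcI)
    have Cb: "submod \<alpha> (C \<beta>)" "C \<beta> \<subseteq> \<alpha>" using Csm[OF b.submod_self] by (auto simp: C_def)
    \<comment> \<open>The source of the strict drop: as \<open>r \<ge> 1\<close>, even \<beta>
      contracts to a proper ideal of \<alpha>, which leaves one more step above the contracted
      chain.\<close>
    have "1 \<notin> C \<beta>"
    proof
      assume "1 \<in> C \<beta>"
      then have "inverse (x ^ r) \<in> \<beta>" by (simp add: C_def)
      then have "x ^ r \<notin> nonunits \<beta>" using a.x0 by (simp add: nonunits_def)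
      moreover have "x ^ r = x * x ^ (r - 1)" using r1 by (simp flip: power_Suc)
      then have "x ^ r \<in> nonunits \<beta>" using b.nonunit_mult[OF b.x_nonunit, of "x ^ (r - 1)"] by simp
      ultimately show False by blast
    qed
    then have ne: "C \<beta> \<noteq> \<alpha>" using a.one by blast
    define M where "M i = (if i = 0 then C \<beta> else \<alpha>)" for i :: nat
    have "chain_in \<alpha> (C \<beta>) \<alpha> M 1"
      by (rule chain_inI) (use Cb a.submod_self in \<open>auto simp: M_def\<close>)
    moreover have "steps M 1 = {0}" using ne by (auto simp: steps_def M_def)
    ultimately have 2: "chain_ge \<alpha> (C \<beta>) \<alpha> 1" by (intro hcI[of _ _ _ M 1]) auto
    have "gen_ideal \<alpha> f h \<subseteq> C \<beta>" using JC Cmono[OF Jb] by blast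
    then have "chain_ge \<alpha> (gen_ideal \<alpha> f h) \<alpha> (s + 1)" using chain_ge_concat[OF 1 2] Cb by blast
    then show ?thesis using length_le unfolding length_le_def by blast
  qed
  have "chain_in \<beta> ?J \<beta> (\<lambda>_. \<beta>) 0" by (rule chain_inI) (use Jb b.submod_self in auto)
  then have "chain_ge \<beta> ?J \<beta> 0" by (rule hcI) simp
  then have n1: "n \<ge> 1" using main by fastforce
  have "length_le \<beta> ?J \<beta> (n - 1)" unfolding length_le_def using main by fastforce
  then show ?thesis using fb hb e f0 h0 cp n1 by blast
qed

end

subsection \<open>Base points of a pencil\<close>

text \<open>Infinitely near points are described as the two-dimensional regular local rings
  dominating \<alpha>, without sequences of transforms; the latter enter only through
  \<open>first_step\<close>.\<close>

definition base_points :: "'a::field \<Rightarrow> 'a set \<Rightarrow> 'a set set" where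
  "base_points z \<alpha> = {\<beta>. (\<exists>u w. regular2 \<beta> u w) \<and> dominates \<alpha> \<beta> \<and> z \<notin> \<beta> \<and> inverse z \<notin> \<beta>}"

text \<open>\<open>factor_blowup\<close> puts one of the two quotients into \<beta>, and by
  \<open>no_dvr\<close> \<beta> cannot contain the order valuation ring. So the center of \<beta> on
  that chart is a closed point of the exceptional curve.\<close>

lemma first_step:
  assumes a: "regular2 \<alpha> x y" and b: "regular2 \<beta> u w" and d: "dominates \<alpha> \<beta>" and ne: "\<beta> \<noteq> \<alpha>"
  shows "\<exists>\<gamma>. (is_transform \<alpha> x y \<gamma> \<or> is_transform \<alpha> y x \<gamma>) \<and> dominates \<gamma> \<beta>"
proof -
  interpret a: regular2 \<alpha> x y by (rule a)
  interpret s: regular2 \<alpha> y x by (rule a.swap)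
  interpret b: regular2 \<beta> u w by (rule b)
  have xb: "x \<in> nonunits \<beta>" "y \<in> nonunits \<beta>" using d a.x_nonunit a.y_nonunit by (auto simp: dominates_def)
  have "y / x \<in> \<beta> \<or> x / y \<in> \<beta>" using factor_blowup[OF a b d] ne by blast
  then show ?thesis
  proof
    assume t: "y / x \<in> \<beta>"
    have "\<not> a.Or \<subseteq> \<beta>" using b.no_dvr[OF a.O_dvr _ xb(1)] by blast
    then show ?thesis using a.step[OF b.sring_axioms b.nonunit_add d t] by blast
  next
    assume t: "x / y \<in> \<beta>"
    have "\<not> s.Or \<subseteq> \<beta>" using b.no_dvr[OF s.O_dvr _ xb(2)] by blast
    then show ?thesis using s.step[OF b.sring_axioms b.nonunit_add d t] by blast
  qed
qed

lemma transform_reg: assumes "is_transform \<alpha> x y \<beta>" shows "\<exists>t. regular2 \<beta> x t" "dominates \<alpha> \<beta>" "\<alpha> \<noteq> \<beta>" "regular2 \<alpha> x y"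
proof -
  obtain t g where q: "transform \<alpha> x y \<beta> t g" using assms unfolding is_transform_def by blast
  interpret q: transform \<alpha> x y \<beta> t g by (rule q)
  show "\<exists>t. regular2 \<beta> x t" "dominates \<alpha> \<beta>" "\<alpha> \<noteq> \<beta>" "regular2 \<alpha> x y" using q.b.regular2_axioms q.dominates_ab q.neq q.a.regular2_axioms by blast+
qed

text \<open>Where the value of F is a unit, \<open>h / f\<close> lies in \<beta>, because f has no
  larger exponent of x than h. So indeterminacy persists only at the finitely many transforms over
  zeros of the initial form F.\<close>

lemma (in regular2) chart_aux:
  assumes f: "f \<in> R" "h \<in> R" "h \<noteq> 0" "coprime_in R f h" "length_le R (gen_ideal R f h) R n"
    and F: "f = x ^ r * poly F tau" "F \<in> polys R" "F \<notin> mpolys R" "degree F \<le> r"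
    and G: "h = x ^ s * poly G tau" "G \<in> polys R" and rs: "r \<le> s"
  shows "finite {\<beta>. is_transform R x y \<beta> \<and> f / h \<notin> \<beta> \<and> h / f \<notin> \<beta>}"
    and "is_transform R x y \<beta> \<Longrightarrow> f / h \<notin> \<beta> \<Longrightarrow> h / f \<notin> \<beta> \<Longrightarrow> \<exists>f'\<in>\<beta>. \<exists>h'\<in>\<beta>. f' / h' = f / h \<and> f' \<noteq> 0 \<and> h' \<noteq> 0
      \<and> coprime_in \<beta> f' h' \<and> n \<ge> 1 \<and> length_le \<beta> (gen_ideal \<beta> f' h') \<beta> (n - 1)"
proof -
  have "{\<beta>. is_transform R x y \<beta> \<and> f / h \<notin> \<beta> \<and> h / f \<notin> \<beta>} \<subseteq> {\<beta>. is_transform R x y \<beta> \<and> poly F tau \<in> nonunits \<beta>}"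
  proof
    fix \<beta> assume b: "\<beta> \<in> {\<beta>. is_transform R x y \<beta> \<and> f / h \<notin> \<beta> \<and> h / f \<notin> \<beta>}"
    then obtain t g where q: "transform R x y \<beta> t g" unfolding is_transform_def by blast
    interpret q: transform R x y \<beta> t g by (rule q)
    have "poly F tau \<in> nonunits \<beta>"
    proof (rule ccontr)
      assume "poly F tau \<notin> nonunits \<beta>"
      then have "inverse (poly F tau) \<in> \<beta>" using q.b.unitD q.polys_in[OF F(2)] by blast
      then have "x ^ (s - r) * poly G tau * inverse (poly F tau) \<in> \<beta>" using q.polys_in[OF G(2)] by simp
      moreover have "x ^ s = x ^ r * x ^ (s - r)" using rs by (simp flip: power_add)
      then have "h / f = x ^ (s - r) * poly G tau * inverse (poly F tau)" unfolding F(1) G(1) using nz[OF F(2,3)] by (simp add: field_simps)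
      ultimately show False using b by simp
    qed
    then show "\<beta> \<in> {\<beta>. is_transform R x y \<beta> \<and> poly F tau \<in> nonunits \<beta>}" using b by blast
  qed
  then show "finite {\<beta>. is_transform R x y \<beta> \<and> f / h \<notin> \<beta> \<and> h / f \<notin> \<beta>}" using finite_points[OF F(2,3)] finite_subset by blast
  assume b: "is_transform R x y \<beta>" "f / h \<notin> \<beta>" "h / f \<notin> \<beta>"
  then obtain t g where q: "transform R x y \<beta> t g" unfolding is_transform_def by blast
  show "\<exists>f'\<in>\<beta>. \<exists>h'\<in>\<beta>. f' / h' = f / h \<and> f' \<noteq> 0 \<and> h' \<noteq> 0
      \<and> coprime_in \<beta> f' h' \<and> n \<ge> 1 \<and> length_le \<beta> (gen_ideal \<beta> f' h') \<beta> (n - 1)"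
    by (rule transform.noether_drop[OF q f(1) F f(2) G f(3) rs f(4) b(2,3) f(5)])
qed

text \<open>The alternative \<open>inverse z\<close> lets numerator and denominator be exchanged
  according to their orders; the set of base points is unaffected by this.\<close>

definition drops :: "'a::field set \<Rightarrow> 'a \<Rightarrow> nat \<Rightarrow> bool" where
  "drops \<beta> z n \<longleftrightarrow> (\<exists>f'\<in>\<beta>. \<exists>h'\<in>\<beta>. (f' / h' = z \<or> f' / h' = inverse z) \<and> f' \<noteq> 0 \<and> h' \<noteq> 0
      \<and> coprime_in \<beta> f' h' \<and> n \<ge> 1 \<and> length_le \<beta> (gen_ideal \<beta> f' h') \<beta> (n - 1))"

lemma finite_chart:
  assumes a: "regular2 \<alpha> x y" and f: "f \<in> \<alpha>" "h \<in> \<alpha>" "f \<noteq> 0" "h \<noteq> 0" "coprime_in \<alpha> f h" and length_le: "length_le \<alpha> (gen_ideal \<alpha> f h) \<alpha> n"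
  shows "finite {\<beta>. is_transform \<alpha> x y \<beta> \<and> f / h \<notin> \<beta> \<and> h / f \<notin> \<beta>}"
    and "is_transform \<alpha> x y \<beta> \<Longrightarrow> f / h \<notin> \<beta> \<Longrightarrow> h / f \<notin> \<beta> \<Longrightarrow> drops \<beta> (f / h) n"
proof -
  interpret a: regular2 \<alpha> x y by (rule a)
  obtain r F where F: "F \<in> polys \<alpha>" "F \<notin> mpolys \<alpha>" "degree F \<le> r" "f = x ^ r * poly F (y/x)" using a.ord_ex[OF f(1,3)] by blast
  obtain s G where G: "G \<in> polys \<alpha>" "G \<notin> mpolys \<alpha>" "degree G \<le> s" "h = x ^ s * poly G (y/x)" using a.ord_ex[OF f(2,4)] by blast
  have cop': "coprime_in \<alpha> h f" using f(5) a.coprime_commute by blast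
  have bd': "length_le \<alpha> (gen_ideal \<alpha> h f) \<alpha> n" using length_le gen_ideal_commute[of \<alpha> f h] by simp
  note 1 = a.chart_aux[OF f(1,2,4,5) length_le F(4,1,2,3) G(4,1)]
  note 2 = a.chart_aux[OF f(2,1,3) cop' bd' G(4,1,2,3) F(4,1)]
  have "finite {\<beta>. is_transform \<alpha> x y \<beta> \<and> f / h \<notin> \<beta> \<and> h / f \<notin> \<beta>} \<and>
    (is_transform \<alpha> x y \<beta> \<longrightarrow> f / h \<notin> \<beta> \<longrightarrow> h / f \<notin> \<beta> \<longrightarrow> drops \<beta> (f / h) n)"
  proof (cases "r \<le> s")
    case True
    show ?thesis using 1(1)[OF True] 1(2)[OF True, of \<beta>] unfolding drops_def by blast
  next
    case False
    then have sr: "s \<le> r" by simp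
    have "{\<beta>. is_transform \<alpha> x y \<beta> \<and> h / f \<notin> \<beta> \<and> f / h \<notin> \<beta>} = {\<beta>. is_transform \<alpha> x y \<beta> \<and> f / h \<notin> \<beta> \<and> h / f \<notin> \<beta>}" by blast
    moreover have "inverse (f / h) = h / f" by (rule inverse_divide)
    ultimately show ?thesis using 2(1)[OF sr] 2(2)[OF sr, of \<beta>] unfolding drops_def by auto
  qed
  then show "finite {\<beta>. is_transform \<alpha> x y \<beta> \<and> f / h \<notin> \<beta> \<and> h / f \<notin> \<beta>}"
    "is_transform \<alpha> x y \<beta> \<Longrightarrow> f / h \<notin> \<beta> \<Longrightarrow> h / f \<notin> \<beta> \<Longrightarrow> drops \<beta> (f / h) n" by blast+
qed

lemma base_points_inverse: "base_points (inverse z) \<alpha> = base_points z \<alpha>"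
  unfolding base_points_def by auto

text \<open>Induction on the bound n for the colength. A base point other than \<alpha> dominates an
  indeterminate transform in one of the two charts; there are finitely many of these, and each has a
  smaller bound.\<close>

lemma base_points_finite_aux:
  assumes "regular2 \<alpha> x y" "f \<in> \<alpha>" "h \<in> \<alpha>" "f \<noteq> 0" "h \<noteq> 0" "coprime_in \<alpha> f h" "length_le \<alpha> (gen_ideal \<alpha> f h) \<alpha> n"
  shows "finite (base_points (f / h) \<alpha>)"
  using assms
proof (induction n arbitrary: \<alpha> x y f h rule: less_induct)
  case (less n)
  interpret a: regular2 \<alpha> x y by (rule less.prems(1))
  let ?B1 = "{\<beta>. is_transform \<alpha> x y \<beta> \<and> f / h \<notin> \<beta> \<and> h / f \<notin> \<beta>}"
  let ?B2 = "{\<beta>. is_transform \<alpha> y x \<beta> \<and> f / h \<notin> \<beta> \<and> h / f \<notin> \<beta>}"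
  note c1 = finite_chart[OF less.prems] and c2 = finite_chart[OF a.swap less.prems(2-)]
  have hf: "inverse (f / h) = h / f" by (rule inverse_divide)
  have sub: "base_points (f / h) \<alpha> \<subseteq> {\<alpha>} \<union> (\<Union>\<gamma>\<in>?B1 \<union> ?B2. base_points (f / h) \<gamma>)"
  proof
    fix \<beta> assume "\<beta> \<in> base_points (f / h) \<alpha>"
    then obtain u w where b: "regular2 \<beta> u w" "dominates \<alpha> \<beta>" "f / h \<notin> \<beta>" "h / f \<notin> \<beta>" unfolding base_points_def hf by blast
    show "\<beta> \<in> {\<alpha>} \<union> (\<Union>\<gamma>\<in>?B1 \<union> ?B2. base_points (f / h) \<gamma>)"
    proof (cases "\<beta> = \<alpha>")
      case False
      obtain \<gamma> where g: "is_transform \<alpha> x y \<gamma> \<or> is_transform \<alpha> y x \<gamma>" "dominates \<gamma> \<beta>" using first_step[OF less.prems(1) b(1,2) False] by blast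
      have "f / h \<notin> \<gamma>" "h / f \<notin> \<gamma>" using g(2) b(3,4) unfolding dominates_def by blast+
      then have "\<gamma> \<in> ?B1 \<union> ?B2" using g(1) by blast
      moreover have "\<beta> \<in> base_points (f / h) \<gamma>" unfolding base_points_def hf using b g by blast
      ultimately show ?thesis by blast
    qed simp
  qed
  have fin: "finite (base_points (f / h) \<gamma>)" if g: "\<gamma> \<in> ?B1 \<union> ?B2" for \<gamma>
  proof -
    have "drops \<gamma> (f / h) n" using g c1(2) c2(2) by blast
    then obtain f' h' where d: "f' \<in> \<gamma>" "h' \<in> \<gamma>" "f' / h' = f / h \<or> f' / h' = inverse (f / h)" "f' \<noteq> 0" "h' \<noteq> 0"
      "coprime_in \<gamma> f' h'" "n \<ge> 1" "length_le \<gamma> (gen_ideal \<gamma> f' h') \<gamma> (n - 1)" unfolding drops_def by blast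
    obtain u w where "regular2 \<gamma> u w" using g transform_reg(1) by blast
    then have "finite (base_points (f' / h') \<gamma>)" using less.IH[of "n - 1" \<gamma> u w f' h'] d by simp
    then show ?thesis using d(3) base_points_inverse by metis
  qed
  have "finite (?B1 \<union> ?B2)" using c1(1) c2(1) by simp
  then have "finite ({\<alpha>} \<union> (\<Union>\<gamma>\<in>?B1 \<union> ?B2. base_points (f / h) \<gamma>))" using fin by blast
  then show ?case using sub finite_subset by blast
qed

lemma base_points_finite: assumes "regular2 \<alpha> x y" shows "finite (base_points z \<alpha>)"
proof -
  interpret a: regular2 \<alpha> x y by (rule assms)
  obtain f h where f: "f \<in> \<alpha>" "h \<in> \<alpha>" "h \<noteq> 0" "z = f / h" "coprime_in \<alpha> f h" using a.ex_coprime by blast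
  show ?thesis
  proof (cases "f = 0")
    case True
    have "\<beta> \<notin> base_points z \<alpha>" for \<beta>
    proof
      assume "\<beta> \<in> base_points z \<alpha>"
      then have "\<alpha> \<subseteq> \<beta>" "z \<notin> \<beta>" unfolding base_points_def dominates_def by blast+
      moreover have "z \<in> \<alpha>" using f(4) True by simp
      ultimately show False by blast
    qed
    then have "base_points z \<alpha> = {}" by blast
    then show ?thesis by simp
  next
    case False
    obtain n where "length_le \<alpha> (gen_ideal \<alpha> f h) \<alpha> n" using a.length_cop[OF f(1,2,5)] by blast
    then show ?thesis using base_points_finite_aux[OF assms f(1,2) False f(3,5)] f(4) by simp
  qed
qed

subsection \<open>Intersections of prime divisors\<close>

text \<open>A prime element of \<beta> is associated to x, which defines the exceptional curve, or
  contracts to a height-one prime of \<alpha>. In both cases one discrete valuation ring contains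
  the other, and maximality gives equality. So the order valuation is the only new localization that
  a transform can bring in.\<close>

lemma (in transform) localization_prime:
  assumes p: "prime_in \<beta> p"
  shows "localization \<beta> p = a.Or \<or> (\<exists>q. prime_in \<alpha> q \<and> localization \<beta> p = localization \<alpha> q)"
proof -
  note pp = b.prmD[OF p]
  interpret T: dvr "localization \<beta> p" p by (rule b.localization_dvr[OF p])
  have bT: "\<beta> \<subseteq> localization \<beta> p" by (rule b.localization_dvr[OF p])
  have locI: "c / d \<in> localization \<beta> p" if "c \<in> \<beta>" "d \<in> \<beta>" "d / p \<notin> \<beta>" for c d using that unfolding localization_def by blast
  have ninv: "inverse z \<notin> localization \<beta> p" if z: "z / p \<in> \<beta>" "z \<noteq> 0" for z
  proof
    assume "inverse z \<in> localization \<beta> p"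
    then have "z / p * inverse z \<in> localization \<beta> p" using bT z(1) by (intro T.mult) auto
    moreover have "z / p * inverse z = inverse p" using z(2) by (simp add: field_simps)
    ultimately show False using T.tn by simp
  qed
  show ?thesis
  proof (cases "x / p \<in> \<beta>")
    case True
    have px: "p / x \<in> \<beta>" by (rule b.prime_assoc[OF b.px p True])
    have "a.Or \<subseteq> localization \<beta> p"
    proof
      fix z assume "z \<in> a.Or"
      then obtain P Q where z: "z = poly P (y/x) / poly Q (y/x)" "P \<in> polys \<alpha>" "Q \<in> polys \<alpha>" "Q \<notin> mpolys \<alpha>" by (rule a.O_repr)
      have "poly Q (y/x) / p \<notin> \<beta>"
      proof
        assume "poly Q (y/x) / p \<in> \<beta>"
        then have "poly Q (y/x) / x \<in> \<beta>" using b.div_trans[OF px] pp(3) by blast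
        then show False using x_div[OF z(3)] z(4) by blast
      qed
      then show "z \<in> localization \<beta> p" unfolding z(1) by (rule locI[OF polys_in[OF z(2)] polys_in[OF z(3)]])
    qed
    then have "localization \<beta> p = a.Or" using a.V.maximal[OF T.sub _ ninv[OF True a.x0]] by blast
    then show ?thesis ..
  next
    case False
    obtain P Q where P: "p = poly P (y/x) / poly Q (y/x)" "P \<in> polys \<alpha>" "Q \<in> polys \<alpha>" "poly Q (y/x) \<noteq> 0"
      using reprE[OF pp(2)] by metis
    \<comment> \<open>A power of x and the denominator of p clear p into \<alpha>, so the
      contraction of p\<beta> is not zero.\<close>
    define f where "f = x ^ degree P * poly P (y/x)"
    have fp: "f = x ^ degree P * poly Q (y/x) * p" unfolding f_def P(1) using P(4) by simp
    have "f \<in> \<alpha>" unfolding f_def by (rule a.homog) (use P in simp_all)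
    moreover have "f \<noteq> 0" unfolding fp using P(4) pp(3) by simp
    moreover have "f / p \<in> \<beta>" unfolding fp using polys_in[OF P(3)] pp(3) by simp
    ultimately obtain q where q: "prime_in \<alpha> q" "{c \<in> \<alpha>. c / p \<in> \<beta>} = {q * r | r. r \<in> \<alpha>}" using contract_prime[OF p False] by blast
    note qq = a.prmD[OF q(1)]
    interpret L: dvr "localization \<alpha> q" q by (rule a.localization_dvr[OF q(1)])
    have "localization \<alpha> q \<subseteq> localization \<beta> p"
    proof
      fix z assume "z \<in> localization \<alpha> q"
      then obtain c d where z: "z = c / d" "c \<in> \<alpha>" "d \<in> \<alpha>" "d / q \<notin> \<alpha>" unfolding localization_def by blast
      have "d \<notin> {q * r | r. r \<in> \<alpha>}" using z(4) a.dvd_set[OF qq(3)] by blast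
      then have "d / p \<notin> \<beta>" using q(2) z(3) by blast
      then show "z \<in> localization \<beta> p" unfolding z(1) using z(2,3) sub by (intro locI) auto
    qed
    moreover have "q * 1 \<in> {q * r | r. r \<in> \<alpha>}" using a.one by blast
    then have "q \<in> {c \<in> \<alpha>. c / p \<in> \<beta>}" unfolding q(2) by simp
    then have "inverse q \<notin> localization \<beta> p" using ninv qq(3) by blast
    ultimately have "localization \<beta> p = localization \<alpha> q" using L.maximal[OF T.sub] by blast
    then show ?thesis using q(1) by blast
  qed
qed

fun tower :: "'a::field set \<Rightarrow> 'a set \<Rightarrow> 'a \<Rightarrow> 'a \<Rightarrow> nat \<Rightarrow> 'a set" where
  "tower N A u z 0 = N"
| "tower N A u z (Suc k) = ssum (tower N A u z k) ((\<lambda>c. c * (u * z ^ k)) ` A)"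

text \<open>Each layer is an image of A modulo A0 and costs at most n, so the bound is linear in the
  number of layers. This linear growth is what the Krull--Akizuki count relies on.\<close>

lemma (in sring) tower_bd:
  assumes N: "submod R N" and A: "submod R A" and A0: "submod R A0" "A0 \<subseteq> A" and length_le: "length_le R A0 A n"
    and w: "\<And>c k. c \<in> A0 \<Longrightarrow> c * (u * z ^ k) \<in> N"
  shows "submod R (tower N A u z k)" "N \<subseteq> tower N A u z k" "length_le R N (tower N A u z k) (k * n)"
proof -
  have "submod R (tower N A u z k) \<and> N \<subseteq> tower N A u z k \<and> length_le R N (tower N A u z k) (k * n)"
  proof (induction k)
    case 0 then show ?case using N length_refl by simp
  next
    case (Suc k)
    let ?L = "tower N A u z k"
    let ?B = "(\<lambda>c. c * (u * z ^ k)) ` A"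
    have Bs: "submod R ?B" by (rule submod_image_right[OF A])
    have 1: "length_le R ?L (ssum ?L ?B) n"
      by (rule length_line[OF _ A A0 length_le]) (use Suc w in blast)+
    have sm: "submod R (ssum ?L ?B)" using Suc Bs by (intro ssum_submod) blast+
    have up: "?L \<subseteq> ssum ?L ?B" by (rule ssum_sup1[OF Bs])
    have "length_le R N (ssum ?L ?B) (k * n + n)" using Suc sm up by (intro length_add[OF _ 1]) blast+
    then show ?case using Suc sm up by (simp add: add.commute) blast
  qed
  then show "submod R (tower N A u z k)" "N \<subseteq> tower N A u z k" "length_le R N (tower N A u z k) (k * n)" by blast+
qed

lemma tower_mem:
  assumes N: "0 \<in> N" and m: "m \<in> N" and p: "p \<in> polys A" "\<And>i. i \<ge> k \<Longrightarrow> coeff p i = 0"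
  shows "m + u * poly p z \<in> tower N A u z k"
  using p
proof (induction k arbitrary: p)
  case 0
  then have "p = 0" by (intro poly_eqI) simp
  then show ?case using m by simp
next
  case (Suc k)
  define c where "c = coeff p k"
  define q where "q = p - monom c k"
  have cA: "c \<in> A" using Suc(2) by (simp add: polys_def c_def)
  have q0: "coeff q i = (if i = k then 0 else coeff p i)" for i by (simp add: q_def c_def)
  have "0 \<in> A" using Suc(2) Suc(3)[of "Suc k"] by (auto simp: polys_def) (metis order_refl)
  then have "q \<in> polys A" using Suc(2) by (simp add: polys_def q0)
  moreover have "coeff q i = 0" if "i \<ge> k" for i using that Suc(3)[of i] by (auto simp: q0)
  ultimately have "m + u * poly q z \<in> tower N A u z k" by (rule Suc.IH)
  moreover have "m + u * poly p z = (m + u * poly q z) + c * (u * z ^ k)" by (simp add: q_def poly_monom algebra_simps)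
  ultimately show ?case using cA unfolding tower.simps ssum_iff by blast
qed

text \<open>Modulo its nonunits \<beta> is spanned over \<alpha> by the powers of
  \<open>y / x\<close> below the degree of g. Measuring over the fixed ring D lets the bound be
  passed from one transform to the next.\<close>

lemma (in transform) residue_bd:
  assumes D: "sring D" "D \<subseteq> \<alpha>" and length_le: "length_le D (nonunits \<alpha>) \<alpha> n"
  shows "\<exists>k. length_le D (nonunits \<beta>) \<beta> k"
proof -
  interpret D: sring D by (rule D(1))
  have sm: "submod D \<alpha>" "submod D (nonunits \<alpha>)" "submod D (nonunits \<beta>)"
    using submod_mono[OF a.submod_self D(2)] submod_mono[OF a.nonunit_submod D(2)] submod_mono[OF b.nonunit_submod] D(2) sub by blast+
  have w: "c * (1 * (y/x) ^ k) \<in> nonunits \<beta>" if "c \<in> nonunits \<alpha>" for c k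
    using that nonunit_sub tau_in by (intro b.nonunit_mult) auto
  have nn: "nonunits \<alpha> \<subseteq> \<alpha>" using a.nonunitD by blast
  note t = D.tower_bd[OF sm(3,1,2) nn length_le w, where k = "degree g"]
  have "\<beta> \<subseteq> tower (nonunits \<beta>) \<alpha> 1 (y/x) (degree g)"
  proof
    fix z assume "z \<in> \<beta>"
    then obtain e where e: "e \<in> polys \<alpha>" "degree e < degree g" "z - poly e (y/x) \<in> nonunits \<beta>" using residue_repr by blast
    have "(z - poly e (y/x)) + 1 * poly e (y/x) \<in> tower (nonunits \<beta>) \<alpha> 1 (y/x) (degree g)"
      by (rule tower_mem[OF b.nonunit0 e(3,1)]) (use e(2) in \<open>simp add: coeff_eq_0\<close>)
    then show "z \<in> tower (nonunits \<beta>) \<alpha> 1 (y/x) (degree g)" by simp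
  qed
  then show ?thesis using length_mono[OF t(3) order_refl _ order_refl] by blast
qed

text \<open>A Krull--Akizuki argument by counting: the powers of \<open>h\<close> produce chains in the residue field
  whose length grows like \<open>n\<close> times the length of \<open>A/(P + hA)\<close>, while the ambient space of rational
  functions of bounded degree grows linearly in \<open>n\<close> with slope independent of \<open>A\<close>.\<close>
lemma (in regular2) krull_akizuki:
  assumes D: "sring D" "D \<subseteq> R" and length_le: "length_le D (nonunits R) R l"
    and A: "sring A" "D \<subseteq> A" "A \<subseteq> Or" and h: "h \<in> A" "h \<notin> nonunits Or"
  shows "\<exists>n. length_le D (ssum (A \<inter> nonunits Or) ((*) h ` A)) A n"
proof -
  interpret D: sring D by (rule D(1))
  interpret A: sring A by (rule A(1))
  let ?P = "A \<inter> nonunits Or" and ?m = "nonunits Or"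
  have hO: "h \<in> Or" using h A by blast
  from hO obtain H G where HG: "h = poly H tau / poly G tau" "H \<in> polys R" "G \<in> polys R" "G \<notin> mpolys R" by (rule O_repr)
  have G0: "poly G tau \<noteq> 0" by (rule nz[OF HG(3,4)])
  define d where "d = max (degree H) (degree G)"
  have mO: "submod Or ?m"
  proof (rule submodI)
    show "a + b \<in> ?m" if "a \<in> ?m" "b \<in> ?m" for a b
    proof -
      have "a / x \<in> Or" "b / x \<in> Or" using that V.nonunit_iff V.div_iff[of x] V.v_t by auto
      then have "(a + b) / x \<in> Or" by (rule V.div_add)
      then show ?thesis using V.nonunit_iff V.div_iff[of x] V.v_t by auto
    qed
  qed (use V.nonunit_mult2 in auto)
  have smm: "submod D ?m" by (rule submod_mono[OF mO]) (use D A in blast)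
  have smR: "submod D R" "submod D (nonunits R)" using submod_mono[OF submod_self D(2)] submod_mono[OF nonunit_submod D(2)] .
  have nR: "nonunits R \<subseteq> R" using nonunitD by blast
  have "card (steps K k) \<le> d * l" if ch: "chain_in D (ssum ?P ((*) h ` A)) A K k" for K k
  proof -
    note K = chain_inD[OF ch]
    let ?S = "steps K k"
    define s where "s = card ?S"
    have "\<exists>e. e \<in> K (Suc i) \<and> e \<notin> K i" if "i \<in> ?S" for i using that K(4)[of i] by (auto simp: steps_def)
    then obtain e where e: "\<And>i. i \<in> ?S \<Longrightarrow> e i \<in> K (Suc i)" "\<And>i. i \<in> ?S \<Longrightarrow> e i \<notin> K i" by metis
    have iS: "i < k" if "i \<in> ?S" for i using that by (simp add: steps_def)
    have eA: "e i \<in> A" if "i \<in> ?S" for i using e(1)[OF that] K(3)[of "Suc i"] iS[OF that] by auto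
    have "\<exists>p q. e i = poly p tau / poly q tau \<and> p \<in> polys R \<and> q \<in> polys R \<and> q \<notin> mpolys R" if "i \<in> ?S" for i
      using eA[OF that] A(3) unfolding order_ring_def by blast
    then obtain p q where pq: "\<And>i. i \<in> ?S \<Longrightarrow> e i = poly (p i) tau / poly (q i) tau" "\<And>i. i \<in> ?S \<Longrightarrow> p i \<in> polys R"
      "\<And>i. i \<in> ?S \<Longrightarrow> q i \<in> polys R" "\<And>i. i \<in> ?S \<Longrightarrow> q i \<notin> mpolys R" by metis
    \<comment> \<open>The finitely many elements \<open>e i\<close>, one new element for each proper
      step, are put over the common denominator Q; c will exceed the degrees of their
      numerators.\<close>
    define Q where "Q = (\<Prod>i\<in>?S. q i)"
    have QR: "Q \<in> polys R" unfolding Q_def using pq(3) by (rule polys_prod)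
    have Qm: "Q \<notin> mpolys R" unfolding Q_def using gauss_prod[OF steps_fin] pq(3,4) by blast
    define E where "E i = p i * (\<Prod>j\<in>?S - {i}. q j)" for i
    have ER: "E i \<in> polys R" if "i \<in> ?S" for i unfolding E_def using pq(2,3) that by (intro polys_mult polys_prod) auto
    have Ee: "e i = poly (E i) tau / poly Q tau" if i: "i \<in> ?S" for i
    proof -
      have Qi: "Q = q i * (\<Prod>j\<in>?S - {i}. q j)" unfolding Q_def by (rule prod.remove[OF steps_fin i])
      have "poly Q tau \<noteq> 0" by (rule nz[OF QR Qm])
      then have "poly (q i) tau \<noteq> 0" "poly (\<Prod>j\<in>?S - {i}. q j) tau \<noteq> 0" unfolding Qi by auto
      then show ?thesis unfolding pq(1)[OF i] Qi E_def by simp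
    qed
    define c where "c = Suc (Max (insert 0 ((\<lambda>i. degree (E i)) ` ?S)))"
    have degE: "degree (E i) < c" if "i \<in> ?S" for i
    proof -
      have "degree (E i) \<le> Max (insert 0 ((\<lambda>i. degree (E i)) ` ?S))" by (rule Max_ge) (use steps_fin that in auto)
      then show ?thesis by (simp add: c_def)
    qed
    \<comment> \<open>Over the denominator \<open>Q * G ^ N\<close> all products
      \<open>e i * h ^ j\<close> with \<open>j < N\<close> have numerators of degree below
      \<open>c + N * d\<close>, which bounds the ambient length by \<open>(c + N * d) * l\<close>.
      The choice of N makes the constant part \<open>c * l\<close> smaller than N, so that it
      disappears on division by N.\<close>
    define N where "N = c * l + 1"
    define u where "u = inverse (poly (Q * G ^ N) tau)"
    have QG: "Q * G ^ N \<in> polys R" "Q * G ^ N \<notin> mpolys R" 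
      using QR HG(3) gauss[OF QR polys_power[OF HG(3)], of N] Qm gauss_power[OF HG(3,4), of N] by auto
    have uO: "u \<in> Or" "u \<noteq> 0" using O_unit[OF QG] by (auto simp: u_def)
    have tO: "tau \<in> Or" using E_O adjoin_gen by blast
    have w: "b * (u * tau ^ j) \<in> ?m" if "b \<in> nonunits R" for b j
      using nonunit_O[OF that] uO tO by (intro V.nonunit_mult) auto
    define M where "M = tower ?m R u tau (c + N * d)"
    note t = D.tower_bd[OF smm smR nR length_le w, where k = "c + N * d", folded M_def]
    have memM: "e i * h ^ j \<in> M" if i: "i \<in> ?S" and j: "j < N" for i j
    proof -
      define F where "F = E i * H ^ j * G ^ (N - j)"
      have "F \<in> polys R" unfolding F_def using ER[OF i] HG by simp
      moreover have "degree F < c + N * d"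
      proof -
        have "degree F \<le> degree (E i) + degree (H ^ j) + degree (G ^ (N - j))"
          unfolding F_def by (intro order_trans[OF degree_mult_le] add_mono degree_mult_le order_refl)
        also have "degree (H ^ j) \<le> j * d" by (rule order_trans[OF degree_power_le]) (simp add: d_def mult.commute)
        also have "degree (G ^ (N - j)) \<le> (N - j) * d" by (rule order_trans[OF degree_power_le]) (simp add: d_def mult.commute)
        finally have "degree F \<le> degree (E i) + (j * d + (N - j) * d)" by simp
        also have "j * d + (N - j) * d = N * d" using j by (simp flip: add_mult_distrib)
        finally show ?thesis using degE[OF i] by simp
      qed
      then have "coeff F i' = 0" if "i' \<ge> c + N * d" for i' using that by (simp add: coeff_eq_0)
      ultimately have "0 + u * poly F tau \<in> M" unfolding M_def by (intro tower_mem V.nonunit0)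
      moreover have "u * poly F tau = e i * h ^ j"
      proof -
        have "poly G tau ^ N = poly G tau ^ j * poly G tau ^ (N - j)" using j by (simp flip: power_add)
        then show ?thesis unfolding u_def F_def Ee[OF i] HG(1) using G0 nz[OF QR Qm] by (simp add: power_divide field_simps)
      qed
      ultimately show ?thesis by simp
    qed
    \<comment> \<open>Row j is the given chain multiplied by \<open>h ^ j\<close>, taken modulo the
      nonunits of \<open>Or\<close> and cut down to M. As h is a unit of \<open>Or\<close>, all s
      steps of a row stay proper; since hA lies in \<open>K 0\<close>, row \<open>Suc j\<close> fits
      below row j. The N rows together have \<open>N * s\<close> steps.\<close>
    define T where "T j i = ssum ((*) (h ^ j) ` K i) ?m \<inter> M" for j i
    have Tsm: "submod D (T j i)" if "i \<le> k" for j i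
      unfolding T_def by (intro submod_Int ssum_submod submod_smult K(1)[OF that] smm t(1))
    have mT: "?m \<subseteq> T j i" if "i \<le> k" for j i unfolding T_def using ssum_sup2[OF submod_smult[OF K(1)[OF that]]] t(2) by blast
    have hA: "h ^ j \<in> A" for j using h by simp
    have hu: "h ^ j \<notin> ?m" for j using V.nonunit_pow[OF hO] h(2) by blast
    have rung: "chain_ge D (T j 0) (T j k) s" if j: "j < N" for j
    proof (rule hcI)
      show "chain_in D (T j 0) (T j k) (T j) k"
      proof (rule chain_inI)
        fix i assume i: "i \<le> k"
        show "submod D (T j i)" by (rule Tsm[OF i])
        have "K 0 \<subseteq> K i" "K i \<subseteq> K k" using chain_in_mono_le[OF ch] i by simp_all
        then show "T j 0 \<subseteq> T j i" "T j i \<subseteq> T j k" unfolding T_def using ssum_mono[OF image_mono order_refl] by blast+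
      next
        fix i assume "i < k"
        then show "T j i \<subseteq> T j (Suc i)" unfolding T_def using ssum_mono[OF image_mono[OF K(4)] order_refl] by blast
      qed
      have "?S \<subseteq> steps (T j) k"
      proof
        fix i assume i: "i \<in> ?S"
        have "h ^ j * e i \<in> (*) (h ^ j) ` K (Suc i)" using e(1)[OF i] by blast
        then have "h ^ j * e i \<in> ssum ((*) (h ^ j) ` K (Suc i)) ?m" by (rule subsetD[OF ssum_sup1[OF smm]])
        then have in1: "h ^ j * e i \<in> T j (Suc i)" unfolding T_def using memM[OF i j] by (simp add: mult.commute)
        have "h ^ j * e i \<notin> T j i"
        proof
          assume "h ^ j * e i \<in> T j i"
          then obtain a n where an: "h ^ j * e i = h ^ j * a + n" "a \<in> K i" "n \<in> ?m" unfolding T_def ssum_def by blast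
          have aA: "a \<in> A" using an(2) K(3)[of i] iS[OF i] by auto
          have "h ^ j * (e i - a) = n" using an(1) by (simp add: algebra_simps)
          then have "h ^ j * (e i - a) \<in> ?m" using an(3) by simp
          moreover have "e i - a \<in> A" using eA[OF i] aA by simp
          ultimately have "e i - a \<in> ?P" using V.nonunit_prime[of "h ^ j" "e i - a"] hu hA A(3) by blast
          moreover have "?P \<subseteq> K i"
          proof -
            have "?P \<subseteq> ssum ?P ((*) h ` A)" by (rule ssum_sup1[OF submod_smult[OF submod_mono[OF A.submod_self A(2)]]])
            then show ?thesis using K(2)[of i] iS[OF i] by auto
          qed
          ultimately have "(e i - a) + a \<in> K i" using submodD(2)[OF K(1)[of i]] an(2) iS[OF i] by (meson less_imp_le subsetD)
          then show False using e(2)[OF i] by simp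
        qed
        then show "i \<in> steps (T j) k" using in1 iS[OF i] by (auto simp: steps_def)
      qed
      then show "s \<le> card (steps (T j) k)" unfolding s_def by (rule card_mono[OF steps_fin])
    qed
    have down: "T (Suc j) k \<subseteq> T j 0" for j
    proof -
      have smP: "submod D ?P" by (rule submod_Int[OF submod_mono[OF A.submod_self A(2)] smm])
      have "(*) (h ^ Suc j) ` K k \<subseteq> (*) (h ^ j) ` K 0"
      proof (rule image_subsetI)
        fix a assume "a \<in> K k"
        then have "a \<in> A" using K(3)[of k] by auto
        then have "h * a \<in> ssum ?P ((*) h ` A)" using subsetD[OF ssum_sup2[OF smP], of "h * a" "(*) h ` A"] by blast
        then have "h * a \<in> K 0" using K(2)[of 0] by auto
        moreover have "h ^ Suc j * a = h ^ j * (h * a)" by simp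
        ultimately show "h ^ Suc j * a \<in> (*) (h ^ j) ` K 0" by blast
      qed
      then show ?thesis unfolding T_def using ssum_mono[OF _ order_refl] by blast
    qed
    have T0: "T j 0 \<subseteq> T j k" for j
      unfolding T_def using ssum_mono[OF image_mono[OF chain_in_mono_le[OF ch]] order_refl, of 0 k] by blast
    have ladder: "chain_ge D (T j 0) (T 0 k) (Suc j * s) \<and> T j 0 \<subseteq> T 0 k" if "j < N" for j
      using that
    proof (induction j)
      case 0 then show ?case using rung[of 0] T0 by simp
    next
      case (Suc j)
      have IH: "chain_ge D (T j 0) (T 0 k) (Suc j * s)" "T j 0 \<subseteq> T 0 k" using Suc by auto
      have 1: "chain_ge D (T (Suc j) k) (T 0 k) (Suc j * s)" by (rule chain_ge_mono[OF IH(1) down order_refl order_refl])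
      have 2: "T (Suc j) k \<subseteq> T 0 k" by (rule order_trans[OF down IH(2)])
      have "chain_ge D (T (Suc j) 0) (T 0 k) (s + Suc j * s)" by (rule chain_ge_concat[OF rung[OF Suc(2)] 1 T0 2])
      moreover have "T (Suc j) 0 \<subseteq> T 0 k" by (rule order_trans[OF T0 2])
      ultimately show ?case by simp
    qed
    have "chain_ge D (T (N - 1) 0) (T 0 k) (N * s)" using ladder[of "N - 1"] by (simp add: N_def)
    then have "chain_ge D ?m M (N * s)" by (rule chain_ge_mono) (use mT[of 0] in \<open>auto simp: T_def\<close>)
    then have "N * s \<le> (c + N * d) * l" using t(3) unfolding length_le_def by blast
    also have "\<dots> < N + N * (d * l)" by (simp add: N_def algebra_simps)
    finally have "N * s < N * (1 + d * l)" by simp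
    then have "s < 1 + d * l" by (simp only: mult_less_cancel1)
    then show ?thesis by (simp add: s_def)
  qed
  then show ?thesis using bdI by blast
qed

section \<open>Noetherian quotients of submodules\<close>

definition noeth_between :: "'a::field set \<Rightarrow> 'a set \<Rightarrow> 'a set \<Rightarrow> bool" where
  "noeth_between A N M \<longleftrightarrow> (\<forall>K :: nat \<Rightarrow> 'a set. (\<forall>i. submod A (K i) \<and> N \<subseteq> K i \<and> K i \<subseteq> M) \<and> (\<forall>i. K i \<subseteq> K (Suc i)) \<longrightarrow> (\<exists>m. \<forall>i\<ge>m. K i = K m))"

lemma nmodI: "(\<And>K :: nat \<Rightarrow> 'a::field set. (\<And>i. submod A (K i)) \<Longrightarrow> (\<And>i. N \<subseteq> K i) \<Longrightarrow> (\<And>i. K i \<subseteq> M) \<Longrightarrow> (\<And>i j. i \<le> j \<Longrightarrow> K i \<subseteq> K j) \<Longrightarrow> \<exists>m. \<forall>i\<ge>m. K i = K m) \<Longrightarrow> noeth_between A N M"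
  unfolding noeth_between_def using lift_Suc_mono_le by metis

lemma nmodD:
  assumes "noeth_between A N M" "\<And>i. submod A (K i)" "\<And>i. N \<subseteq> K i" "\<And>i. K i \<subseteq> M" "\<And>i j. i \<le> j \<Longrightarrow> K i \<subseteq> K j"
  shows "\<exists>m. \<forall>i\<ge>m. K i = K (m :: nat)"
proof -
  have "K i \<subseteq> K (Suc i)" for i by (rule assms(5)) simp
  then have "(\<forall>i. submod A (K i) \<and> N \<subseteq> K i \<and> K i \<subseteq> M) \<and> (\<forall>i. K i \<subseteq> K (Suc i))" using assms(2,3,4) by simp
  then show ?thesis using assms(1) unfolding noeth_between_def by blast
qed

lemma noeth_between_refl: "noeth_between A M M"
proof (rule nmodI)
  fix K :: "nat \<Rightarrow> 'a set" assume "\<And>i. M \<subseteq> K i" "\<And>i. K i \<subseteq> M"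
  then have "K i = M" for i by blast
  then show "\<exists>m. \<forall>i\<ge>m. K i = K m" by simp
qed

lemma (in sring) noeth_between_add:
  assumes 1: "noeth_between R N L" and 2: "noeth_between R L M" and L: "submod R L" "N \<subseteq> L" "L \<subseteq> M" and M: "submod R M"
  shows "noeth_between R N M"
proof (rule nmodI)
  fix K :: "nat \<Rightarrow> 'a set" assume K: "\<And>i. submod R (K i)" "\<And>i. N \<subseteq> K i" "\<And>i. K i \<subseteq> M" "\<And>i j. i \<le> j \<Longrightarrow> K i \<subseteq> K j"
  have "\<exists>m. \<forall>i\<ge>m. K i \<inter> L = K m \<inter> L"
  proof (rule nmodD[OF 1])
    show "submod R (K i \<inter> L)" for i by (rule submod_Int[OF K(1) L(1)])
    show "N \<subseteq> K i \<inter> L" "K i \<inter> L \<subseteq> L" for i using K(2) L(2) by auto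
    show "K i \<inter> L \<subseteq> K j \<inter> L" if "i \<le> j" for i j using K(4)[OF that] by blast
  qed
  then obtain m1 where m1: "\<And>i. i \<ge> m1 \<Longrightarrow> K i \<inter> L = K m1 \<inter> L" by blast
  have "\<exists>m. \<forall>i\<ge>m. ssum (K i) L = ssum (K m) L"
  proof (rule nmodD[OF 2])
    show "submod R (ssum (K i) L)" for i by (rule ssum_submod[OF K(1) L(1)])
    show "L \<subseteq> ssum (K i) L" for i by (rule ssum_sup2[OF K(1)])
    show "ssum (K i) L \<subseteq> M" for i by (rule ssum_least[OF M K(3) L(3)])
    show "ssum (K i) L \<subseteq> ssum (K j) L" if "i \<le> j" for i j by (rule ssum_mono[OF K(4)[OF that] order_refl])
  qed
  then obtain m2 where m2: "\<And>i. i \<ge> m2 \<Longrightarrow> ssum (K i) L = ssum (K m2) L" by blast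
  let ?m = "max m1 m2"
  have "K i = K ?m" if i: "i \<ge> ?m" for i
  proof
    show "K ?m \<subseteq> K i" by (rule K(4)[OF i])
    show "K i \<subseteq> K ?m"
    proof
      fix z assume z: "z \<in> K i"
      have e1: "K i \<inter> L = K ?m \<inter> L" using m1[of i] m1[of ?m] i by simp
      have e2: "ssum (K i) L = ssum (K ?m) L" using m2[of i] m2[of ?m] i by simp
      have "z \<in> ssum (K i) L" by (rule subsetD[OF ssum_sup1[OF L(1)] z])
      then obtain p q where pq: "z = p + q" "p \<in> K ?m" "q \<in> L" unfolding e2 ssum_iff by blast
      have "p \<in> K i" using pq(2) K(4)[OF i] by blast
      then have "z - p \<in> K i" by (rule submod_diff[OF K(1) z])
      then have "q \<in> K i \<inter> L" using pq by simp
      then have "q \<in> K ?m" unfolding e1 by blast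
      then show "z \<in> K ?m" unfolding pq(1) using submodD(2)[OF K(1) pq(2)] by blast
    qed
  qed
  then show "\<exists>m. \<forall>i\<ge>m. K i = K m" by blast
qed

text \<open>Elements of M' that u carries into N lie in N', so a submodule K between N' and M' is
  recovered from N + uK; chains are transported in this way.\<close>

lemma (in sring) noeth_between_inject:
  assumes 1: "noeth_between R N M" and N: "submod R N" "N \<subseteq> M" and M: "submod R M"
    and u: "\<And>z. z \<in> M' \<Longrightarrow> u * z \<in> M" "\<And>z. z \<in> M' \<Longrightarrow> u * z \<in> N \<Longrightarrow> z \<in> N'"
  shows "noeth_between R N' M'"
proof (rule nmodI)
  fix K :: "nat \<Rightarrow> 'a set" assume K: "\<And>i. submod R (K i)" "\<And>i. N' \<subseteq> K i" "\<And>i. K i \<subseteq> M'" "\<And>i j. i \<le> j \<Longrightarrow> K i \<subseteq> K j"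
  have sm: "submod R ((*) u ` K i)" for i by (rule submod_smult[OF K(1)])
  have "\<exists>m. \<forall>i\<ge>m. ssum N ((*) u ` K i) = ssum N ((*) u ` K m)"
  proof (rule nmodD[OF 1])
    show "submod R (ssum N ((*) u ` K i))" for i by (rule ssum_submod[OF N(1) sm])
    show "N \<subseteq> ssum N ((*) u ` K i)" for i by (rule ssum_sup1[OF sm])
    have "(*) u ` K i \<subseteq> M" for i using u(1) K(3) by blast
    then show "ssum N ((*) u ` K i) \<subseteq> M" for i by (rule ssum_least[OF M N(2)])
    show "ssum N ((*) u ` K i) \<subseteq> ssum N ((*) u ` K j)" if "i \<le> j" for i j by (rule ssum_mono[OF order_refl image_mono[OF K(4)[OF that]]])
  qed
  then obtain m where m: "\<And>i. i \<ge> m \<Longrightarrow> ssum N ((*) u ` K i) = ssum N ((*) u ` K m)" by blast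
  have "K i = K m" if i: "i \<ge> m" for i
  proof
    show "K m \<subseteq> K i" by (rule K(4)[OF i])
    show "K i \<subseteq> K m"
    proof
      fix z assume z: "z \<in> K i"
      then have "u * z \<in> (*) u ` K i" by blast
      then have "u * z \<in> ssum N ((*) u ` K m)" using subsetD[OF ssum_sup2[OF N(1)]] m[OF i] by metis
      then obtain n w where nw: "u * z = n + u * w" "n \<in> N" "w \<in> K m" unfolding ssum_def by blast
      have "w \<in> K i" using nw(3) K(4)[OF i] by blast
      then have "z - w \<in> M'" using submod_diff[OF K(1) z] K(3) by blast
      moreover have "u * (z - w) \<in> N" using nw by (simp add: algebra_simps)
      ultimately have "z - w \<in> K m" using u(2) K(2) by blast
      then have "(z - w) + w \<in> K m" using submodD(2)[OF K(1)] nw(3) by blast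
      then show "z \<in> K m" by simp
    qed
  qed
  then show "\<exists>m. \<forall>i\<ge>m. K i = K m" by blast
qed

text \<open>A chain that stays inside the nonunits of \<open>Or\<close> is constant. Otherwise some
  member contains an element h outside them, and from there on the chain lives above P + hA, where
  \<open>krull_akizuki\<close> bounds the length over D.\<close>

lemma (in regular2) noeth_between_residue:
  assumes D: "sring D" "D \<subseteq> R" and length_le: "length_le D (nonunits R) R l" and A: "sring A" "D \<subseteq> A" "A \<subseteq> Or"
  shows "noeth_between A (A \<inter> nonunits Or) A"
proof (rule nmodI)
  fix K :: "nat \<Rightarrow> 'a set"
  assume K: "\<And>i. submod A (K i)" "\<And>i. A \<inter> nonunits Or \<subseteq> K i" "\<And>i. K i \<subseteq> A" "\<And>i j. i \<le> j \<Longrightarrow> K i \<subseteq> K j"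
  show "\<exists>m. \<forall>i\<ge>m. K i = K m"
  proof (cases "\<forall>i. K i \<subseteq> nonunits Or")
    case True
    then have "K i = A \<inter> nonunits Or" for i using K(2)[of i] K(3)[of i] by blast
    then show ?thesis by simp
  next
    case False
    then obtain i0 h where h: "h \<in> K i0" "h \<notin> nonunits Or" by blast
    obtain n where n: "length_le D (ssum (A \<inter> nonunits Or) ((*) h ` A)) A n" using krull_akizuki[OF D length_le A _ h(2)] h(1) K(3) by blast
    have "\<exists>m. \<forall>i\<ge>m. K (i0 + i) = K (i0 + m)"
    proof (rule length_stable[OF n])
      fix i
      show "submod D (K (i0 + i))" by (rule submod_mono[OF K(1) A(2)])
      have "h \<in> K (i0 + i)" using h(1) K(4)[of i0 "i0 + i"] by auto
      then have "(*) h ` A \<subseteq> K (i0 + i)" using submodD(3)[OF K(1)] by (auto simp: mult.commute)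
      then show "ssum (A \<inter> nonunits Or) ((*) h ` A) \<subseteq> K (i0 + i)" by (rule ssum_least[OF K(1) K(2)])
      show "K (i0 + i) \<subseteq> A" by (rule K(3))
      show "K (i0 + i) \<subseteq> K (i0 + Suc i)" by (rule K(4)) simp
    qed
    then obtain m where m: "\<And>i. i \<ge> m \<Longrightarrow> K (i0 + i) = K (i0 + m)" by blast
    have "K i = K (i0 + m)" if "i \<ge> i0 + m" for i using m[of "i - i0"] that by simp
    then show ?thesis by blast
  qed
qed

text \<open>A prime divisor of the second kind: the order valuation ring of a regular point above D.
  The length condition says that the residue field of the point is finite over that of D.\<close>

definition prime_divisor :: "'a::field set \<Rightarrow> 'a set \<Rightarrow> 'a \<Rightarrow> bool" where
  "prime_divisor D W t \<longleftrightarrow> (\<exists>\<alpha> y l. regular2 \<alpha> t y \<and> dominates D \<alpha> \<and> length_le D (nonunits \<alpha>) \<alpha> l \<and> W = order_ring \<alpha> (y / t))"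

lemma gdvrD:
  assumes "prime_divisor D W t" and D: "sring D"
  shows "dvr W t" "D \<subseteq> W" "nonunits D \<subseteq> nonunits W"
    "sring A \<Longrightarrow> D \<subseteq> A \<Longrightarrow> A \<subseteq> W \<Longrightarrow> noeth_between A (A \<inter> nonunits W) A"
proof -
  obtain \<alpha> y l where a: "regular2 \<alpha> t y" "dominates D \<alpha>" "length_le D (nonunits \<alpha>) \<alpha> l" "W = order_ring \<alpha> (y / t)" using assms(1) unfolding prime_divisor_def by blast
  interpret a: regular2 \<alpha> t y by (rule a(1))
  show "dvr W t" unfolding a(4) by (rule a.O_dvr)
  show "D \<subseteq> W" unfolding a(4) using a(2) a.R_O unfolding dominates_def by blast
  show "nonunits D \<subseteq> nonunits W" unfolding a(4) using a(2) a.nonunit_O unfolding dominates_def by blast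
  show "sring A \<Longrightarrow> D \<subseteq> A \<Longrightarrow> A \<subseteq> W \<Longrightarrow> noeth_between A (A \<inter> nonunits W) A"
    unfolding a(4) by (rule a.noeth_between_residue[OF D _ a(3)]) (use a(2) in \<open>auto simp: dominates_def\<close>)
qed

text \<open>The condition \<open>irred\<close> says that no member of \<open>WW\<close> can be
  omitted. It takes the place of an approximation theorem, as it provides an element that fails to
  be integral at a single W.\<close>

locale overring = D: regular2 D x0 y0 for D :: "'a::field set" and x0 y0 +
  fixes A :: "'a set" and WW :: "'a set set" and tt :: "'a set \<Rightarrow> 'a" and PP :: "'a set"
  assumes fin: "finite WW" and W: "W \<in> WW \<Longrightarrow> prime_divisor D W (tt W)" and P: "p \<in> PP \<Longrightarrow> prime_in D p"
    and A: "A = {z. (\<forall>p\<in>PP. z \<in> localization D p) \<and> (\<forall>W\<in>WW. z \<in> W)}"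
    and irred: "W \<in> WW \<Longrightarrow> \<exists>c. (\<forall>p\<in>PP. c \<in> localization D p) \<and> (\<forall>W'\<in>WW - {W}. c \<in> W') \<and> c \<notin> W"
begin

lemma Wdvr: "w \<in> WW \<Longrightarrow> dvr w (tt w)" and WD: "w \<in> WW \<Longrightarrow> D \<subseteq> w" and Wn: "w \<in> WW \<Longrightarrow> nonunits D \<subseteq> nonunits w"
  using gdvrD(1-3)[OF W D.sring_axioms] by blast+

lemma Psring: "p \<in> PP \<Longrightarrow> sring (localization D p)" and PD: "p \<in> PP \<Longrightarrow> D \<subseteq> localization D p"
  using D.localization_dvr[OF P] dvr.axioms(1) by blast+

lemma Wsring: "w \<in> WW \<Longrightarrow> sring w" using Wdvr dvr.axioms(1) by blast

lemma A_sring: "sring A"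
proof
  show "subring A" unfolding subring_def A
    using sring.zero[OF Psring] sring.one[OF Psring] sring.add[OF Psring] sring.mult[OF Psring] sring.neg[OF Psring]
      sring.zero[OF Wsring] sring.one[OF Wsring] sring.add[OF Wsring] sring.mult[OF Wsring] sring.neg[OF Wsring] by simp
qed

sublocale A: sring A by (rule A_sring)

lemma DA: "D \<subseteq> A" unfolding A using PD WD by blast
lemma AW: "w \<in> WW \<Longrightarrow> A \<subseteq> w" unfolding A by blast

abbreviation "vv w \<equiv> dvr.v w (tt w)"

text \<open>The pole of c has some order e and is corrected by elements of D, which lie in all the
  rings concerned. If \<open>inverse (tt w ^ k) = a / b\<close> and b has value n, then a has value
  n - k, and \<open>a * b ^ (e - 1) * c ^ n\<close> has value (n - k) + (e - 1)n - en = -k.\<close>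

lemma approx:
  assumes w: "w \<in> WW"
  shows "\<exists>u. (\<forall>p\<in>PP. u \<in> localization D p) \<and> (\<forall>W'\<in>WW - {w}. u \<in> W') \<and> u \<noteq> 0 \<and> vv w u = - int k"
proof -
  interpret w: dvr w "tt w" by (rule Wdvr[OF w])
  obtain c where c: "\<forall>p\<in>PP. c \<in> localization D p" "\<forall>W'\<in>WW - {w}. c \<in> W'" "c \<notin> w" using irred[OF w] by blast
  have c0: "c \<noteq> 0" using c(3) by auto
  define e where "e = nat (- w.v c)"
  have ve: "w.v c = - int e" "e \<ge> 1" using w.in_iff[OF c0] c(3) by (auto simp: e_def)
  obtain a b where ab: "a \<in> D" "b \<in> D" "b \<noteq> 0" "inverse (tt w ^ k) = a / b" using D.ex_frac by blast
  have a0: "a \<noteq> 0" using ab w.t0 by auto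
  define n where "n = nat (w.v b)"
  have "b \<in> w" using ab WD[OF w] by blast
  then have vn: "w.v b = int n" using w.in_iff[OF ab(3)] by (simp add: n_def)
  define u where "u = a * b ^ (e - 1) * c ^ n"
  have "w.v (a / b) = - int k" unfolding ab(4)[symmetric] using w.t0 by (simp add: w.v_inverse w.v_pow w.v_t)
  then have va: "w.v a = int n - int k" using w.v_divide[OF a0 ab(3)] vn by simp
  have "w.v u = w.v a + int (e - 1) * w.v b + int n * w.v c"
    unfolding u_def using a0 ab(3) c0 by (simp add: w.v_mult w.v_pow)
  also have "\<dots> = - int k" unfolding va vn ve(1) using ve(2) by (simp add: of_nat_diff algebra_simps)
  finally have "w.v u = - int k" .
  moreover have "u \<noteq> 0" using a0 ab c0 by (simp add: u_def)
  moreover have "u \<in> localization D p" if p: "p \<in> PP" for p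
  proof -
    interpret p: sring "localization D p" by (rule Psring[OF p])
    show ?thesis unfolding u_def using PD[OF p] ab c(1) p by (intro p.mult p.pow) auto
  qed
  moreover have "u \<in> W'" if p: "W' \<in> WW - {w}" for W'
  proof -
    interpret p: sring W' using Wsring p by blast
    show ?thesis unfolding u_def using WD[of W'] ab c(2) p by (intro p.mult p.pow) auto
  qed
  ultimately show ?thesis by blast
qed

definition level :: "('a set \<Rightarrow> nat) \<Rightarrow> 'a set" where
  "level e = {z. (\<forall>p\<in>PP. z \<in> localization D p) \<and> (\<forall>w\<in>WW. z / tt w ^ e w \<in> w)}"

lemma level_le: "level e \<subseteq> A"
proof
  fix z assume z: "z \<in> level e"
  have "z \<in> w" if w: "w \<in> WW" for w
  proof -
    interpret w: dvr w "tt w" by (rule Wdvr[OF w])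
    have "z / tt w ^ e w * tt w ^ e w \<in> w" using z w w.tR unfolding level_def by (intro w.mult w.pow) auto
    then show ?thesis using w.t0 by simp
  qed
  then show "z \<in> A" using z unfolding level_def A by blast
qed

lemma level_submod: "submod A (level e)"
proof (rule submodI)
  show "0 \<in> level e" unfolding level_def using sring.zero[OF Psring] sring.zero[OF Wsring] by simp
  show "a + b \<in> level e" if "a \<in> level e" "b \<in> level e" for a b
    using that sring.add[OF Psring] sring.div_add[OF Wsring] unfolding level_def by simp
  show "r * a \<in> level e" if "r \<in> A" "a \<in> level e" for r a
    using that sring.mult[OF Psring] sring.div_mult(2)[OF Wsring] unfolding level_def A by simp
qed

text \<open>One exponent is lowered from \<open>Suc k\<close> to k at a time. An element u with a
  pole of order k at w and none elsewhere embeds the quotient of the two levels into A modulo the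
  nonunits of w, which is Noetherian by the Krull--Akizuki argument.\<close>

lemma noeth_between_level: "(\<Sum>w\<in>WW. e w) = n \<Longrightarrow> noeth_between A (level e) A"
proof (induction n arbitrary: e)
  case 0
  then have "\<forall>w\<in>WW. e w = 0" using fin by simp
  then have "level e = A" unfolding level_def A by auto
  then show ?case using noeth_between_refl by simp
next
  case (Suc n)
  have "\<exists>w\<in>WW. e w \<noteq> 0"
  proof (rule ccontr)
    assume "\<not> ?thesis" then have "(\<Sum>w\<in>WW. e w) = 0" by simp
    then show False using Suc(2) by simp
  qed
  then obtain w k where w: "w \<in> WW" "e w = Suc k" by (metis not0_implies_Suc)
  interpret w: dvr w "tt w" by (rule Wdvr[OF w(1)])
  define e' where "e' = e(w := k)"
  have "(\<Sum>i\<in>WW. e i) = e w + (\<Sum>i\<in>WW - {w}. e i)" by (rule sum.remove[OF fin w(1)])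
  moreover have "(\<Sum>i\<in>WW. e' i) = e' w + (\<Sum>i\<in>WW - {w}. e' i)" by (rule sum.remove[OF fin w(1)])
  moreover have "(\<Sum>i\<in>WW - {w}. e' i) = (\<Sum>i\<in>WW - {w}. e i)" by (rule sum.cong) (auto simp: e'_def)
  ultimately have "(\<Sum>i\<in>WW. e' i) = n" using Suc(2) w(2) by (simp add: e'_def)
  then have IH: "noeth_between A (level e') A" by (rule Suc.IH)
  obtain u where u: "\<forall>p\<in>PP. u \<in> localization D p" "\<forall>W'\<in>WW - {w}. u \<in> W'" "u \<noteq> 0" "w.v u = - int k" using approx[OF w(1)] by blast
  have tk: "tt w ^ j \<noteq> 0" "w.v (tt w ^ j) = int j" for j using w.t0 by (simp_all add: w.v_pow w.v_t)
  have sub: "level e \<subseteq> level e'"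
  proof
    fix z assume z: "z \<in> level e"
    have "z / tt i ^ e' i \<in> i" if i: "i \<in> WW" for i
    proof (cases "i = w")
      case True
      have "z / tt w ^ Suc k * tt w \<in> w" using z w w.tR unfolding level_def by (intro w.mult) auto
      then show ?thesis using True w.t0 by (simp add: e'_def)
    next
      case False then show ?thesis using z i unfolding level_def by (simp add: e'_def)
    qed
    then show "z \<in> level e'" using z unfolding level_def by blast
  qed
  have "noeth_between A (level e) (level e')"
  proof (rule A.noeth_between_inject[OF gdvrD(4)[OF W[OF w(1)] D.sring_axioms A_sring DA AW[OF w(1)]]])
    have mw: "submod w (nonunits w)"
    proof (rule submodI)
      show "a + b \<in> nonunits w" if "a \<in> nonunits w" "b \<in> nonunits w" for a b
      proof -
        have "a / tt w \<in> w" "b / tt w \<in> w" using that w.nonunit_iff w.div_iff[OF w.t0] w.v_t by auto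
        then have "(a + b) / tt w \<in> w" by (rule w.div_add)
        then show ?thesis using w.nonunit_iff w.div_iff[OF w.t0] w.v_t by auto
      qed
    qed (use w.nonunit_mult2 in auto)
    show "submod A (A \<inter> nonunits w)" by (rule submod_Int[OF A.submod_self submod_mono[OF mw AW[OF w(1)]]])
    show "submod A A" by (rule A.submod_self)
    fix z assume z: "z \<in> level e'"
    then have zw: "z / tt i ^ e' i \<in> i" "z \<in> i" if "i \<in> WW" for i using that level_le AW unfolding level_def by blast+
    have zk: "z = 0 \<or> w.v z \<ge> int k" using zw(1)[OF w(1)] w.div_iff[OF tk(1)] tk(2) by (simp add: e'_def)
    show uz: "u * z \<in> A" unfolding A
    proof (intro CollectI conjI ballI)
      fix p assume "p \<in> PP" then show "u * z \<in> localization D p" using z u(1) sring.mult[OF Psring] unfolding level_def by blast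
    next
      fix i assume i: "i \<in> WW"
      show "u * z \<in> i"
      proof (cases "i = w")
        case True
        have "z = 0 \<or> w.v (u * z) \<ge> 0"
          using zk w.v_mult[OF u(3), of z] u(4) by (cases "z = 0") auto
        then show ?thesis using True w.in_iff[of "u * z"] u(3) by (cases "z = 0") auto
      next
        case False then show ?thesis using sring.mult[OF Wsring[OF i]] u(2) zw(2)[OF i] i by blast
      qed
    qed
    assume un: "u * z \<in> A \<inter> nonunits w"
    have "z = 0 \<or> w.v z \<ge> int (Suc k)"
    proof (cases "z = 0")
      case False
      have "u * z \<in> nonunits w" using un by blast
      then have "w.v (u * z) \<ge> 1" using w.nonunit_iff[of "u * z"] u(3) False by simp
      then show ?thesis using w.v_mult[OF u(3) False] u(4) by simp
    qed simp
    then have "z = 0 \<or> w.v (tt w ^ Suc k) \<le> w.v z" unfolding tk(2) .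
    then have zk: "z / tt w ^ Suc k \<in> w" by (subst w.div_iff[OF tk(1)])
    have "z / tt i ^ e i \<in> i" if i: "i \<in> WW" for i
    proof (cases "i = w")
      case True then show ?thesis using zk w(2) by simp
    next
      case False then show ?thesis using zw(1)[OF i] by (simp add: e'_def)
    qed
    then show "z \<in> level e" using z unfolding level_def by blast
  qed auto
  then show ?case using A.noeth_between_add[OF _ IH level_submod sub level_le A.submod_self] by blast
qed

text \<open>Inverting \<open>g\<close> kills all but the height-one primes of \<open>D\<close>, so an ideal is determined up to
  \<open>g\<close>-torsion by a greatest common divisor in \<open>D\<close>.\<close>
lemma noetherian:
  assumes g: "prime_in D g" "\<And>p. p \<in> PP \<Longrightarrow> 1 / g \<in> localization D p"
  shows "noetherian_ring A"
  unfolding noetherian_ring_def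
proof (intro conjI allI impI)
  show "subring A" by (rule A.sub)
  fix I :: "nat \<Rightarrow> 'a set" assume I: "(\<forall>n. is_ideal (I n) A) \<and> incseq I"
  have Iid: "is_ideal (I n) A" for n using I by blast
  have Ism: "submod A (I n)" "I n \<subseteq> A" for n using Iid by (simp_all add: ideal_submod)
  have Imono: "m \<le> n \<Longrightarrow> I m \<subseteq> I n" for m n using I by (auto dest: incseqD)
  note gg = D.prmD[OF g(1)]
  have gA: "g \<in> A" using gg DA by blast
  show "\<exists>N. \<forall>n\<ge>N. I n = I N"
  proof (cases "\<forall>n. I n \<subseteq> {0}")
    case True
    then have "I n = {0}" for n using submodD(1)[OF Ism(1)[of n]] by blast
    then show ?thesis by simp
  next
    case False
    then obtain k0 i0 where i0: "i0 \<in> I k0" "i0 \<noteq> 0" by blast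
    define U where "U = (\<Union>n. I n)"
    have Um: "r * i \<in> U" if "r \<in> A" "i \<in> U" for r i using that submodD(3)[OF Ism(1)] unfolding U_def by blast
    have Ua: "i + j \<in> U" if ij: "i \<in> U" "j \<in> U" for i j
    proof -
      obtain m n where "i \<in> I m" "j \<in> I n" using ij unfolding U_def by blast
      then have "i \<in> I (max m n)" "j \<in> I (max m n)" using Imono[of m "max m n"] Imono[of n "max m n"] by auto
      then show ?thesis using submodD(2)[OF Ism(1)] unfolding U_def by blast
    qed
    have U0: "0 \<in> U" using submodD(1)[OF Ism(1)] unfolding U_def by blast
    have UA: "U \<subseteq> A" using Ism(2) unfolding U_def by blast
    \<comment> \<open>Elements of D that lie in U up to powers of g; the numerators of all members
      of U are among them. Their greatest common divisor c, multiplied by a power of g, will be the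
      element f of U.\<close>
    define J where "J = {d \<in> D. \<exists>M. g ^ M * d \<in> U}"
    have num: "\<exists>a\<in>J. \<exists>b\<in>D. b \<noteq> 0 \<and> i = a / b \<and> (\<forall>p\<in>PP. b / p \<notin> D)" if i: "i \<in> U" for i
    proof -
      obtain a b where ab: "a \<in> D" "b \<in> D" "b \<noteq> 0" "i = a / b" "coprime_in D a b" using D.ex_coprime by blast
      have "b / p \<notin> D" if p: "p \<in> PP" for p
      proof
        assume bp: "b / p \<in> D"
        note pp = D.prmD[OF P[OF p]]
        have "i \<in> localization D p" using i UA p unfolding A by blast
        then obtain c d where cd: "i = c / d" "c \<in> D" "d \<in> D" "d / p \<notin> D" unfolding localization_def by blast
        have "d \<noteq> 0" using cd(4) by auto
        then have "a * d / p = b / p * c" using cd(1) ab(3,4) by (simp add: field_simps)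
        then have "a * d / p \<in> D" using D.mult[OF bp cd(2)] by (simp only:)
        then have "a / p \<in> D" using pp(5)[OF ab(1) cd(3)] cd(4) by blast
        then show False using D.coprime_prm[OF ab(5) P[OF p]] bp by blast
      qed
      moreover have "g ^ 0 * a \<in> U" using Um[of b i] i ab DA by auto
      then have "a \<in> J" unfolding J_def using ab(1) by blast
      ultimately show ?thesis using ab by blast
    qed
    have Jid: "is_ideal J D"
    proof (rule is_idealI)
      show "J \<subseteq> D" unfolding J_def by blast
      have "g ^ 0 * 0 \<in> U" using U0 by simp
      then show "0 \<in> J" unfolding J_def using D.zero by blast
      fix a b assume "a \<in> J" "b \<in> J"
      then obtain m n where ab: "a \<in> D" "b \<in> D" "g ^ m * a \<in> U" "g ^ n * b \<in> U" unfolding J_def by blast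
      have "g ^ n * (g ^ m * a) + g ^ m * (g ^ n * b) \<in> U" 
        by (rule Ua[OF Um[OF A.pow[OF gA] ab(3)] Um[OF A.pow[OF gA] ab(4)]])
      then have "g ^ (m + n) * (a + b) \<in> U" by (simp add: power_add algebra_simps)
      then show "a + b \<in> J" unfolding J_def using ab by auto
    next
      fix r a assume r: "r \<in> D" "a \<in> J"
      then obtain m where ab: "a \<in> D" "g ^ m * a \<in> U" unfolding J_def by blast
      have "r * (g ^ m * a) \<in> U" by (rule Um[OF subsetD[OF DA r(1)] ab(2)])
      then have "g ^ m * (r * a) \<in> U" by (simp add: mult_ac)
      then show "r * a \<in> J" unfolding J_def using r ab by auto
    qed
    have i0U: "i0 \<in> U" using i0 unfolding U_def by blast
    obtain j0 where j0: "j0 \<in> J" "j0 \<noteq> 0"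
    proof -
      obtain a b where "a \<in> J" "b \<in> D" "b \<noteq> 0" "i0 = a / b" using num[OF i0U] by blast
      then show ?thesis using that[of a] i0 by auto
    qed
    have j0D: "j0 \<in> D" using j0 unfolding J_def by blast
    \<comment> \<open>A minimal b makes \<open>c = j0 / b\<close> a greatest common divisor: every
      \<open>j / c\<close> lies in D, and a further common prime factor p would allow
      \<open>b / p\<close> in place of b.\<close>
    let ?Q = "\<lambda>b. b \<in> D \<and> b \<noteq> 0 \<and> (\<forall>j\<in>J. j / (j0 / b) \<in> D)"
    have "?Q j0" using j0 j0D unfolding J_def by auto
    then obtain b where b: "?Q b" and bmax: "\<And>d. ?Q d \<Longrightarrow> b / d \<in> D \<Longrightarrow> d / b \<in> D"
      by (rule D.principal_max[of ?Q]) blast+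
    define c where "c = j0 / b"
    have c0: "c \<noteq> 0" using j0 b by (simp add: c_def)
    have Jc: "j / c \<in> D" if "j \<in> J" for j using b that by (simp add: c_def)
    let ?J' = "{d \<in> D. d * c \<in> J}"
    have J'id: "is_ideal ?J' D"
    proof -
      have "submod D ({r. r * c \<in> J} \<inter> D)" using Jid submod_Int[OF submod_vimage D.submod_self] by (simp add: ideal_submod)
      moreover have "{r. r * c \<in> J} \<inter> D = ?J'" by blast
      ultimately show ?thesis by (auto simp: ideal_submod)
    qed
    \<comment> \<open>With c divided out, no prime element divides all of J. So the colon ideal (J :
      c) has finite colength, and it contains a power of g.\<close>
    have "\<exists>n. length_le D ?J' D n"
    proof (rule D.length_ex[OF J'id])
      fix p assume p: "prime_in D p"
      note pp = D.prmD[OF p]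
      show "\<exists>j\<in>?J'. j / p \<notin> D"
      proof (rule ccontr)
        assume "\<not> ?thesis"
        then have all: "\<And>j. j \<in> D \<Longrightarrow> j * c \<in> J \<Longrightarrow> j / p \<in> D" by blast
        have jp: "j / c / p \<in> D" if j: "j \<in> J" for j using all[of "j / c"] Jc[OF j] c0 j by simp
        have "j0 / c = b" using j0 b by (simp add: c_def)
        then have bp: "b / p \<in> D" using jp[OF j0(1)] by simp
        have "?Q (b / p)"
        proof (intro conjI ballI bp)
          show "b / p \<noteq> 0" using b pp by simp
          fix j assume "j \<in> J"
          moreover have "j / (j0 / (b / p)) = j / c / p" by (simp add: c_def)
          ultimately show "j / (j0 / (b / p)) \<in> D" using jp by simp
        qed
        moreover have "b / (b / p) \<in> D" using b pp by simp
        ultimately have "b / p / b \<in> D" by (rule bmax)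
        moreover have "b / p / b = 1 / p" using b by simp
        ultimately show False using pp(4) by simp
      qed
    qed
    then obtain nb where "length_le D ?J' D nb" by blast
    then obtain N0 where N0: "g ^ N0 \<in> ?J'" using D.length_power[OF J'id _ gg(1)] by blast
    then have "g ^ N0 * c \<in> J" by blast
    then obtain M where M: "g ^ M * (g ^ N0 * c) \<in> U" unfolding J_def by blast
    define f where "f = g ^ (M + N0) * c"
    have fU: "f \<in> U" using M by (simp add: f_def power_add mult_ac)
    have f0: "f \<noteq> 0" using gg c0 by (simp add: f_def)
    have fA: "f \<in> A" using fU UA by blast
    \<comment> \<open>g has value at least 1 at every w, so this N makes
      \<open>u = g ^ N / f\<close> integral at all of \<open>WW\<close>. At the localizations g is
      invertible and f is c up to powers of g. Together these give uU \<subseteq> A.\<close>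
    define N where "N = (\<Sum>w\<in>WW. nat (vv w f))"
    define u where "u = g ^ N / f"
    have gv: "vv w (g ^ n) \<ge> int n" "g \<in> w" if w: "w \<in> WW" for w n
    proof -
      interpret w: dvr w "tt w" by (rule Wdvr[OF w])
      have gn: "g \<in> nonunits w" using Wn[OF w] gg(1) by blast
      then show "g \<in> w" by (rule w.nonunitD)
      have "w.v g \<ge> 1" using gn w.nonunit_iff gg(3) by blast
      then have "int n * w.v g \<ge> int n * 1" by (intro mult_left_mono) auto
      then show "w.v (g ^ n) \<ge> int n" using w.v_pow[OF gg(3)] by simp
    qed
    have uW: "u \<in> w" if w: "w \<in> WW" for w
    proof -
      interpret w: dvr w "tt w" by (rule Wdvr[OF w])
      have "nat (w.v f) \<le> N" unfolding N_def using fin w by (intro member_le_sum) auto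
      then have "w.v f \<le> w.v (g ^ N)" using gv(1)[OF w, of N] by linarith
      then show ?thesis unfolding u_def using w.div_iff[OF f0] by blast
    qed
    have uP: "u * i \<in> localization D p" if p: "p \<in> PP" and i: "i \<in> U" for p i
    proof -
      interpret p: sring "localization D p" by (rule Psring[OF p])
      obtain a b where ab: "a \<in> J" "b \<in> D" "b \<noteq> 0" "i = a / b" "\<forall>p\<in>PP. b / p \<notin> D" using num[OF i] by blast
      have "a / c / b \<in> localization D p" unfolding localization_def using Jc[OF ab(1)] ab(2,5) p by blast
      moreover have "g ^ N \<in> localization D p" using gg PD[OF p] by (intro p.pow) blast
      moreover have "(1 / g) ^ (M + N0) \<in> localization D p" by (rule p.pow[OF g(2)[OF p]])
      ultimately have "g ^ N * (1 / g) ^ (M + N0) * (a / c / b) \<in> localization D p" by (intro p.mult)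
      moreover have "g ^ N * (1 / g) ^ (M + N0) * (a / c / b) = u * i" unfolding u_def f_def ab(4) by (simp add: power_divide power_add)
      ultimately show ?thesis by simp
    qed
    have uI: "u * i \<in> A" if i: "i \<in> U" for i
      unfolding A using uP[OF _ i] sring.mult[OF Wsring uW] AW UA i by blast
    \<comment> \<open>With these exponents \<open>level e\<close> lies in g^N A, which is ufA. So
      whatever u carries into \<open>level e\<close> lies in fA, and the chain stabilizes once it
      contains f.\<close>
    define e where "e w = nat (vv w (g ^ N))" for w
    have lev: "z / g ^ N \<in> A" if z: "z \<in> level e" for z
      unfolding A
    proof (intro CollectI conjI ballI)
      fix p assume p: "p \<in> PP"
      interpret p: sring "localization D p" by (rule Psring[OF p])
      have "z * (1 / g) ^ N \<in> localization D p" using z p g(2)[OF p] unfolding level_def by (intro p.mult p.pow) auto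
      then show "z / g ^ N \<in> localization D p" by (simp add: power_divide)
    next
      fix w assume w: "w \<in> WW"
      interpret w: dvr w "tt w" by (rule Wdvr[OF w])
      have "z / tt w ^ e w \<in> w" using z w unfolding level_def by blast
      moreover have "tt w ^ e w \<noteq> 0" "w.v (tt w ^ e w) = int (e w)" using w.t0 by (simp_all add: w.v_pow w.v_t)
      moreover have "int (e w) = w.v (g ^ N)" using gv(1)[OF w, of N] by (simp add: e_def)
      ultimately show "z / g ^ N \<in> w" using w.div_iff[of "tt w ^ e w" z] w.div_iff[of "g ^ N" z] gg(3) by simp
    qed
    have "noeth_between A (level e) A" by (rule noeth_between_level[OF refl])
    then have "noeth_between A ((*) f ` A) U"
    proof (rule A.noeth_between_inject[OF _ level_submod level_le A.submod_self])
      show "u * z \<in> A" if "z \<in> U" for z by (rule uI[OF that])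
      show "z \<in> (*) f ` A" if "z \<in> U" "u * z \<in> level e" for z
      proof -
        have "u * z / g ^ N \<in> A" by (rule lev[OF that(2)])
        moreover have "z = f * (u * z / g ^ N)" unfolding u_def using f0 gg(3) by simp
        ultimately show ?thesis by blast
      qed
    qed
    moreover obtain k where k: "f \<in> I k" using fU unfolding U_def by blast
    ultimately have "\<exists>m. \<forall>i\<ge>m. I (k + i) = I (k + m)"
    proof (intro nmodD[of A "(*) f ` A" U "\<lambda>i. I (k + i)"])
      fix i
      show "submod A (I (k + i))" by (rule Ism)
      have "f \<in> I (k + i)" using k Imono[of k "k + i"] by auto
      then show "(*) f ` A \<subseteq> I (k + i)" using submodD(3)[OF Ism(1)] by (auto simp: mult.commute)
      show "I (k + i) \<subseteq> U" unfolding U_def by blast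
      show "I (k + i) \<subseteq> I (k + j)" if "i \<le> j" for j by (rule Imono) (use that in simp)
    qed
    then obtain m where m: "\<And>i. i \<ge> m \<Longrightarrow> I (k + i) = I (k + m)" by blast
    have "I n = I (k + m)" if "n \<ge> k + m" for n using m[of "n - k"] that by simp
    then show ?thesis by blast
  qed
qed

end

text \<open>A case of Heinzer's theorem that a Krull overring of a two-dimensional Noetherian domain is Noetherian.\<close>
theorem overring_noetherian:
  assumes D: "regular2 D x0 y0" and fin: "finite WW" and W: "\<And>W. W \<in> WW \<Longrightarrow> \<exists>t. prime_divisor D W t"
    and A: "A = {z. (\<forall>p. prime_in D p \<longrightarrow> A \<subseteq> localization D p \<longrightarrow> z \<in> localization D p) \<and> (\<forall>W\<in>WW. A \<subseteq> W \<longrightarrow> z \<in> W)}"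
  shows "noetherian_ring A"
proof -
  interpret D: regular2 D x0 y0 by (rule D)
  define PP where "PP = {p. prime_in D p \<and> A \<subseteq> localization D p}"
  define R where "R X = {z. (\<forall>p\<in>PP. z \<in> localization D p) \<and> (\<forall>W\<in>X. z \<in> W)}" for X :: "'a set set"
  define ok where "ok X \<longleftrightarrow> X \<subseteq> WW \<and> R X = A" for X
  have "R {W \<in> WW. A \<subseteq> W} = {z. (\<forall>p. prime_in D p \<longrightarrow> A \<subseteq> localization D p \<longrightarrow> z \<in> localization D p) \<and> (\<forall>W\<in>WW. A \<subseteq> W \<longrightarrow> z \<in> W)}"
    unfolding R_def PP_def by auto
  then have "R {W \<in> WW. A \<subseteq> W} = A" using A by simp
  then have "ok {W \<in> WW. A \<subseteq> W}" unfolding ok_def by blast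
  \<comment> \<open>A subfamily of least cardinality with intersection A is irredundant, as the
    locale \<open>overring\<close> demands.\<close>
  then obtain X where X0: "ok X" "\<forall>Y. ok Y \<longrightarrow> card X \<le> card Y"
    using ex_has_least_nat[of ok _ card] by blast
  then have X: "ok X" "\<And>Y. card Y < card X \<Longrightarrow> \<not> ok Y" by (simp, meson leD)
  have XW: "X \<subseteq> WW" and RX: "R X = A" using X(1) unfolding ok_def by blast+
  have finX: "finite X" by (rule finite_subset[OF XW fin])
  define tt where "tt W = (SOME t. prime_divisor D W t)" for W
  have tt: "prime_divisor D w (tt w)" if "w \<in> X" for w
    unfolding tt_def by (rule someI_ex, rule W, rule subsetD[OF XW that])
  interpret overring D x0 y0 A X tt PP
  proof
    show "A = {z. (\<forall>p\<in>PP. z \<in> localization D p) \<and> (\<forall>W\<in>X. z \<in> W)}" using RX unfolding R_def by simp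
    show "\<exists>c. (\<forall>p\<in>PP. c \<in> localization D p) \<and> (\<forall>W'\<in>X - {W}. c \<in> W') \<and> c \<notin> W" if "W \<in> X" for W
    proof (rule ccontr)
      assume "\<not> ?thesis"
      then have "R (X - {W}) = R X" unfolding R_def by blast
      then have "ok (X - {W})" using RX XW unfolding ok_def by blast
      moreover have "card (X - {W}) < card X" using that finX by (rule card_Diff1_less[rotated])
      ultimately show False using X(2) by blast
    qed
  qed (use finX tt PP_def in auto)
  show ?thesis
  proof (cases "\<forall>p. prime_in D p \<longrightarrow> A \<subseteq> localization D p")
    case True
    then have "A \<subseteq> D" using D.mem_loc by blast
    then have "A = D" using DA by blast
    then show ?thesis using D.noeth by simp
  next
    case False
    then obtain g where g: "prime_in D g" "\<not> A \<subseteq> localization D g" by blast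
    note gg = D.prmD[OF g(1)]
    show ?thesis
    proof (rule noetherian[OF g(1)])
      fix p assume "p \<in> PP"
      then have p: "prime_in D p" "A \<subseteq> localization D p" by (auto simp: PP_def)
      \<comment> \<open>If p divided g, the localization at p would be contained in the one at g,
        which does not contain A.\<close>
      have "g / p \<notin> D"
      proof
        assume gp: "g / p \<in> D"
        have "localization D p \<subseteq> localization D g"
        proof
          fix z assume "z \<in> localization D p"
          then obtain c d where z: "z = c / d" "c \<in> D" "d \<in> D" "d / p \<notin> D" unfolding localization_def by blast
          have "d / g \<notin> D" using D.div_trans[OF gp _ gg(3), of d] z(4) by blast
          then show "z \<in> localization D g" unfolding localization_def using z by blast
        qed
        then show False using p g by blast
      qed
      then show "1 / g \<in> localization D p" unfolding localization_def using D.one gg(2) by blast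
    qed
  qed
qed

text \<open>Valuation rings are integrally closed: if z is not in T, multiplying the integral
  equation by the power n - 1 of \<open>inverse z\<close> expresses z through elements of T.\<close>

lemma normal_inter:
  assumes A: "subring A" and T: "\<And>z. (\<And>T. T \<in> \<T> \<Longrightarrow> z \<in> T) \<Longrightarrow> z \<in> A"
    and v: "\<And>T. T \<in> \<T> \<Longrightarrow> A \<subseteq> T \<and> sring T \<and> (\<forall>z. z \<in> T \<or> inverse z \<in> T)"
  shows "normal_domain A"
  unfolding normal_domain_def
proof (intro conjI ballI impI A)
  fix z assume "integral_over A z"
  then obtain n c where n: "n \<ge> 1" "\<forall>i<n. c i \<in> A" "z ^ n + (\<Sum>i<n. c i * z ^ i) = 0" unfolding integral_over_def by blast
  show "z \<in> A"
  proof (rule T, rule ccontr)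
    fix T assume T: "T \<in> \<T>" "z \<notin> T"
    interpret T: sring T using v[OF T(1)] by blast
    have i: "inverse z \<in> T" and z0: "z \<noteq> 0" using v[OF T(1)] T(2) by auto
    have "inverse z ^ (n - 1) * (z ^ n + (\<Sum>i<n. c i * z ^ i)) = z + (\<Sum>i<n. c i * inverse z ^ (n - 1 - i))"
    proof -
      have "z ^ n = z ^ (n - 1) * z" using n(1) by (metis Suc_diff_1 less_eq_Suc_le One_nat_def power_Suc2)
      then have "inverse z ^ (n - 1) * z ^ n = z" using z0 by (simp add: power_inverse)
      moreover have t: "inverse z ^ (n - 1) * (c i * z ^ i) = c i * inverse z ^ (n - 1 - i)" if "i < n" for i
      proof -
        have "inverse z ^ (n - 1) = inverse z ^ (n - 1 - i) * inverse z ^ i" using that by (simp flip: power_add)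
        then show ?thesis using z0 by (simp add: power_inverse)
      qed
      moreover have "inverse z ^ (n - 1) * (\<Sum>i<n. c i * z ^ i) = (\<Sum>i<n. c i * inverse z ^ (n - 1 - i))"
        unfolding sum_distrib_left by (rule sum.cong) (use t in simp_all)
      ultimately show ?thesis by (simp only: distrib_left)
    qed
    then have "z = - (\<Sum>i<n. c i * inverse z ^ (n - 1 - i))" using n(3) by (simp add: eq_neg_iff_add_eq_0)
    moreover have "- (\<Sum>i<n. c i * inverse z ^ (n - 1 - i)) \<in> T" using n(2) v[OF T(1)] i by (intro T.neg T.setsum T.mult T.pow) auto
    ultimately show False using T(2) by simp
  qed
qed

subsection \<open>Noetherian downsets\<close>

text \<open>Membership in \<open>QD\<close> asks only for inclusion; domination comes from the
  dimension. If the nonunits of R contract to zero, R is the whole field. If they contract to a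
  height-one prime, R contains a discrete valuation ring whose parameter stays a nonunit, against
  \<open>no_dvr\<close>.\<close>

lemma dominates_reg2:
  assumes D: "regular2 D a b" and R: "regular2 R u w" and sub: "D \<subseteq> R" shows "dominates D R"
proof -
  interpret D: regular2 D a b by (rule D)
  interpret R: regular2 R u w by (rule R)
  let ?P = "nonunits R \<inter> D"
  have PD: "?P \<subseteq> nonunits D"
  proof
    fix z assume z: "z \<in> ?P"
    show "z \<in> nonunits D"
    proof (rule ccontr)
      assume "z \<notin> nonunits D"
      then have "z \<noteq> 0" "inverse z \<in> R" using D.unitD[of z] z sub by blast+
      then show False using z by (simp add: nonunits_def)
    qed
  qed
  have P: "prime_ideal ?P D"
  proof (rule prime_idealI)
    show "is_ideal ?P D" unfolding ideal_submod
      using submod_Int[OF submod_mono[OF R.nonunit_submod sub] D.submod_self] by blast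
    show "c \<in> ?P \<or> d \<in> ?P" if "c \<in> D" "d \<in> D" "c * d \<in> ?P" for c d
      using R.nonunit_prime[of c d] that sub by blast
  qed simp_all
  have inv: "inverse d \<in> R" if "d \<in> D" "d \<notin> ?P" for d using R.unitD[of d] that sub by blast
  have "?P = nonunits D"
  proof (rule ccontr)
    assume ne: "?P \<noteq> nonunits D"
    show False
    proof (cases "?P = {0}")
      case True
      obtain c d where cd: "c \<in> D" "d \<in> D" "d \<noteq> 0" "inverse u = c / d" using D.ex_frac by blast
      have "d \<notin> ?P" unfolding True using cd(3) by simp
      then have "inverse d \<in> R" by (rule inv[OF cd(2)])
      then have "c * inverse d \<in> R" using cd(1) sub by (intro R.mult) auto
      then have "inverse u \<in> R" using cd(4) by (simp add: divide_inverse)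
      then show False using R.x_nonunit R.x0 by (simp add: nonunits_def)
    next
      case False
      obtain p where p: "prime_in D p" "?P = {p * r | r. r \<in> D}" using D.prime_principal[OF P False ne] by blast
      note pp = D.prmD[OF p(1)]
      have "localization D p \<subseteq> R"
      proof
        fix z assume "z \<in> localization D p"
        then obtain c d where z: "z = c / d" "c \<in> D" "d \<in> D" "d / p \<notin> D" unfolding localization_def by blast
        have "d \<notin> ?P" unfolding p(2) using z(4) D.dvd_set[OF pp(3)] by blast
        then have "inverse d \<in> R" by (rule inv[OF z(3)])
        then have "c * inverse d \<in> R" using z(2) sub by (intro R.mult) auto
        then show "z \<in> R" using z(1) by (simp add: divide_inverse)
      qed
      moreover have "p * 1 \<in> {p * r | r. r \<in> D}" using D.one by blast
      then have "p \<in> nonunits R" unfolding p(2)[symmetric] by simp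
      ultimately show False using R.no_dvr[OF D.localization_dvr(1)[OF p(1)]] by blast
    qed
  qed
  then show ?thesis using sub unfolding dominates_def by blast
qed

text \<open>The invariant carried along quadratic transforms from D: finite residue length, which
  \<open>prime_divisor\<close> asks for, and control over all height-one localizations, which lets
  membership be tested at rings known in advance.\<close>

definition good_point :: "'a::field set \<Rightarrow> 'a set set \<Rightarrow> 'a set \<Rightarrow> bool" where
  "good_point D WW \<beta> \<longleftrightarrow> (\<exists>u w. regular2 \<beta> u w) \<and> dominates D \<beta> \<and> (\<exists>l. length_le D (nonunits \<beta>) \<beta> l) \<and>
    (\<forall>p. prime_in \<beta> p \<longrightarrow> (\<exists>q. prime_in D q \<and> localization \<beta> p = localization D q) \<or> localization \<beta> p \<in> WW)"

lemma (in regular2) good_self: "good_point R WW R"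
  unfolding good_point_def dominates_def
proof (intro conjI allI impI)
  show "\<exists>u w. regular2 R u w" using regular2_axioms by blast
  show "\<exists>l. length_le R (nonunits R) R l" using length_residue by blast
  show "(\<exists>q. prime_in R q \<and> localization R p = localization R q) \<or> localization R p \<in> WW" if "prime_in R p" for p using that by blast
qed simp_all

lemma good_step:
  assumes D: "sring D" and a: "good_point D WW \<alpha>" and q: "is_transform \<alpha> x y \<beta>" and W: "order_ring \<alpha> (y / x) \<in> WW"
  shows "good_point D WW \<beta>"
proof -
  obtain t g where q: "transform \<alpha> x y \<beta> t g" using q unfolding is_transform_def by blast
  interpret q: transform \<alpha> x y \<beta> t g by (rule q)
  obtain l where l: "length_le D (nonunits \<alpha>) \<alpha> l" and da: "dominates D \<alpha>" using a unfolding good_point_def by blast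
  have lp: "(\<exists>q. prime_in D q \<and> localization \<beta> p = localization D q) \<or> localization \<beta> p \<in> WW" if "prime_in \<beta> p" for p
    using q.localization_prime[OF that] a W unfolding good_point_def by metis
  have "\<exists>l. length_le D (nonunits \<beta>) \<beta> l" using q.residue_bd[OF D _ l] da unfolding dominates_def by blast
  moreover have "dominates D \<beta>" by (rule dominates_trans[OF da q.dominates_ab])
  ultimately show ?thesis unfolding good_point_def using q.b.regular2_axioms lp by blast
qed

text \<open>\<beta> is the intersection of its height-one localizations; each of them contains A and
  is of one of the two kinds at which z is tested.\<close>

lemma good_mem:
  assumes g: "good_point D WW \<beta>" and A: "A \<subseteq> \<beta>"
    and z: "\<And>p. prime_in D p \<Longrightarrow> A \<subseteq> localization D p \<Longrightarrow> z \<in> localization D p" "\<And>W. W \<in> WW \<Longrightarrow> A \<subseteq> W \<Longrightarrow> z \<in> W"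
  shows "z \<in> \<beta>"
proof -
  obtain u w where b: "regular2 \<beta> u w" using g unfolding good_point_def by blast
  interpret b: regular2 \<beta> u w by (rule b)
  show ?thesis
  proof (rule b.mem_loc)
    fix p assume p: "prime_in \<beta> p"
    have "A \<subseteq> localization \<beta> p" using A b.localization_dvr(2)[OF p] by blast
    moreover have "(\<exists>q. prime_in D q \<and> localization \<beta> p = localization D q) \<or> localization \<beta> p \<in> WW" using g p unfolding good_point_def by blast
    ultimately show "z \<in> localization \<beta> p" using z by metis
  qed
qed

lemma valuation_nonu_add:
  assumes v: "valuation_ring R" and a: "a \<in> nonunits R" "b \<in> nonunits R" shows "a + b \<in> nonunits R"
proof -
  interpret sring R using v by unfold_locales (simp add: valuation_ring_def)
  have main: "a + b \<in> nonunits R" if ab: "a \<in> nonunits R" "b \<in> nonunits R" "a / b \<in> R" "b \<noteq> 0" for a b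
  proof -
    have "b * (1 + a / b) \<in> nonunits R" by (rule nonunit_mult[OF ab(2)]) (use ab in simp)
    moreover have "b * (1 + a / b) = a + b" using ab(4) by (simp add: field_simps)
    ultimately show ?thesis by simp
  qed
  show ?thesis
  proof (cases "a = 0 \<or> b = 0")
    case True then show ?thesis using a by auto
  next
    case False
    then have "a / b \<noteq> 0" by simp
    then have "a / b \<in> R \<or> inverse (a / b) \<in> R" using v unfolding valuation_ring_def by blast
    then have "a / b \<in> R \<or> b / a \<in> R" by (simp only: inverse_divide)
    then show ?thesis using main[OF a] main[OF a(2,1)] False by (auto simp: add.commute)
  qed
qed

section \<open>The Zariski topology on local overrings\<close>

lemma zariski_basic:
  assumes "openin (topology_generated_by {{R. X \<subseteq> R} | X. finite X}) G" "R \<in> G"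
  shows "\<exists>X. finite X \<and> X \<subseteq> R \<and> {S. X \<subseteq> S} \<subseteq> (G :: 'a set set)"
proof -
  have "generate_topology_on {{R. X \<subseteq> R} | X. finite X} G" using assms(1) by (simp add: openin_topology_generated_by_iff)
  then show ?thesis using assms(2)
  proof (induction rule: generate_topology_on.induct)
    case Empty then show ?case by simp
  next
    case (Int a b)
    obtain X where X: "finite X" "X \<subseteq> R" "{S. X \<subseteq> S} \<subseteq> a" using Int by blast
    obtain Y where Y: "finite Y" "Y \<subseteq> R" "{S. Y \<subseteq> S} \<subseteq> b" using Int by blast
    have "finite (X \<union> Y) \<and> X \<union> Y \<subseteq> R \<and> {S. X \<union> Y \<subseteq> S} \<subseteq> a \<inter> b" using X Y by auto
    then show ?case by blast
  next
    case (UN K)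
    then obtain k where k: "k \<in> K" "R \<in> k" by blast
    obtain X where X: "finite X" "X \<subseteq> R" "{S. X \<subseteq> S} \<subseteq> k" using UN.IH[OF k] by (elim exE conjE)
    have "{S. X \<subseteq> S} \<subseteq> \<Union> K" using X(3) k(1) by (rule order_trans[OF _ Union_upper])
    then show ?case using X(1,2) by (intro exI[of _ X] conjI)
  next
    case (Basis s) then show ?case by blast
  qed
qed

text \<open>Every point of U has a basic neighbourhood \<open>xf R\<close> inside U. If finitely
  many never covered U, points picked one after another outside those already used would give a
  strictly decreasing sequence of closed sets \<open>C n\<close>.\<close>

lemma quasi_compact:
  assumes V: "V \<subseteq> LD D" and N: "noetherian_space (subtopology (zariski D) V)"
    and U: "openin (subtopology (zariski D) V) U"
  shows "\<exists>XX. finite XX \<and> (\<forall>X\<in>XX. finite X) \<and> U = {R \<in> V. \<exists>X\<in>XX. X \<subseteq> R}"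
proof -
  let ?B = "topology_generated_by {{R. X \<subseteq> R} | X :: 'a set. finite X}"
  let ?T = "subtopology (zariski D) V"
  have T: "?T = subtopology ?B V" unfolding zariski_def using V by (simp add: subtopology_subtopology inf.absorb2)
  have op: "openin ?T {R \<in> V. X \<subseteq> R}" if X: "finite X" for X
  proof -
    have "openin ?B {R. X \<subseteq> R}" by (rule topology_generated_by_Basis) (use X in blast)
    then show ?thesis unfolding T openin_subtopology by (intro exI[of _ "{R. X \<subseteq> R}"]) auto
  qed
  have opU: "openin ?T {R \<in> V. \<exists>X\<in>XX. X \<subseteq> R}" if XX: "\<forall>X\<in>XX. finite X" for XX
  proof -
    have "openin ?T (\<Union>X\<in>XX. {R \<in> V. X \<subseteq> R})" by (rule openin_Union) (use op XX in auto)
    moreover have "(\<Union>X\<in>XX. {R \<in> V. X \<subseteq> R}) = {R \<in> V. \<exists>X\<in>XX. X \<subseteq> R}" by blast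
    ultimately show ?thesis by simp
  qed
  have top: "topspace ?T = V"
  proof
    show "topspace ?T \<subseteq> V" by simp
    have "openin ?T {R \<in> V. {} \<subseteq> R}" by (rule op) simp
    then have "{R \<in> V. {} \<subseteq> R} \<subseteq> topspace ?T" by (rule openin_subset)
    then show "V \<subseteq> topspace ?T" by simp
  qed
  obtain G where G: "openin ?B G" "U = G \<inter> V" using U unfolding T openin_subtopology by blast
  have "\<forall>R\<in>U. \<exists>X. finite X \<and> X \<subseteq> R \<and> (\<forall>S\<in>V. X \<subseteq> S \<longrightarrow> S \<in> U)"
  proof
    fix R assume "R \<in> U"
    then have "R \<in> G" using G(2) by simp
    from zariski_basic[OF G(1) this] obtain X where X: "finite X" "X \<subseteq> R" "{S. X \<subseteq> S} \<subseteq> G" by (elim exE conjE)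
    have "S \<in> U" if "S \<in> V" "X \<subseteq> S" for S using that X(3) G(2) by auto
    then show "\<exists>X. finite X \<and> X \<subseteq> R \<and> (\<forall>S\<in>V. X \<subseteq> S \<longrightarrow> S \<in> U)" using X(1,2) by (intro exI[of _ X]) simp
  qed
  from bchoice[OF this] obtain xf where xf0: "\<forall>R\<in>U. finite (xf R) \<and> xf R \<subseteq> R \<and> (\<forall>S\<in>V. xf R \<subseteq> S \<longrightarrow> S \<in> U)" by (elim exE)
  have xf: "finite (xf R)" "xf R \<subseteq> R" "S \<in> V \<Longrightarrow> xf R \<subseteq> S \<Longrightarrow> S \<in> U" if "R \<in> U" for R S
    using bspec[OF xf0 that] by simp_all
  have UV: "U \<subseteq> V" unfolding G(2) by simp
  show ?thesis
  proof (rule ccontr)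
    assume neg: "\<not> ?thesis"
    have ex: "\<exists>R. R \<in> U \<and> (\<forall>X\<in>xf ` F. \<not> X \<subseteq> R)" if F: "finite F" "F \<subseteq> U" for F
    proof (rule ccontr)
      assume n: "\<not> ?thesis"
      have "U = {R \<in> V. \<exists>X\<in>xf ` F. X \<subseteq> R}"
      proof (intro equalityI subsetI)
        fix R assume R: "R \<in> U"
        have "\<exists>X\<in>xf ` F. X \<subseteq> R"
        proof (rule ccontr)
          assume "\<not> (\<exists>X\<in>xf ` F. X \<subseteq> R)"
          then have "R \<in> U \<and> (\<forall>X\<in>xf ` F. \<not> X \<subseteq> R)" using R by simp
          then show False by (rule notE[OF n, OF exI])
        qed
        then show "R \<in> {R \<in> V. \<exists>X\<in>xf ` F. X \<subseteq> R}" using R UV by (intro CollectI conjI) auto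
      next
        fix S assume "S \<in> {R \<in> V. \<exists>X\<in>xf ` F. X \<subseteq> R}"
        then have S: "S \<in> V" "\<exists>X\<in>xf ` F. X \<subseteq> S" by simp_all
        from S(2) obtain R where "R \<in> F" "xf R \<subseteq> S" by (elim bexE imageE) simp
        then show "S \<in> U" using xf(3)[of R S] F(2) S(1) by (meson subsetD)
      qed
      moreover have "finite (xf ` F)" "\<forall>X\<in>xf ` F. finite X" using F xf(1) by auto
      ultimately have "finite (xf ` F) \<and> (\<forall>X\<in>xf ` F. finite X) \<and> U = {R \<in> V. \<exists>X\<in>xf ` F. X \<subseteq> R}" by (intro conjI)
      then show False by (rule notE[OF neg, OF exI])
    qed
    define pick where "pick F = (SOME R. R \<in> U \<and> (\<forall>X\<in>xf ` F. \<not> X \<subseteq> R))" for F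
    have pick: "pick F \<in> U \<and> (\<forall>X\<in>xf ` F. \<not> X \<subseteq> pick F)" if "finite F" "F \<subseteq> U" for F
      unfolding pick_def by (rule someI_ex[OF ex[OF that]])
    define F where "F n = ((\<lambda>F. insert (pick F) F) ^^ n) {}" for n
    have FS: "F (Suc n) = insert (pick (F n)) (F n)" for n by (simp add: F_def)
    have Fo: "finite (F n) \<and> F n \<subseteq> U" for n
    proof (induction n)
      case 0 then show ?case by (simp add: F_def)
    next
      case (Suc n) then show ?case unfolding FS using pick[of "F n"] by simp
    qed
    define C where "C n = {R \<in> V. \<not> (\<exists>X\<in>xf ` F n. X \<subseteq> R)}" for n
    have "closedin ?T (C n)" for n
    proof -
      have "openin ?T {R \<in> V. \<exists>X\<in>xf ` F n. X \<subseteq> R}" by (rule opU) (use Fo[of n] xf(1) in auto)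
      then have "closedin ?T (topspace ?T - {R \<in> V. \<exists>X\<in>xf ` F n. X \<subseteq> R})" by (rule openin_closedin_eq[THEN iffD1, THEN conjunct2])
      moreover have "topspace ?T - {R \<in> V. \<exists>X\<in>xf ` F n. X \<subseteq> R} = C n" unfolding top C_def by blast
      ultimately show ?thesis by simp
    qed
    moreover have "decseq C"
    proof (rule decseq_SucI)
      fix n show "C (Suc n) \<subseteq> C n" unfolding C_def FS by auto
    qed
    ultimately have "\<exists>N. \<forall>n\<ge>N. C n = C N" using N unfolding noetherian_space_def by blast
    then obtain N where Nn: "\<forall>n\<ge>N. C n = C N" ..
    have e: "C (Suc N) = C N" using Nn[rule_format, of "Suc N"] by simp
    have p: "pick (F N) \<in> U" "\<forall>X\<in>xf ` F N. \<not> X \<subseteq> pick (F N)" using pick[of "F N"] Fo[of N] by simp_all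
    have "pick (F N) \<in> C N" unfolding C_def using p subsetD[OF UV p(1)] by simp
    then have "pick (F N) \<in> C (Suc N)" unfolding e .
    then have "\<not> xf (pick (F N)) \<subseteq> pick (F N)" unfolding C_def FS by simp
    then show False using xf(2)[OF p(1)] by simp
  qed
qed

text \<open>Brings the two kinds of members to a common form: domination is built into
  \<open>LD\<close> for valuation rings and comes from \<open>dominates_reg2\<close> for regular
  ones, whose membership in \<open>LD\<close> then follows.\<close>

lemma QstarD_dom:
  assumes D: "regular2 D a b" and fr: "Defs.frac D = UNIV" and R: "R \<in> QstarD D"
  shows "dominates D R" "R \<in> LD D" "(\<exists>u w. regular2 R u w) \<or> valuation_ring R"
proof -
  interpret D: regular2 D a b by (rule D)
  have "dominates D R \<and> R \<in> LD D \<and> ((\<exists>u w. regular2 R u w) \<or> valuation_ring R)"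
  proof (cases "R \<in> QD D")
    case True
    then obtain u w where DR: "D \<subseteq> R" and r: "regular2 R u w" using QD_iff[OF fr] by blast
    interpret r: regular2 R u w by (rule r)
    have d: "dominates D R" by (rule dominates_reg2[OF D r DR])
    have "nonunits R \<inter> D = nonunits D"
    proof
      show "nonunits D \<subseteq> nonunits R \<inter> D" using d D.nonunitD unfolding dominates_def by blast
      show "nonunits R \<inter> D \<subseteq> nonunits D" using dominates_unit[OF d _ _ D.sring_axioms] by blast
    qed
    then have "R \<in> LD D" unfolding LD_def using r.local DR r.nonunit_maxid D.nonunit_maxid by simp
    then show ?thesis using d r by blast
  next
    case False
    then have v: "R \<in> LD D" "valuation_ring R" using R unfolding QstarD_def by blast+
    interpret r: sring R using v(2) by unfold_locales (simp add: valuation_ring_def)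
    have "max_ideal R = nonunits R" by (rule r.nonunit_max(2)[OF valuation_nonu_add[OF v(2)]])
    then have "nonunits R \<inter> D = nonunits D" "D \<subseteq> R" using v(1) D.nonunit_maxid unfolding LD_def by auto
    then have "dominates D R" unfolding dominates_def by blast
    then show ?thesis using v by blast
  qed
  then show "dominates D R" "R \<in> LD D" "(\<exists>u w. regular2 R u w) \<or> valuation_ring R" by blast+
qed

text \<open>A valuation ring contains one of \<open>y / x\<close> and \<open>x / y\<close>. If it
  also contains the order valuation ring of that chart, maximality makes the two equal; otherwise
  its center on the chart is a closed point and yields a transform.\<close>

lemma next_step:
  assumes a: "regular2 \<alpha> x y" and R: "(\<exists>u w. regular2 R u w) \<or> valuation_ring R" and d: "dominates \<alpha> R" and ne: "R \<noteq> \<alpha>"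
  shows "R = order_ring \<alpha> (y / x) \<or> R = order_ring \<alpha> (x / y) \<or> (\<exists>\<beta>. (is_transform \<alpha> x y \<beta> \<or> is_transform \<alpha> y x \<beta>) \<and> dominates \<beta> R)"
proof (cases "\<exists>u w. regular2 R u w")
  case True then show ?thesis using first_step[OF a _ d ne] by blast
next
  case False
  then have v: "valuation_ring R" using R by blast
  interpret a: regular2 \<alpha> x y by (rule a)
  interpret s: regular2 \<alpha> y x by (rule a.swap)
  have R: "sring R" using v by unfold_locales (simp add: valuation_ring_def)
  have nx: "inverse x \<notin> R" "inverse y \<notin> R" using d a.x_nonunit a.y_nonunit a.x0 a.y0 unfolding dominates_def nonunits_def by blast+
  have "y / x \<noteq> 0" using a.x0 a.y0 by simp
  then have "y / x \<in> R \<or> inverse (y / x) \<in> R" using v unfolding valuation_ring_def by blast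
  then have "y / x \<in> R \<or> x / y \<in> R" by (simp only: inverse_divide)
  then show ?thesis
  proof
    assume t: "y / x \<in> R"
    show ?thesis
    proof (cases "a.Or \<subseteq> R")
      case True then show ?thesis using a.V.maximal[OF sring.sub[OF R] True nx(1)] by blast
    next
      case False then show ?thesis using a.step[OF R valuation_nonu_add[OF v] d t] by blast
    qed
  next
    assume t: "x / y \<in> R"
    show ?thesis
    proof (cases "s.Or \<subseteq> R")
      case True then show ?thesis using s.V.maximal[OF sring.sub[OF R] True nx(2)] by blast
    next
      case False then show ?thesis using s.step[OF R valuation_nonu_add[OF v] d t] by blast
    qed
  qed
qed

theorem theorem5p10:
  fixes D :: "'a::field set" and V U :: "'a set set"
  assumes "subring D"
    and "frac D = UNIV"
    and "regular_local_ring D"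
    and "krull_dim D = 2"
    and "downset D V"
    and "noetherian_space (subtopology (zariski D) V)"
    and "openin (subtopology (zariski D) V) U"
  shows "noetherian_ring (OU U) \<and> normal_domain (OU U)"
proof -
  note fr = assms(2)
  obtain a b where D: "regular2 D a b" using regular_reg2[OF assms(3,4,2)] by blast
  interpret D: regular2 D a b by (rule D)
  have VQ: "V \<subseteq> QstarD D" and down: "\<And>\<alpha> \<beta>. \<alpha> \<in> QstarD D \<Longrightarrow> \<beta> \<in> V \<Longrightarrow> \<alpha> \<subseteq> \<beta> \<Longrightarrow> \<alpha> \<in> V"
    using assms(5) unfolding downset_def by blast+
  note Q = QstarD_dom[OF D fr]
  have VL: "V \<subseteq> LD D" using VQ Q(2) by blast
  obtain XX where XX: "finite XX" "\<forall>X\<in>XX. finite X" "U = {R \<in> V. \<exists>X\<in>XX. X \<subseteq> R}" using quasi_compact[OF VL assms(6,7)] by blast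
  define A where "A = OU U"
  have AU: "A \<subseteq> R" if "R \<in> U" for R using that unfolding A_def OU_def by blast
  have UI: "z \<in> A" if "\<And>R. R \<in> U \<Longrightarrow> z \<in> R" for z using that unfolding A_def OU_def by blast
  \<comment> \<open>The points where some element of the finite description of U is undetermined.
    Any transform that still has to be continued below lies in this finite set.\<close>
  define S where "S = (\<Union>X\<in>XX. \<Union>x\<in>X. base_points x D)"
  have finS: "finite S" unfolding S_def using XX(1,2) base_points_finite[OF D] by blast
  define fr where "fr \<alpha> \<longleftrightarrow> (\<exists>x y. regular2 \<alpha> x y) \<and> dominates D \<alpha> \<and> (\<exists>l. length_le D (nonunits \<alpha>) \<alpha> l)" for \<alpha>
  \<comment> \<open>Parameters are fixed once for each point, because an order ring is written in
    terms of them and \<open>WW\<close> has to be one finite set.\<close>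
  have "\<forall>\<alpha>. \<exists>x y. fr \<alpha> \<longrightarrow> regular2 \<alpha> x y" unfolding fr_def by blast
  then obtain gx gy where gxy: "\<And>\<alpha>. fr \<alpha> \<Longrightarrow> regular2 \<alpha> (gx \<alpha>) (gy \<alpha>)" by metis
  \<comment> \<open>Both charts contribute their order ring, so either one may be used for the next
    transform.\<close>
  define WW where "WW = (\<lambda>\<alpha>. order_ring \<alpha> (gy \<alpha> / gx \<alpha>)) ` {\<alpha> \<in> S. fr \<alpha>} \<union> (\<lambda>\<alpha>. order_ring \<alpha> (gx \<alpha> / gy \<alpha>)) ` {\<alpha> \<in> S. fr \<alpha>}"
  have finW: "finite WW" unfolding WW_def using finS by simp
  have gW: "\<exists>t. prime_divisor D W t" if W: "W \<in> WW" for W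
  proof -
    obtain \<alpha> where al: "fr \<alpha>" "W = order_ring \<alpha> (gy \<alpha> / gx \<alpha>) \<or> W = order_ring \<alpha> (gx \<alpha> / gy \<alpha>)" using W unfolding WW_def by blast
    have "dominates D \<alpha>" "\<exists>l. length_le D (nonunits \<alpha>) \<alpha> l" using al(1) unfolding fr_def by blast+
    then show ?thesis using gxy[OF al(1)] regular2.swap[OF gxy[OF al(1)]] al(2) unfolding prime_divisor_def by blast
  qed
  have UV: "U \<subseteq> V" using XX(3) by blast
  have reach: "z \<in> R" if R: "R \<in> U" and z1: "\<And>p. prime_in D p \<Longrightarrow> A \<subseteq> localization D p \<Longrightarrow> z \<in> localization D p" and z2: "\<And>W. W \<in> WW \<Longrightarrow> A \<subseteq> W \<Longrightarrow> z \<in> W" for R z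
  proof -
    obtain X where X: "X \<in> XX" "X \<subseteq> R" using R XX(3) by blast
    have RV: "R \<in> V" and RQ: "R \<in> QstarD D" using R UV VQ by blast+
    \<comment> \<open>A good point inside R that contains X belongs to V by the downset property,
      hence to U. It therefore contains A, and \<open>good_mem\<close> decides membership of
      z.\<close>
    have inherits: "z \<in> R" if g: "good_point D WW \<beta>" and s: "\<beta> \<subseteq> R" "X \<subseteq> \<beta>" for \<beta>
    proof -
      have "D \<subseteq> \<beta>" "\<exists>u w. regular2 \<beta> u w" using g unfolding good_point_def dominates_def by blast+
      then have "\<beta> \<in> QD D" using QD_iff[OF assms(2)] by blast
      then have "\<beta> \<in> QstarD D" unfolding QstarD_def by (rule UnI1)
      then have "\<beta> \<in> V" using down RV s(1) by blast
      then have "\<beta> \<in> U" using XX(3) X(1) s(2) by blast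
      then have "z \<in> \<beta>" using good_mem[OF g AU z1 z2] by blast
      then show ?thesis using s(1) by blast
    qed
    show ?thesis
    proof (cases "X \<subseteq> D")
      case True
      then show ?thesis using inherits[OF D.good_self] Q(1)[OF RQ] unfolding dominates_def by blast
    next
      case False
      \<comment> \<open>Good points below R that do not yet contain X. Each is a base point of some
        \<open>x \<in> X\<close>: if \<open>inverse x\<close> were in \<alpha>, it would be a
        nonunit there and so a nonunit of R, although x lies in R. Hence G is finite, and one
        transform beyond a maximal member must contain X.\<close>
      define G where "G = {\<alpha>. good_point D WW \<alpha> \<and> dominates \<alpha> R \<and> \<not> X \<subseteq> \<alpha>}"
      have GS: "\<alpha> \<in> S \<and> fr \<alpha>" if al: "\<alpha> \<in> G" for \<alpha>
      proof -
        have g: "good_point D WW \<alpha>" "dominates \<alpha> R" using al unfolding G_def by blast+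
        obtain x where x: "x \<in> X" "x \<notin> \<alpha>" using al unfolding G_def by blast
        obtain u w where r: "regular2 \<alpha> u w" using g(1) unfolding good_point_def by blast
        interpret r: regular2 \<alpha> u w by (rule r)
        have x0: "x \<noteq> 0" using x(2) r.zero by metis
        have "inverse x \<notin> \<alpha>"
        proof
          assume i: "inverse x \<in> \<alpha>"
          then have "inverse x \<in> nonunits \<alpha>" using x(2) unfolding nonunits_def by simp
          then have "inverse x \<in> nonunits R" using g(2) unfolding dominates_def by blast
          then show False using x0 x(1) X(2) unfolding nonunits_def by auto
        qed
        then have "\<alpha> \<in> base_points x D" unfolding base_points_def using g(1) r x(2) unfolding good_point_def by blast
        moreover have "fr \<alpha>" unfolding fr_def using g(1) unfolding good_point_def by blast
        ultimately show ?thesis unfolding S_def using X(1) x(1) by blast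
      qed
      have "finite G" by (rule finite_subset[OF _ finS]) (use GS in blast)
      moreover have "D \<in> G" unfolding G_def using D.good_self Q(1)[OF RQ] False by blast
      ultimately obtain \<alpha> where al: "\<alpha> \<in> G" "\<And>\<beta>. \<beta> \<in> G \<Longrightarrow> \<alpha> \<subseteq> \<beta> \<Longrightarrow> \<alpha> = \<beta>" using finite_has_maximal[of G] by blast
      have g: "good_point D WW \<alpha>" "dominates \<alpha> R" "\<not> X \<subseteq> \<alpha>" using al(1) unfolding G_def by blast+
      have ne: "R \<noteq> \<alpha>" using g(3) X(2) by blast
      let ?x = "gx \<alpha>" and ?y = "gy \<alpha>"
      have aS: "\<alpha> \<in> S" "fr \<alpha>" using GS[OF al(1)] by blast+
      have r: "regular2 \<alpha> ?x ?y" by (rule gxy[OF aS(2)])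
      have W1: "order_ring \<alpha> (?y / ?x) \<in> WW" and W2: "order_ring \<alpha> (?x / ?y) \<in> WW" unfolding WW_def using aS by blast+
      consider "R \<in> WW" | \<beta> where "is_transform \<alpha> ?x ?y \<beta> \<or> is_transform \<alpha> ?y ?x \<beta>" "dominates \<beta> R"
        using next_step[OF r Q(3)[OF RQ] g(2) ne] W1 W2 by blast
      then show ?thesis
      proof cases
        case 1 then show ?thesis using z2 AU[OF R] by blast
      next
        case (2 \<beta>)
        have gb: "good_point D WW \<beta>" using good_step[OF D.sring_axioms g(1) _ W1] good_step[OF D.sring_axioms g(1) _ W2] 2(1) by blast
        obtain x' y' where q: "is_transform \<alpha> x' y' \<beta>" using 2(1) by (elim disjE) (rule that, assumption)+
        have ab: "\<alpha> \<subseteq> \<beta>" using transform_reg(2)[OF q] unfolding dominates_def by (rule conjunct1)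
        have "\<beta> \<notin> G" using al(2)[OF _ ab] transform_reg(3)[OF q] by (intro notI) simp
        then have "X \<subseteq> \<beta>" using gb 2(2) unfolding G_def by blast
        then show ?thesis using inherits[OF gb] 2(2) unfolding dominates_def by blast
      qed
    qed
  qed
  let ?I = "{z. (\<forall>p. prime_in D p \<longrightarrow> A \<subseteq> localization D p \<longrightarrow> z \<in> localization D p) \<and> (\<forall>W\<in>WW. A \<subseteq> W \<longrightarrow> z \<in> W)}"
  have AI: "A = ?I"
  proof
    show "A \<subseteq> ?I" by blast
    show "?I \<subseteq> A" using reach by (intro subsetI UI) blast
  qed
  have noe: "noetherian_ring A" by (rule overring_noetherian[OF D finW gW AI])
  moreover have "normal_domain A"
  proof (rule normal_inter[where \<T> = "{localization D p | p. prime_in D p \<and> A \<subseteq> localization D p} \<union> {W \<in> WW. A \<subseteq> W}"])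
    show "subring A" using noe by (simp add: noetherian_ring_def)
    show "z \<in> A" if "\<And>T. T \<in> {localization D p | p. prime_in D p \<and> A \<subseteq> localization D p} \<union> {W \<in> WW. A \<subseteq> W} \<Longrightarrow> z \<in> T" for z
      by (subst AI) (use that in blast)
    fix T assume T: "T \<in> {localization D p | p. prime_in D p \<and> A \<subseteq> localization D p} \<union> {W \<in> WW. A \<subseteq> W}"
    have "\<exists>t. dvr T t" using T D.localization_dvr(1) gW gdvrD(1)[OF _ D.sring_axioms] by blast
    then obtain t where "dvr T t" by blast
    then interpret T: dvr T t .
    show "A \<subseteq> T \<and> sring T \<and> (\<forall>z. z \<in> T \<or> inverse z \<in> T)" using T T.valuation T.sring_axioms by blast
  qed
  ultimately show ?thesis by (simp add: A_def)
qed

end
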